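(* Let $\theta\in(0,1)$, let $u_\eta\in L^2(Q)$ and $u_c\in BV(Q)$, and let $\Sigma\subset\Pi$ be a nonempty training set. Consider the two-level scheme: Level 1: $(\tilde\alpha,\tilde{\mathscr B})\in\operatorname{arg\,min}\{\|u_c-u_{\alpha,\mathscr B}\|_{L^2(Q)}^2:\ \alpha\in[\theta,1/\theta]^2,\ \mathscr B\in\Sigma\}$; Level 2: $u_{\alpha,\mathscr B}:=\operatorname{arg\,min}\{\|u-u_\eta\|_{L^2(Q)}^2+PGV^2_{\alpha,\mathscr B}(u):\ u\in BV(Q)\}$. Then the scheme admits at least one solution $(\tilde\alpha,\tilde{\mathscr B})\in[\theta,1/\theta]^2\times\Sigma$, and provides an associated optimally reconstructed image $u_{\tilde\alpha,\tilde{\mathscr B}}\in BV(Q)$.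
   Context: Let $N\in\mathbb N$ and $Q:=(-1/2,1/2)^N$. $\mathcal M_b(Q;X)$ denotes the bounded Radon measures on $Q$ with values in $X$, and $|\mu|_{\mathcal M_b(Q;X)}$ the total variation of $\mu$; $Du$ is the distributional gradient; $\mathbb R^2_+$ is the set of vectors with positive entries. First order operators are of the form $\mathscr Bv=\sum_{i=1}^N B^i\frac{\partial}{\partial x_i}v$ for $v\in\mathcal D'(Q;\mathbb R^N)$, with values in $\mathcal D'(Q;\mathbb R^{N\times N})$, i.e. $(\mathscr Bv)_{lj}=\sum_{i,k=1}^N B^i_{ljk}\frac{\partial}{\partial x_i}v_k$ with constant real coefficients $B^i_{ljk}$. Set $\|\mathscr B\|_{\ell^\infty}:=\sum_{i=1}^N\|B^i\|$ ($\|\cdot\|$ the Euclidean norm of the coefficient tensor); $\mathscr B_n\to\mathscr B$ in $\ell^\infty$ means $\|\mathscr B_n-\mathscr B\|_{\ell^\infty}=\sum_i\|B^i_n-B^i\|\to0$. $BV_{\mathscr B}(Q;\mathbb R^N):=\{u\in L^1(Q;\mathbb R^N):\mathscr Bu\in\mathcal M_b(Q;\mathbb R^{N\times N})\}$, with norm $\|u\|_{BV_{\mathscr B}}:=\|u\|_{L^1(Q;\mathbb R^N)}+|\mathscr Bu|_{\mathcal M_b(Q;\mathbb R^{N\times N})}$. $\Pi$ is the collection of such $\mathscr B$ with finite dimensional null-space $\mathcal N(\mathscr B)$ and such that: (1) $BV_{\mathscr B}(Q;\mathbb R^N)$ is a Banach space; (2) for every $u\in BV_{\mathscr B}(Q;\mathbb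 R^N)$ there is $\{u_n\}\subset C^\infty(\overline Q;\mathbb R^N)$ with $u_n\to u$ in $L^1$ and $|\mathscr Bu_n|_{\mathcal M_b}\to|\mathscr Bu|_{\mathcal M_b}$; (3) the injection of $BV_{\mathscr B}(Q;\mathbb R^N)$ into $L^1(Q;\mathbb R^N)$ is compact. A set $\Sigma\subset\Pi$ is a training set if it is closed and bounded in $\ell^\infty$ and its operators satisfy the following compactness property: for all sequences $\mathscr B_n\in\Sigma$ and $v_n$ with $\sup_n\{\|\mathscr B_n\|_{\ell^\infty}+\|v_n\|_{BV_{\mathscr B_n}(Q;\mathbb R^N)}\}<+\infty$ there exist $\mathscr B$ and $v\in BV_{\mathscr B}(Q;\mathbb R^N)$ such that, up to a subsequence, $v_n\to v$ strongly in $L^1(Q;\mathbb R^N)$ and $\mathscr B_nv_n\rightharpoonup^*\mathscr Bv$ weakly* in $\mathcal M_b(Q;\mathbb R^{N\times N})$. For $u\in L^1(Q)$, $\alpha=(\alpha_0,\alpha_1)\in\mathbb R^2_+$, $\mathscr B\in\Pi$, $$PGV^2_{\alpha,\mathscr B}(u):=\inf\{\alpha_0|Du-v|_{\mathcal M_b(Q;\mathbb R^N)}+\alpha_1|\mathscr Bv|_{\mathcal M_b(Q;\mathbb R^{N\times N})}:\ v\in BV_{\mathscr B}(Q;\mathbb R^N)\}.$$ *)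

theory Defs
  imports "HOL-Analysis.Analysis"
begin

text \<open>
  The dimension \<open>N\<close> is the cardinality of the index type \<open>'n\<close>. Elements of \<open>L\<^sup>1(Q)\<close>, \<open>L\<^sup>2(Q)\<close>,
  \<open>BV(Q)\<close> are represented by functions on the whole space of which only the values almost everywhere
  on \<open>Q\<close> are relevant; all norms below are blind to changes outside \<open>Q\<close> and on null sets.
\<close>

definition Q :: "(real^'n) set" where
  "Q = {x. \<forall>i. - 1/2 < x $ i \<and> x $ i < 1/2}"

abbreviation leb_Q :: "(real^'n) measure" where
  "leb_Q \<equiv> lebesgue_on Q"

abbreviation borel_Q :: "(real^'n) set set" where
  "borel_Q \<equiv> sets (restrict_space borel Q)"


section \<open>Lebesgue spaces on \<open>Q\<close>\<close>

definition L1 :: "(real^'n \<Rightarrow> 'x::euclidean_space) set" where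
  "L1 = {v. integrable leb_Q v}"

definition L1_norm :: "(real^'n \<Rightarrow> 'x::euclidean_space) \<Rightarrow> ennreal" where
  "L1_norm v = (\<integral>\<^sup>+x. ennreal (norm (v x)) \<partial>leb_Q)"

definition L2_norm_sq :: "(real^'n \<Rightarrow> real) \<Rightarrow> ennreal" where
  "L2_norm_sq u = (\<integral>\<^sup>+x. ennreal ((u x)\<^sup>2) \<partial>leb_Q)"

definition L2 :: "(real^'n \<Rightarrow> real) set" where
  "L2 = {u. u \<in> borel_measurable leb_Q \<and> L2_norm_sq u < \<infinity>}"


section \<open>Smooth functions and distributions\<close>

definition partial :: "'n \<Rightarrow> (real^'n \<Rightarrow> 'x::real_normed_vector) \<Rightarrow> real^'n \<Rightarrow> 'x" where
  "partial i f x = frechet_derivative f (at x) (axis i 1)"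

primrec partials :: "'n list \<Rightarrow> (real^'n \<Rightarrow> 'x::real_normed_vector) \<Rightarrow> real^'n \<Rightarrow> 'x" where
  "partials [] f = f"
| "partials (i # is) f = partial i (partials is f)"

text \<open>
  Differentiability of all iterated partial derivatives (hence their continuity): this is
  \<open>C\<^sup>\<infinity>(\<real>\<^sup>N)\<close>. Restrictions of such functions to the closed cube make up \<open>C\<^sup>\<infinity>\<close> of the closure of \<open>Q\<close>.
\<close>
definition smooth :: "(real^'n \<Rightarrow> 'x::real_normed_vector) \<Rightarrow> bool" where
  "smooth f \<longleftrightarrow> (\<forall>is x. partials is f differentiable (at x))"

definition test_functions :: "(real^'n \<Rightarrow> real) set" where
  "test_functions = {\<phi>. smooth \<phi> \<and> (\<exists>K. compact K \<and> K \<subseteq> Q \<and> (\<forall>x. x \<notin> K \<longrightarrow> \<phi> x = 0))}"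

text \<open>
  A functional on \<open>C\<^sub>c\<^sup>\<infinity>(Q)\<close> with values in \<open>X\<close> is encoded as a function on all real functions;
  only its values on \<open>test_functions\<close> matter.
\<close>
type_synonym ('n, 'x) functional = "(real^'n \<Rightarrow> real) \<Rightarrow> 'x"

definition distribution :: "('n::finite, 'x::euclidean_space) functional \<Rightarrow> bool" where
  "distribution T \<longleftrightarrow>
     (\<forall>\<phi>\<in>test_functions. \<forall>\<psi>\<in>test_functions. \<forall>a b.
        T (\<lambda>x. a * \<phi> x + b * \<psi> x) = a *\<^sub>R T \<phi> + b *\<^sub>R T \<psi>) \<and>
     (\<forall>K. compact K \<and> K \<subseteq> Q \<longrightarrow>
        (\<exists>C m. \<forall>\<phi>\<in>test_functions. \<forall>M. (\<forall>x. x \<notin> K \<longrightarrow> \<phi> x = 0) \<and>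
            (\<forall>is x. length is \<le> m \<longrightarrow> \<bar>partials is \<phi> x\<bar> \<le> M)
          \<longrightarrow> norm (T \<phi>) \<le> C * M))"

definition regular :: "(real^'n \<Rightarrow> 'x::euclidean_space) \<Rightarrow> ('n, 'x) functional" where
  "regular v \<phi> = (\<integral>x. \<phi> x *\<^sub>R v x \<partial>leb_Q)"

definition distr_partial :: "'n \<Rightarrow> ('n::finite, 'x::euclidean_space) functional \<Rightarrow> ('n, 'x) functional" where
  "distr_partial i T \<phi> = - T (partial i \<phi>)"

definition distr_grad :: "('n::finite, real) functional \<Rightarrow> ('n, real^'n) functional" where
  "distr_grad T \<phi> = (\<chi> i. distr_partial i T \<phi>)"


section \<open>Bounded Radon measures\<close>

text \<open>
  Vector measures are set functions on the Borel subsets of \<open>Q\<close>; values on other sets are irrelevant.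
\<close>
definition total_variation :: "((real^'n) set \<Rightarrow> 'x::euclidean_space) \<Rightarrow> ennreal" where
  "total_variation \<mu> =
     (SUP P \<in> {P. finite P \<and> disjoint P \<and> P \<subseteq> borel_Q}. \<Sum>A\<in>P. ennreal (norm (\<mu> A)))"

text \<open>
  On the open set \<open>Q\<close> of a Euclidean space every countably additive set function of finite
  variation is automatically Radon.
\<close>
definition bounded_Radon :: "((real^'n) set \<Rightarrow> 'x::euclidean_space) \<Rightarrow> bool" where
  "bounded_Radon \<mu> \<longleftrightarrow>
     (\<forall>A::nat \<Rightarrow> (real^'n) set. range A \<subseteq> borel_Q \<and> disjoint_family A
        \<longrightarrow> (\<lambda>i. \<mu> (A i)) sums \<mu> (\<Union>i. A i)) \<and>
     total_variation \<mu> < \<infinity>"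

text \<open>
  Positive part in the Jordan decomposition of a signed measure. Negative values are truncated to
  \<open>0\<close> by \<open>ennreal\<close>, which does not affect the supremum because \<open>B = {}\<close> is admissible.
\<close>
definition positive_part :: "((real^'n) set \<Rightarrow> real) \<Rightarrow> (real^'n) measure" where
  "positive_part \<nu> =
     measure_of Q borel_Q (\<lambda>A. SUP B \<in> {B. B \<in> borel_Q \<and> B \<subseteq> A}. ennreal (\<nu> B))"

definition signed_integral :: "((real^'n) set \<Rightarrow> real) \<Rightarrow> (real^'n \<Rightarrow> real) \<Rightarrow> real" where
  "signed_integral \<nu> \<phi> =
     (\<integral>x. \<phi> x \<partial>positive_part \<nu>) - (\<integral>x. \<phi> x \<partial>positive_part (\<lambda>A. - \<nu> A))"

definition vector_integral ::
    "((real^'n) set \<Rightarrow> 'x::euclidean_space) \<Rightarrow> (real^'n \<Rightarrow> real) \<Rightarrow> 'x" where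
  "vector_integral \<mu> \<phi> = (\<Sum>b\<in>Basis. signed_integral (\<lambda>A. \<mu> A \<bullet> b) \<phi> *\<^sub>R b)"

definition represents ::
    "((real^'n) set \<Rightarrow> 'x::euclidean_space) \<Rightarrow> ('n::finite, 'x) functional \<Rightarrow> bool" where
  "represents \<mu> T \<longleftrightarrow> bounded_Radon \<mu> \<and> (\<forall>\<phi>\<in>test_functions. T \<phi> = vector_integral \<mu> \<phi>)"

text \<open>
  Total variation of a distribution. The representing measure is unique on Borel sets when it
  exists, so the infimum is its total variation; it is \<open>\<infinity>\<close> when the distribution is not a bounded
  Radon measure.
\<close>
definition Mb_norm :: "('n::finite, 'x::euclidean_space) functional \<Rightarrow> ennreal" where
  "Mb_norm T = (INF \<mu> \<in> {\<mu>. represents \<mu> T}. total_variation \<mu>)"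

definition C0 :: "(real^'n \<Rightarrow> real) set" where
  "C0 = {\<phi>. continuous_on Q \<phi> \<and>
            (\<forall>e>0. \<exists>K. compact K \<and> K \<subseteq> Q \<and> (\<forall>x\<in>Q - K. \<bar>\<phi> x\<bar> < e))}"

definition weak_star ::
    "(nat \<Rightarrow> (real^'n) set \<Rightarrow> 'x::euclidean_space) \<Rightarrow> ((real^'n) set \<Rightarrow> 'x) \<Rightarrow> bool" where
  "weak_star \<mu>s \<mu> \<longleftrightarrow>
     (\<forall>\<phi>\<in>C0. (\<lambda>n. vector_integral (\<mu>s n) \<phi>) \<longlonglongrightarrow> vector_integral \<mu> \<phi>)"

definition BV :: "(real^'n \<Rightarrow> real) set" where
  "BV = {u \<in> L1. \<exists>\<mu>. represents \<mu> (distr_grad (regular u))}"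


section \<open>First order operators\<close>

text \<open>The coefficient \<open>B\<^sup>i\<^sub>l\<^sub>j\<^sub>k\<close> is \<open>B $ i $ l $ j $ k\<close>.\<close>
type_synonym 'n operator = "real^'n^'n^'n^'n"

definition apply_op :: "'n::finite operator \<Rightarrow> ('n, real^'n) functional \<Rightarrow> ('n, real^'n^'n) functional" where
  "apply_op B T \<phi> =
     (\<chi> l j. \<Sum>i\<in>UNIV. \<Sum>k\<in>UNIV. B $ i $ l $ j $ k * (distr_partial i T \<phi> $ k))"

definition linf_norm :: "'n::finite operator \<Rightarrow> real" where
  "linf_norm B = (\<Sum>i\<in>UNIV. norm (B $ i))"

definition BV_op :: "'n::finite operator \<Rightarrow> (real^'n \<Rightarrow> real^'n) set" where
  "BV_op B = {v \<in> L1. \<exists>\<mu>. represents \<mu> (apply_op B (regular v))}"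

definition BV_op_norm :: "'n::finite operator \<Rightarrow> (real^'n \<Rightarrow> real^'n) \<Rightarrow> ennreal" where
  "BV_op_norm B v = L1_norm v + Mb_norm (apply_op B (regular v))"

definition null_space :: "'n::finite operator \<Rightarrow> ('n, real^'n) functional set" where
  "null_space B = {T. distribution T \<and> (\<forall>\<phi>\<in>test_functions. apply_op B T \<phi> = 0)}"

text \<open>Distributions are identified when they agree on test functions.\<close>
definition finite_dim_null_space :: "'n::finite operator \<Rightarrow> bool" where
  "finite_dim_null_space B \<longleftrightarrow>
     (\<exists>F. finite F \<and> F \<subseteq> null_space B \<and>
        (\<forall>T\<in>null_space B. \<exists>c. \<forall>\<phi>\<in>test_functions. T \<phi> = (\<Sum>S\<in>F. c S *\<^sub>R S \<phi>)))"

text \<open>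
  \<open>BV_op B\<close> modulo equality almost everywhere is by construction a normed space, so that being a
  Banach space means completeness.
\<close>
definition BV_op_Banach :: "'n::finite operator \<Rightarrow> bool" where
  "BV_op_Banach B \<longleftrightarrow>
     (\<forall>v::nat \<Rightarrow> real^'n \<Rightarrow> real^'n. (\<forall>n. v n \<in> BV_op B) \<and>
        (\<forall>e>0. \<exists>M. \<forall>m\<ge>M. \<forall>n\<ge>M. BV_op_norm B (\<lambda>x. v m x - v n x) < ennreal e) \<longrightarrow>
        (\<exists>w\<in>BV_op B. (\<lambda>n. BV_op_norm B (\<lambda>x. v n x - w x)) \<longlonglongrightarrow> 0))"

definition smooth_approximation :: "'n::finite operator \<Rightarrow> bool" where
  "smooth_approximation B \<longleftrightarrow>
     (\<forall>u\<in>BV_op B. \<exists>us::nat \<Rightarrow> real^'n \<Rightarrow> real^'n. (\<forall>n. smooth (us n)) \<and>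
        (\<lambda>n. L1_norm (\<lambda>x. us n x - u x)) \<longlonglongrightarrow> 0 \<and>
        (\<lambda>n. Mb_norm (apply_op B (regular (us n)))) \<longlonglongrightarrow> Mb_norm (apply_op B (regular u)))"

definition compact_injection :: "'n::finite operator \<Rightarrow> bool" where
  "compact_injection B \<longleftrightarrow>
     (\<forall>v::nat \<Rightarrow> real^'n \<Rightarrow> real^'n. (\<forall>n. v n \<in> BV_op B) \<and> (SUP n. BV_op_norm B (v n)) < \<infinity> \<longrightarrow>
        (\<exists>r w. strict_mono (r::nat \<Rightarrow> nat) \<and> w \<in> L1 \<and>
           (\<lambda>n. L1_norm (\<lambda>x. v (r n) x - w x)) \<longlonglongrightarrow> 0))"

definition Pi_ops :: "'n::finite operator set" where
  "Pi_ops = {B. finite_dim_null_space B \<and> BV_op_Banach B \<and> smooth_approximation B \<and>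
                compact_injection B}"


section \<open>Training sets and the bilevel scheme\<close>

definition linf_closed :: "'n::finite operator set \<Rightarrow> bool" where
  "linf_closed \<Sigma> \<longleftrightarrow>
     (\<forall>Bs B. (\<forall>n::nat. Bs n \<in> \<Sigma>) \<and> (\<lambda>n. linf_norm (Bs n - B)) \<longlonglongrightarrow> 0 \<longrightarrow> B \<in> \<Sigma>)"

definition linf_bounded :: "'n::finite operator set \<Rightarrow> bool" where
  "linf_bounded \<Sigma> \<longleftrightarrow> (\<exists>C. \<forall>B\<in>\<Sigma>. linf_norm B \<le> C)"

definition compactness_property :: "'n::finite operator set \<Rightarrow> bool" where
  "compactness_property \<Sigma> \<longleftrightarrow>
     (\<forall>(Bs::nat \<Rightarrow> 'n operator) (v::nat \<Rightarrow> real^'n \<Rightarrow> real^'n).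
        (\<forall>n. Bs n \<in> \<Sigma> \<and> v n \<in> BV_op (Bs n)) \<and>
        (SUP n. ennreal (linf_norm (Bs n)) + BV_op_norm (Bs n) (v n)) < \<infinity> \<longrightarrow>
        (\<exists>(B::'n operator) w r \<mu>s \<mu>. w \<in> BV_op B \<and> strict_mono (r::nat \<Rightarrow> nat) \<and>
           (\<lambda>n. L1_norm (\<lambda>x. v (r n) x - w x)) \<longlonglongrightarrow> 0 \<and>
           (\<forall>n. represents (\<mu>s n) (apply_op (Bs (r n)) (regular (v (r n))))) \<and>
           represents \<mu> (apply_op B (regular w)) \<and>
           weak_star \<mu>s \<mu>))"

definition training_set :: "'n::finite operator set \<Rightarrow> bool" where
  "training_set \<Sigma> \<longleftrightarrow>
     \<Sigma> \<subseteq> Pi_ops \<and> linf_closed \<Sigma> \<and> linf_bounded \<Sigma> \<and> compactness_property \<Sigma>"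

text \<open>The pair \<open>\<alpha>\<close> is \<open>(\<alpha>\<^sub>0, \<alpha>\<^sub>1)\<close>.\<close>
definition PGV2 :: "real \<times> real \<Rightarrow> 'n::finite operator \<Rightarrow> (real^'n \<Rightarrow> real) \<Rightarrow> ennreal" where
  "PGV2 \<alpha> B u =
     (INF v \<in> BV_op B.
        ennreal (fst \<alpha>) * Mb_norm (\<lambda>\<phi>. distr_grad (regular u) \<phi> - regular v \<phi>)
      + ennreal (snd \<alpha>) * Mb_norm (apply_op B (regular v)))"

definition level2_functional ::
    "(real^'n \<Rightarrow> real) \<Rightarrow> real \<times> real \<Rightarrow> 'n::finite operator \<Rightarrow> (real^'n \<Rightarrow> real) \<Rightarrow> ennreal" where
  "level2_functional u\<eta> \<alpha> B u = L2_norm_sq (\<lambda>x. u x - u\<eta> x) + PGV2 \<alpha> B u"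

definition is_level2_solution ::
    "(real^'n \<Rightarrow> real) \<Rightarrow> real \<times> real \<Rightarrow> 'n::finite operator \<Rightarrow> (real^'n \<Rightarrow> real) \<Rightarrow> bool" where
  "is_level2_solution u\<eta> \<alpha> B u \<longleftrightarrow> is_arg_min (level2_functional u\<eta> \<alpha> B) (\<lambda>u. u \<in> BV) u"

text \<open>A representative of \<open>u\<^sub>\<alpha>\<^sub>,\<^sub>B\<close>, meaningful when the minimizer exists and is unique up to null sets.\<close>
definition reconstruction ::
    "(real^'n \<Rightarrow> real) \<Rightarrow> real \<times> real \<Rightarrow> 'n::finite operator \<Rightarrow> real^'n \<Rightarrow> real" where
  "reconstruction u\<eta> \<alpha> B = arg_min (level2_functional u\<eta> \<alpha> B) (\<lambda>u. u \<in> BV)"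

definition level1_cost ::
    "(real^'n \<Rightarrow> real) \<Rightarrow> (real^'n \<Rightarrow> real) \<Rightarrow> (real \<times> real) \<times> 'n::finite operator \<Rightarrow> ennreal" where
  "level1_cost uc u\<eta> p = L2_norm_sq (\<lambda>x. uc x - reconstruction u\<eta> (fst p) (snd p) x)"

end

theory Submission
  imports Defs
    "HOL-Computational_Algebra.Polynomial"
    "HOL-Real_Asymp.Real_Asymp"
    "HOL-Probability.Helly_Selection"
begin

text \<open>
  For fixed weights and a fixed operator the lower level functional is a strictly convex fidelity term
  plus a convex seminorm, so its minimizer is unique. Everything else rests on one compactness
  statement, \<open>level2_limit\<close>: if weights, operators and functions \<open>u n\<close> vary such that weights and operators
  converge while energy and upper level cost of \<open>u n\<close> stay below convergent bounds, then some function in \<open>BV\<close>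
  has energy (for the limit weights and operator) and cost at most the limits of these bounds. With constant weights and operator
  this yields lower level minimizers. For the upper level one takes a minimizing sequence of weights
  and operators, which lie in a compact set. The limit function produced by \<open>level2_limit\<close> is the
  reconstruction for the limit parameters, since \<open>level2_functional_upper_semicontinuous\<close> shows that no
  competitor has smaller energy: by smooth approximation a competitor may use a smooth auxiliary field, which is
  admissible for all operators with energy depending continuously on the operator.

  The proof of \<open>level2_limit\<close> has three ingredients. First, the auxiliary fields are bounded in \<open>L\<^sup>1\<close>
  (\<open>auxiliary_fields_bounded\<close>). If not, normalize them; the compactness property of the training set gives a
  limit of norm one, but this limit is also the distributional limit of gradients of functions tending to
  zero, hence zero by \<open>fundamental_lemma\<close>. So the fields converge strongly along a subsequence, by the
  compactness property again. Secondly, the functions \<open>u n\<close> are only bounded in \<open>L\<^sup>2\<close>; strong convergence is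
  obtained for averages of the tails of the sequence, by the parallelogram law (\<open>mazur_midpoint\<close>). As all quantities involved are
  convex, nothing is lost by averaging, provided that images, fields and the distributions \<open>B\<^sub>n v\<^sub>n\<close> are
  averaged simultaneously. Thirdly, the measure norm of distributions is lower semicontinuous under pointwise
  convergence on test functions (\<open>Mb_norm_lower_semicontinuous\<close>). In particular the limit distribution is
  again a measure, which puts the limit function into \<open>BV\<close> and the limit field into the domain of the limit operator.

  The last point is weak compactness of bounded vector measures (\<open>represents_limit\<close>). It is reduced to
  Helly's selection theorem on the real line: discretize the measures, regard them as positive measures on
  positions and directions of the mass, and transport these to the line by a space-filling curve.
\<close>

section \<open>Smooth functions\<close>

lemma partials_closed:
  assumes "f \<in> C" and "\<And>i g. g \<in> C \<Longrightarrow> partial i g \<in> C"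
  shows "partials is f \<in> C"
  using assms by (induction "is") auto

text \<open>
  Smoothness is the largest property that implies differentiability and is inherited by partial
  derivatives. A class of functions with these two closure properties therefore consists of smooth
  functions; below such a class takes the place of formulas for iterated derivatives.
\<close>
lemma smooth_coinduct:
  assumes "f \<in> C" and "\<And>g x. g \<in> C \<Longrightarrow> g differentiable (at x)"
    and "\<And>i g. g \<in> C \<Longrightarrow> partial i g \<in> C"
  shows "smooth f"
  unfolding smooth_def using partials_closed[of f C] assms by blast

lemma partials_snoc: "partials (is @ [i]) f = partials is (partial i f)"
  by (induction "is") auto

lemma smooth_partial: "smooth f \<Longrightarrow> smooth (partial i f)"
  unfolding smooth_def by (metis partials_snoc)

lemma smooth_differentiable: "smooth f \<Longrightarrow> f differentiable (at x)"
  unfolding smooth_def by (metis partials.simps(1))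

lemma smooth_continuous_on: "smooth f \<Longrightarrow> continuous_on S f"
  by (meson continuous_at_imp_continuous_on differentiable_imp_continuous_within smooth_differentiable)

lemma partial_eqI: "(f has_derivative f') (at x) \<Longrightarrow> partial i f x = f' (axis i 1)"
  unfolding partial_def using frechet_derivative_at by metis

lemma partial_scaleR:
  assumes "f differentiable (at x)" "g differentiable (at x)"
  shows "partial i (\<lambda>x. f x *\<^sub>R g x) x = f x *\<^sub>R partial i g x + partial i f x *\<^sub>R g x"
proof -
  have "((\<lambda>x. f x *\<^sub>R g x) has_derivative
      (\<lambda>h. f x *\<^sub>R frechet_derivative g (at x) h + frechet_derivative f (at x) h *\<^sub>R g x)) (at x)"
    using assms by (intro has_derivative_scaleR) (auto simp: frechet_derivative_works)
  from partial_eqI[OF this] show ?thesis by (simp add: partial_def)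
qed

lemma partial_add:
  assumes "f differentiable (at x)" "g differentiable (at x)"
  shows "partial i (\<lambda>x. f x + g x) x = partial i f x + partial i g x"
proof -
  have "((\<lambda>x. f x + g x) has_derivative
      (\<lambda>h. frechet_derivative f (at x) h + frechet_derivative g (at x) h)) (at x)"
    using assms by (intro has_derivative_add) (auto simp: frechet_derivative_works)
  from partial_eqI[OF this] show ?thesis by (simp add: partial_def)
qed

text \<open>
  The partial derivative of a product is a sum of two products; finite sums are included in order to
  have a class that is closed under partial derivatives.
\<close>
inductive_set scaleR_span :: "(real^'n \<Rightarrow> 'x::real_normed_vector) set" where
  prod: "smooth f \<Longrightarrow> smooth g \<Longrightarrow> (\<lambda>x. f x *\<^sub>R g x) \<in> scaleR_span"
| sum: "g \<in> scaleR_span \<Longrightarrow> h \<in> scaleR_span \<Longrightarrow> (\<lambda>x. g x + h x) \<in> scaleR_span"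

lemma scaleR_span_differentiable: "g \<in> scaleR_span \<Longrightarrow> g differentiable (at x)"
  by (induction rule: scaleR_span.induct)
     (auto intro!: differentiable_add differentiable_scaleR intro: smooth_differentiable)

lemma scaleR_span_partial: "g \<in> scaleR_span \<Longrightarrow> partial i g \<in> scaleR_span"
proof (induction rule: scaleR_span.induct)
  case (prod f g)
  have "partial i (\<lambda>x. f x *\<^sub>R g x) = (\<lambda>x. f x *\<^sub>R partial i g x + partial i f x *\<^sub>R g x)"
    using prod by (intro ext partial_scaleR smooth_differentiable)
  then show ?case using prod by (auto intro!: scaleR_span.intros smooth_partial)
next
  case (sum g h)
  have "partial i (\<lambda>x. g x + h x) = (\<lambda>x. partial i g x + partial i h x)"
    using sum by (intro ext partial_add scaleR_span_differentiable)
  then show ?case using sum by (auto intro!: scaleR_span.intros)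
qed

lemma smooth_scaleR: "smooth f \<Longrightarrow> smooth g \<Longrightarrow> smooth (\<lambda>x. f x *\<^sub>R g x)"
  by (rule smooth_coinduct[of _ scaleR_span])
     (auto intro: scaleR_span.prod scaleR_span_differentiable scaleR_span_partial)

lemma smooth_mult: "smooth f \<Longrightarrow> smooth g \<Longrightarrow> smooth (\<lambda>x. f x * g x :: real)"
  using smooth_scaleR[of f g] by simp

lemma smooth_const: "smooth (\<lambda>x::real^'n. c :: 'x::real_normed_vector)"
proof (rule smooth_coinduct[of _ "range (\<lambda>c x. c)"])
  fix i and g :: "real^'n \<Rightarrow> 'x" assume "g \<in> range (\<lambda>c x. c)"
  then obtain c where g: "g = (\<lambda>x. c)" by auto
  have "partial i g = (\<lambda>x. 0)"
    unfolding g by (intro ext partial_eqI) simp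
  then show "partial i g \<in> range (\<lambda>c x. c)" by auto
qed auto

lemma smooth_prod: "(\<And>i. i \<in> I \<Longrightarrow> smooth (f i)) \<Longrightarrow> smooth (\<lambda>x. \<Prod>i\<in>I. f i x :: real)"
  by (induction I rule: infinite_finite_induct) (auto intro: smooth_const smooth_mult)

text \<open>
  For \<open>p = 1\<close> this is the classical function \<open>exp (- 1 / t)\<close>, extended by zero. Differentiation multiplies it
  by polynomials in \<open>1 / t\<close>; with these factors included the family is closed under derivatives.
\<close>
definition flat :: "real poly \<Rightarrow> real \<Rightarrow> real" where
  "flat p t = (if t > 0 then poly p (1/t) * exp (- (1/t)) else 0)"

lemma poly_mult_exp_decay: "((\<lambda>s. poly p s * exp (- s)) \<longlongrightarrow> (0::real)) at_top"
proof -
  have "((\<lambda>s. \<Sum>i\<le>degree p. coeff p i * (s ^ i / exp s)) \<longlongrightarrow> (\<Sum>i\<le>degree p. coeff p i * 0)) at_top"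
    by (intro tendsto_intros tendsto_power_div_exp_0)
  moreover have "(\<lambda>s. \<Sum>i\<le>degree p. coeff p i * (s ^ i / exp s)) = (\<lambda>s. poly p s * exp (- s))"
    by (auto simp: poly_altdef exp_minus field_simps sum_distrib_right sum_divide_distrib)
  ultimately show ?thesis by simp
qed

text \<open>
  The only delicate point is \<open>t = 0\<close>: there the difference quotient \<open>flat p t / t\<close> is again a polynomial in
  \<open>1 / t\<close> times \<open>exp (- 1 / t)\<close>, and the exponential wins.
\<close>
lemma DERIV_flat:
  "(flat p has_real_derivative flat ([:0, 0, 1:] * (p - pderiv p)) t) (at t)"
proof (cases t "0::real" rule: linorder_cases)
  case less
  have "((\<lambda>t. 0) has_real_derivative 0) (at t)" by simp
  then have "(flat p has_real_derivative 0) (at t)"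
    by (rule DERIV_cong_ev[THEN iffD1, rotated 3])
       (use less eventually_nhds_in_open[of "{..<0::real}" t] in \<open>auto simp: flat_def elim!: eventually_mono\<close>)
  then show ?thesis using less by (simp add: flat_def)
next
  case greater
  have "((\<lambda>t. poly p (1/t) * exp (- (1/t))) has_real_derivative
      (poly (pderiv p) (1/t) * (- 1/t^2) * exp (- (1/t)) + exp (-(1/t)) * (1/t^2) * poly p (1/t))) (at t)"
    using greater
    by (auto intro!: derivative_eq_intros simp: power2_eq_square field_simps)
  then have "(flat p has_real_derivative
      (poly (pderiv p) (1/t) * (- 1/t^2) * exp (- (1/t)) + exp (-(1/t)) * (1/t^2) * poly p (1/t))) (at t)"
    by (rule DERIV_cong_ev[THEN iffD1, rotated 3])
       (use greater eventually_nhds_in_open[of "{0<..}" t] in \<open>auto simp: flat_def elim!: eventually_mono\<close>)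
  moreover have "poly (pderiv p) (1/t) * (- 1/t^2) * exp (- (1/t)) + exp (-(1/t)) * (1/t^2) * poly p (1/t)
    = flat ([:0, 0, 1:] * (p - pderiv p)) t"
    using greater by (simp add: flat_def power2_eq_square field_simps)
  ultimately show ?thesis by simp
next
  case equal
  have "((\<lambda>t. flat p t / t) \<longlongrightarrow> 0) (at_right 0)"
  proof -
    have "((\<lambda>t. poly ([:0,1:] * p) (inverse t) * exp (- inverse t)) \<longlongrightarrow> 0) (at_right (0::real))"
      by (rule filterlim_compose[OF poly_mult_exp_decay filterlim_inverse_at_top_right])
    then show ?thesis
      by (rule Lim_transform_eventually)
         (auto simp: eventually_at_filter flat_def field_simps)
  qed
  moreover have "((\<lambda>t. flat p t / t) \<longlongrightarrow> 0) (at_left 0)"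
    by (rule Lim_transform_eventually[OF tendsto_const])
       (auto simp: eventually_at_filter flat_def)
  ultimately have "((\<lambda>t. flat p t / t) \<longlongrightarrow> 0) (at 0)"
    by (rule filterlim_split_at[rotated])
  then show ?thesis
    using equal by (simp add: has_field_derivative_iff flat_def)
qed

lemma smooth_flat_affine:
  fixes i :: "'n::finite"
  shows "smooth (\<lambda>x::real^'n. flat p (c * x $ i + d))"
proof (rule smooth_coinduct[of _ "{\<lambda>x. k * flat p (c * x $ i + d) | k p. True}"])
  have D: "((\<lambda>x::real^'n. k * flat p (c * x $ i + d)) has_derivative
       (\<lambda>h. k * (flat ([:0, 0, 1:] * (p - pderiv p)) (c * x $ i + d) * (c * h $ i)))) (at x)" for k p x
  proof -
    have "((\<lambda>x::real^'n. c * x $ i + d) has_derivative (\<lambda>h. c * h $ i)) (at x)"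
      by (auto intro!: derivative_eq_intros bounded_linear_imp_has_derivative bounded_linear_vec_nth)
    from has_derivative_compose[OF this DERIV_flat[unfolded has_field_derivative_def, of p]]
    show ?thesis by (intro has_derivative_mult_right) (simp add: mult_ac)
  qed
  show "g differentiable at x" if "g \<in> {\<lambda>x. k * flat p (c * x $ i + d) | k p. True}" for g and x :: "real^'n"
    using that D unfolding differentiable_def by blast
  show "partial j g \<in> {\<lambda>x. k * flat p (c * x $ i + d) | k p. True}"
    if "g \<in> {\<lambda>x. k * flat p (c * x $ i + d) | k p. True}" for j and g :: "real^'n \<Rightarrow> real"
  proof -
    from that obtain k p where g: "g = (\<lambda>x. k * flat p (c * x $ i + d))" by auto
    have "partial j g = (\<lambda>x. (if i = j then k * c else 0) * flat ([:0, 0, 1:] * (p - pderiv p)) (c * x $ i + d))"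
      unfolding g by (intro ext, subst partial_eqI[OF D]) (auto simp: axis_def)
    then show ?thesis by blast
  qed
  have "(\<lambda>x::real^'n. flat p (c * x $ i + d)) = (\<lambda>x. 1 * flat p (c * x $ i + d))" by simp
  then show "(\<lambda>x::real^'n. flat p (c * x $ i + d)) \<in> {\<lambda>x. k * flat p (c * x $ i + d) | k p. True}"
    by blast
qed

section \<open>Test functions on the cube\<close>

lemma Q_box: "Q = (box (\<chi> i. - 1/2) (\<chi> i. 1/2) :: (real^'n) set)"
  by (auto simp: Q_def mem_box_cart)

lemma open_Q: "open (Q :: (real^'n) set)"
  and bounded_Q: "bounded (Q :: (real^'n) set)"
  unfolding Q_box by (rule open_box, rule bounded_box)

lemma borel_Q_iff: "A \<in> borel_Q \<longleftrightarrow> A \<subseteq> Q \<and> A \<in> sets (borel :: (real^'n) measure)"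
  using borel_open[OF open_Q] by (subst sets_restrict_space_iff) auto

lemma sets_Q_lebesgue: "(Q :: (real^'n) set) \<in> sets lebesgue"
  using borel_open[OF open_Q] by (intro sets_completionI_sets) simp

lemma space_leb_Q: "space (leb_Q :: (real^'n) measure) = Q"
  by (simp add: space_restrict_space)

lemma finite_measure_leb_Q: "finite_measure (leb_Q :: (real^'n) measure)"
proof (rule finite_measureI)
  have "emeasure lborel (Q :: (real^'n) set) < \<infinity>"
    by (simp add: Q_box emeasure_lborel_box_eq)
  then show "emeasure (leb_Q :: (real^'n) measure) (space leb_Q) \<noteq> \<infinity>"
    by (simp add: emeasure_restrict_space sets_Q_lebesgue space_restrict_space open_Q borel_open)
qed

lemma borel_measurable_leb_Q: "f \<in> borel_measurable borel \<Longrightarrow> f \<in> borel_measurable (leb_Q :: (real^'n) measure)"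
  by (intro measurable_restrict_space1 measurable_completion) simp

lemma test_smooth: "\<phi> \<in> test_functions \<Longrightarrow> smooth \<phi>"
  by (simp add: test_functions_def)

lemma test_continuous_on: "\<phi> \<in> test_functions \<Longrightarrow> continuous_on S \<phi>"
  by (intro smooth_continuous_on test_smooth)

lemma test_borel: "\<phi> \<in> test_functions \<Longrightarrow> \<phi> \<in> borel_measurable borel"
  by (intro borel_measurable_continuous_onI test_continuous_on)

lemma test_support:
  assumes "\<phi> \<in> test_functions"
  obtains K where "compact K" "K \<subseteq> Q" "\<And>x. x \<notin> K \<Longrightarrow> \<phi> x = 0"
  using assms by (auto simp: test_functions_def)

lemma test_zero: "\<phi> \<in> test_functions \<Longrightarrow> x \<notin> Q \<Longrightarrow> \<phi> x = 0"
  by (auto elim: test_support)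

lemma test_bounded:
  assumes "\<phi> \<in> test_functions"
  obtains M where "M \<ge> 0" "\<And>x. \<bar>\<phi> x\<bar> \<le> M"
proof -
  obtain K where K: "compact K" "K \<subseteq> Q" "\<And>x. x \<notin> K \<Longrightarrow> \<phi> x = 0"
    using test_support[OF assms] by blast
  have "bounded (\<phi> ` K)"
    by (intro compact_imp_bounded compact_continuous_image K test_continuous_on assms)
  then obtain M where M: "\<And>x. x \<in> K \<Longrightarrow> \<bar>\<phi> x\<bar> \<le> M"
    by (auto simp: bounded_iff)
  show thesis
  proof (rule that[of "max M 0"])
    show "\<bar>\<phi> x\<bar> \<le> max M 0" for x
      using M[of x] K(3)[of x] by (cases "x \<in> K") auto
  qed simp
qed

text \<open>
  The complement of a compact set is open, so that a function vanishing there has vanishing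
  derivatives there as well. In particular partial derivatives of test functions are test functions.
\<close>
lemma partial_eq_0:
  assumes "compact K" "\<And>x. x \<notin> K \<Longrightarrow> f x = 0" "x \<notin> K"
  shows "partial i f x = 0"
proof -
  have "((\<lambda>x. 0) has_derivative (\<lambda>h. 0)) (at x)" by simp
  then have "(f has_derivative (\<lambda>h. 0)) (at x)"
    by (rule has_derivative_transform_within_open[of _ _ _ _ "-K"])
       (use assms compact_imp_closed in auto)
  from partial_eqI[OF this] show ?thesis .
qed

lemma test_partial:
  assumes "\<phi> \<in> test_functions"
  shows "partial i \<phi> \<in> test_functions"
proof -
  obtain K where "compact K" "K \<subseteq> Q" "\<And>x. x \<notin> K \<Longrightarrow> \<phi> x = 0"
    using test_support[OF assms] by blast
  then show ?thesis
    using smooth_partial[OF test_smooth[OF assms]] partial_eq_0[of K \<phi>]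
    unfolding test_functions_def by blast
qed

lemma test_regular_integrable:
  assumes "\<phi> \<in> test_functions" "v \<in> L1"
  shows "integrable leb_Q (\<lambda>x. \<phi> x *\<^sub>R v x)"
proof -
  obtain M where M: "\<And>x. \<bar>\<phi> x\<bar> \<le> M" using test_bounded[OF assms(1)] by metis
  have v: "integrable leb_Q v" using assms(2) by (simp add: L1_def)
  show ?thesis
  proof (rule Bochner_Integration.integrable_bound[where f="\<lambda>x. M *\<^sub>R norm (v x)"])
    show "(\<lambda>x. \<phi> x *\<^sub>R v x) \<in> borel_measurable leb_Q"
      by (intro borel_measurable_scaleR borel_measurable_leb_Q test_borel assms borel_measurable_integrable v)
    have "\<bar>\<phi> x\<bar> * norm (v x) \<le> \<bar>M\<bar> * norm (v x)" for x
      by (intro mult_right_mono order_trans[OF M]) auto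
    then show "AE x in leb_Q. norm (\<phi> x *\<^sub>R v x) \<le> norm (M *\<^sub>R norm (v x))"
      by (simp add: abs_mult)
  qed (use v in simp)
qed

section \<open>The fundamental lemma of the calculus of variations\<close>

text \<open>
  A product of one-sided cut-offs, two for each coordinate. The shift by \<open>1\<close> keeps the support at
  distance \<open>1 / k\<close> from the faces of the box: it is compact in \<open>Q\<close> even if the box touches the boundary of \<open>Q\<close>.
  The factor \<open>k\<close> makes the functions converge to the indicator of the open box.
\<close>
definition bump :: "real^'n \<Rightarrow> real^'n \<Rightarrow> nat \<Rightarrow> real^'n \<Rightarrow> real" where
  "bump a b k x = (\<Prod>i\<in>UNIV. flat 1 (real k * (x $ i - a $ i) - 1) * flat 1 (real k * (b $ i - x $ i) - 1))"

lemma flat_1_bounds: "0 \<le> flat 1 t" "flat 1 t \<le> 1"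
  by (auto simp: flat_def)

lemma bump_bounds: "0 \<le> bump a b k x" "bump a b k x \<le> 1"
  unfolding bump_def by (auto intro!: prod_nonneg prod_le_1 mult_le_one mult_nonneg_nonneg simp: flat_1_bounds)

lemma bump_tendsto:
  fixes x :: "real^'n"
  shows "(\<lambda>k. bump a b k x) \<longlonglongrightarrow> indicator (box a b) x"
proof (cases "x \<in> box a b")
  case True
  have *: "(\<lambda>k. flat 1 (real k * s - 1)) \<longlonglongrightarrow> 1" if "s > 0" for s
  proof -
    have lim: "filterlim (\<lambda>k. real k * s - 1) at_top sequentially"
      using that by real_asymp
    have "(\<lambda>k. exp (- (1 / (real k * s - 1)))) \<longlonglongrightarrow> 1"
      using that by real_asymp
    then show ?thesis
      by (rule Lim_transform_eventually)
         (use filterlim_at_top_dense[THEN iffD1, OF lim, rule_format, of 0] in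
           \<open>auto simp: flat_def elim!: eventually_mono\<close>)
  qed
  have "(\<lambda>k. bump a b k x) \<longlonglongrightarrow> (\<Prod>i\<in>(UNIV::'n set). 1 * 1)"
    unfolding bump_def
    by (intro tendsto_prod tendsto_mult *) (use True in \<open>auto simp: mem_box_cart\<close>)
  then show ?thesis using True by simp
next
  case False
  then obtain i where i: "x $ i \<le> a $ i \<or> b $ i \<le> x $ i"
    by (auto simp: mem_box_cart not_less)
  have "bump a b k x = 0" for k
    unfolding bump_def
  proof (intro prod_zero bexI[of _ i])
    have "real k * (x $ i - a $ i) \<le> 0 \<or> real k * (b $ i - x $ i) \<le> 0"
      using i by (auto simp: mult_nonneg_nonpos)
    then show "flat 1 (real k * (x $ i - a $ i) - 1) * flat 1 (real k * (b $ i - x $ i) - 1) = 0"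
      by (auto simp: flat_def)
  qed auto
  then show ?thesis using False by simp
qed

lemma bump_test:
  fixes a b :: "real^'n"
  assumes "box a b \<subseteq> Q" "\<And>i. -1/2 \<le> a $ i" "\<And>i. b $ i \<le> 1/2" "k > 0"
  shows "bump a b k \<in> test_functions"
proof -
  have "smooth (\<lambda>x::real^'n. \<Prod>i\<in>UNIV. flat 1 (real k * x $ i + (- real k * a $ i - 1)) * flat 1 (- real k * x $ i + (real k * b $ i - 1)))"
    by (intro smooth_prod smooth_mult smooth_flat_affine)
  also have "(\<lambda>x::real^'n. \<Prod>i\<in>UNIV. flat 1 (real k * x $ i + (- real k * a $ i - 1)) * flat 1 (- real k * x $ i + (real k * b $ i - 1))) = bump a b k"
    by (auto simp: bump_def fun_eq_iff algebra_simps)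
  finally have smooth: "smooth (bump a b k)" .
  define K where "K = cbox (\<chi> i. a $ i + 1 / real k) (\<chi> i. b $ i - 1 / real k)"
  have "K \<subseteq> box a b"
  proof
    fix x assume "x \<in> K"
    then have "a $ i + 1 / real k \<le> x $ i" "x $ i \<le> b $ i - 1 / real k" for i
      by (auto simp: K_def mem_box_cart)
    moreover have "1 / real k > 0" using assms(4) by simp
    ultimately show "x \<in> box a b"
      unfolding mem_box_cart by (smt (verit, best))
  qed
  moreover have "bump a b k x = 0" if "x \<notin> K" for x
  proof -
    have "\<not> (\<forall>i. a $ i + 1 / real k \<le> x $ i \<and> x $ i \<le> b $ i - 1 / real k)"
      using that by (simp add: K_def mem_box_cart)
    then obtain i where i: "x $ i < a $ i + 1 / real k \<or> b $ i - 1 / real k < x $ i"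
      by (auto simp: not_le)
    then have "real k * (x $ i - a $ i) \<le> 1 \<or> real k * (b $ i - x $ i) \<le> 1"
      using assms(4) by (auto simp: field_simps)
    then show ?thesis
      unfolding bump_def by (intro prod_zero bexI[of _ i]) (auto simp: flat_def)
  qed
  ultimately show ?thesis
    using smooth assms(1) unfolding test_functions_def K_def
    by (blast intro: compact_cbox)
qed

text \<open>
  Dominated convergence along the functions \<open>bump a b k\<close> shows that \<open>w\<close> has integral zero over every box.
  Boxes are stable under intersection and generate the Borel sets, hence the same holds for Borel
  sets, and for Lebesgue sets because these differ from Borel sets by null sets.
\<close>
lemma fundamental_lemma:
  fixes w :: "real^'n \<Rightarrow> 'x::euclidean_space"
  assumes w: "w \<in> L1" and zero: "\<And>\<phi>. \<phi> \<in> test_functions \<Longrightarrow> regular w \<phi> = 0"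
  shows "AE x in leb_Q. w x = 0"
proof -
  have int: "integrable leb_Q w" using w by (simp add: L1_def)
  have box0: "(LINT x:box a b|leb_Q. w x) = 0" for a b :: "real^'n"
  proof -
    define a' b' where "a' = (\<chi> i. max (a $ i) (-1/2))" and "b' = (\<chi> i. min (b $ i) (1/2))"
    have b': "box a' b' = box a b \<inter> Q" by (auto simp: a'_def b'_def Q_def mem_box_cart)
    have "(\<lambda>k. \<integral>x. bump a' b' (Suc k) x *\<^sub>R w x \<partial>leb_Q) \<longlonglongrightarrow> (\<integral>x. indicat_real (box a' b') x *\<^sub>R w x \<partial>leb_Q)"
    proof (rule integral_dominated_convergence[where w="\<lambda>x. norm (w x)"])
      have "bump a' b' (Suc k) \<in> test_functions" for k
        by (rule bump_test) (simp_all add: b', simp_all add: a'_def b'_def)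
      then show "(\<lambda>x. bump a' b' (Suc k) x *\<^sub>R w x) \<in> borel_measurable leb_Q" for k
        by (intro borel_measurable_integrable test_regular_integrable w)
      show "(\<lambda>x. indicat_real (box a' b') x *\<^sub>R w x) \<in> borel_measurable leb_Q"
        by (intro borel_measurable_scaleR borel_measurable_leb_Q borel_measurable_indicator borel_measurable_integrable[OF int]) simp
      show "AE x in leb_Q. (\<lambda>k. bump a' b' (Suc k) x *\<^sub>R w x) \<longlonglongrightarrow> indicat_real (box a' b') x *\<^sub>R w x"
        by (intro AE_I2 tendsto_intros LIMSEQ_Suc bump_tendsto)
      show "AE x in leb_Q. norm (bump a' b' (Suc k) x *\<^sub>R w x) \<le> norm (w x)" for k
        using bump_bounds[of a' b' "Suc k"] by (auto intro!: AE_I2 mult_left_le_one_le)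
    qed (use int in simp)
    moreover have "(\<integral>x. bump a' b' (Suc k) x *\<^sub>R w x \<partial>leb_Q) = 0" for k
      using zero[of "bump a' b' (Suc k)"] bump_test[of a' b' "Suc k"] b'
      by (auto simp: regular_def a'_def b'_def)
    ultimately have "(\<integral>x. indicat_real (box a' b') x *\<^sub>R w x \<partial>leb_Q) = 0"
      using LIMSEQ_unique[OF _ tendsto_const] by fastforce
    also have "(\<integral>x. indicat_real (box a' b') x *\<^sub>R w x \<partial>leb_Q) = (LINT x:box a b|leb_Q. w x)"
      unfolding set_lebesgue_integral_def
      by (rule Bochner_Integration.integral_cong) (auto simp: b' space_leb_Q indicator_def)
    finally show ?thesis .
  qed
  have sint: "set_integrable leb_Q A w" if "A \<in> sets borel" for A
  proof -
    have "A \<inter> space leb_Q \<in> sets leb_Q"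
      using that by (auto simp: sets_restrict_space space_leb_Q)
    then have "set_integrable leb_Q (A \<inter> space leb_Q) w"
      using integrable_mult_indicator[OF _ int] by (simp add: set_integrable_def)
    then show ?thesis
      unfolding set_integrable_def
      by (rule Bochner_Integration.integrable_cong[THEN iffD1, rotated 2]) (auto simp: indicator_def)
  qed
  have all: "(\<integral>x. w x \<partial>leb_Q) = 0"
  proof -
    have "(\<integral>x. w x \<partial>leb_Q) = (LINT x:box (\<chi> i. -1/2) (\<chi> i. 1/2)|leb_Q. w x)"
      unfolding set_lebesgue_integral_def Q_box[symmetric]
      by (rule Bochner_Integration.integral_cong) (auto simp: space_leb_Q)
    with box0 show ?thesis by simp
  qed
  have borel0: "(LINT x:A|leb_Q. w x) = 0" if "A \<in> sets borel" for A
  proof -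
    have bsig: "sets (borel :: (real^'n) measure) = sigma_sets UNIV (range (\<lambda>(a, b). box a b))"
      unfolding borel_eq_box by (rule sets_measure_of) simp
    have stable: "Int_stable (range (\<lambda>(a, b). box a b :: (real^'n) set))"
      by (auto simp: Int_stable_def box_Int_box)
    have sub: "range (\<lambda>(a, b). box a b :: (real^'n) set) \<subseteq> Pow UNIV" by simp
    from that have "A \<in> sigma_sets UNIV (range (\<lambda>(a, b). box a b))" by (simp add: bsig)
    with stable sub show ?thesis
    proof (induction rule: sigma_sets_induct_disjoint)
      case (compl A)
      then have A: "A \<in> sets borel" by (simp add: bsig)
      have "(LINT x:UNIV - A|leb_Q. w x) = (\<integral>x. w x - indicat_real A x *\<^sub>R w x \<partial>leb_Q)"
        unfolding set_lebesgue_integral_def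
        by (rule Bochner_Integration.integral_cong) (auto simp: indicator_def)
      also have "\<dots> = 0"
        using compl sint[OF A] int all
        by (subst Bochner_Integration.integral_diff) (auto simp: set_integrable_def set_lebesgue_integral_def)
      finally show ?case .
    next
      case (union A)
      then have A: "A i \<in> sets borel" for i by (auto simp: bsig)
      have m: "A i \<inter> Q \<in> sets leb_Q" for i
        using A by (auto simp: sets_restrict_space)
      have U: "set_integrable leb_Q (\<Union>i. A i \<inter> Q) w"
        unfolding set_integrable_def by (intro integrable_mult_indicator int sets.countable_UN) (use m in auto)
      have "(LINT x:A i \<inter> Q|leb_Q. w x) = (LINT x:A i|leb_Q. w x)" for i
        unfolding set_lebesgue_integral_def
        by (rule Bochner_Integration.integral_cong) (auto simp: space_leb_Q indicator_def)
      then have z: "(LINT x:A i \<inter> Q|leb_Q. w x) = 0" for i using union by simp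
      have "(LINT x:(\<Union>i. A i)|leb_Q. w x) = (LINT x:(\<Union>i. A i \<inter> Q)|leb_Q. w x)"
        unfolding set_lebesgue_integral_def
        by (rule Bochner_Integration.integral_cong) (auto simp: space_leb_Q indicator_def)
      also have "\<dots> = (\<Sum>i. (LINT x:(A i \<inter> Q)|leb_Q. w x))"
        by (rule lebesgue_integral_countable_add[OF m _ U])
           (use union(1) in \<open>auto simp: disjoint_family_on_def\<close>)
      also have "\<dots> = 0" by (simp add: z)
      finally show ?case .
    qed (use box0 in \<open>auto simp: set_lebesgue_integral_def\<close>)
  qed
  interpret finite_measure "leb_Q :: (real^'n) measure" by (rule finite_measure_leb_Q)
  show ?thesis
  proof (rule density_zero[OF int])
    fix A assume "A \<in> sets (leb_Q :: (real^'n) measure)"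
    then have "A \<subseteq> Q" "A \<in> sets lebesgue"
      by (auto simp: sets_restrict_space_iff sets_Q_lebesgue)
    then obtain S N N' where A: "A = S \<union> N" "N \<subseteq> N'" "N' \<in> null_sets lborel" "S \<in> sets lborel"
      using sets_completionE by metis
    have SQ: "S \<in> sets borel" "S \<subseteq> Q" using A \<open>A \<subseteq> Q\<close> by auto
    have N': "N' \<in> null_sets lebesgue" using A(3) by (rule null_sets_completionI)
    then have "AE x in lebesgue. x \<notin> N'" by (rule AE_not_in)
    then have "AE x in leb_Q. x \<notin> N'"
      by (auto simp: AE_restrict_space_iff sets_Q_lebesgue)
    then have ae: "AE x in leb_Q. indicat_real A x *\<^sub>R w x = indicat_real S x *\<^sub>R w x"
      by eventually_elim (use A in \<open>auto simp: indicator_def\<close>)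
    have "(LINT x:A|leb_Q. w x) = (LINT x:S|leb_Q. w x)"
      unfolding set_lebesgue_integral_def
      by (rule integral_cong_AE)
         (use sint[OF SQ(1)] ae \<open>A \<in> sets leb_Q\<close> int in \<open>auto simp: set_integrable_def\<close>)
    then show "(LINT x:A|leb_Q. w x) = 0" using borel0[OF SQ(1)] by simp
  qed
qed

section \<open>Integration by parts\<close>

text \<open>
  The integral of a difference quotient of \<open>w\<close> in direction \<open>i\<close> vanishes by translation invariance of the
  Lebesgue measure. The quotients converge to the partial derivative and, by the mean value
  inequality, they are bounded by the maximum of the partial derivative on a fixed ball.
\<close>
lemma integral_partial_eq_0:
  fixes w :: "real^'n \<Rightarrow> 'x::euclidean_space"
  assumes diff: "\<And>x. w differentiable (at x)" and cont: "continuous_on UNIV (partial i w)"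
    and K: "compact K" "\<And>x. x \<notin> K \<Longrightarrow> w x = 0"
  shows "(\<integral>x. partial i w x \<partial>lborel) = 0"
proof -
  let ?e = "axis i 1 :: real^'n"
  have e: "norm ?e = 1" by simp
  have w_borel [measurable]: "w \<in> borel_measurable borel"
    by (intro borel_measurable_continuous_onI continuous_at_imp_continuous_on ballI differentiable_imp_continuous_within diff)
  have p_borel [measurable]: "partial i w \<in> borel_measurable borel"
    by (intro borel_measurable_continuous_onI cont)
  have der: "((\<lambda>t. w (x + t *\<^sub>R ?e)) has_derivative (\<lambda>s. s *\<^sub>R partial i w (x + t *\<^sub>R ?e))) (at t within S)" for x t S
  proof -
    have 1: "((\<lambda>t. x + t *\<^sub>R ?e) has_derivative (\<lambda>s. s *\<^sub>R ?e)) (at t within S)"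
      by (auto intro!: derivative_eq_intros)
    have 2: "(w has_derivative frechet_derivative w (at (x + t *\<^sub>R ?e))) (at (x + t *\<^sub>R ?e))"
      using diff by (simp add: frechet_derivative_works)
    show ?thesis
      using has_derivative_compose[OF 1 2] linear_frechet_derivative[OF diff]
      by (simp add: partial_def linear_scale)
  qed
  obtain M where M: "M \<ge> 0" "\<And>x. norm (partial i w x) \<le> M"
  proof -
    have "bounded (partial i w ` K)"
      by (intro compact_imp_bounded compact_continuous_image K continuous_on_subset[OF cont]) auto
    then obtain M where M: "\<And>x. x \<in> K \<Longrightarrow> norm (partial i w x) \<le> M"
      by (auto simp: bounded_iff)
    show thesis
    proof (rule that[of "max M 0"])
      show "norm (partial i w x) \<le> max M 0" for x
        using M[of x] by (cases "x \<in> K") (auto simp: partial_eq_0[OF K])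
    qed simp
  qed
  have quot: "norm (w (x + h *\<^sub>R ?e) - w x) \<le> M * \<bar>h\<bar>" for x h
  proof -
    have "norm (w (x + h *\<^sub>R ?e) - w (x + 0 *\<^sub>R ?e)) \<le> M * norm (h - 0)"
    proof (rule differentiable_bound[where S=UNIV and f'="\<lambda>t s. s *\<^sub>R partial i w (x + t *\<^sub>R ?e)"])
      show "onorm (\<lambda>s. s *\<^sub>R partial i w (x + t *\<^sub>R ?e)) \<le> M" for t
        by (rule onorm_le) (use mult_left_mono[OF M(2)] in \<open>simp add: mult.commute[of M]\<close>)
    qed (use der in auto)
    then show ?thesis by simp
  qed
  obtain R where R: "\<And>x. x \<in> K \<Longrightarrow> norm x \<le> R"
    using compact_imp_bounded[OF K(1)] by (auto simp: bounded_iff)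
  define h where "h n = 1 / real (Suc n)" for n
  have h: "0 < h n" "h n \<le> 1" for n by (auto simp: h_def)
  have w_int: "integrable lborel w"
  proof -
    have "integrable lborel (\<lambda>x. indicator K x *\<^sub>R w x)"
      by (rule borel_integrable_compact[OF K(1)])
        (intro continuous_at_imp_continuous_on ballI differentiable_imp_continuous_within diff)
    also have "(\<lambda>x. indicator K x *\<^sub>R w x) = w" using K(2) by (auto simp: indicator_def)
    finally show ?thesis .
  qed
  have shift_int: "integrable lborel (\<lambda>x. w (x + c))"
    and shift_eq: "(\<integral>x. w (x + c) \<partial>lborel) = (\<integral>x. w x \<partial>lborel)" for c
  proof -
    have "integrable (distr lborel borel ((+) c)) w" using w_int by (simp add: lborel_distr_plus)
    then show "integrable lborel (\<lambda>x. w (x + c))"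
      by (subst (asm) integrable_distr_eq) (auto simp: add.commute)
    have "(\<integral>x. w x \<partial>distr lborel borel ((+) c)) = (\<integral>x. w (c + x) \<partial>lborel)"
      by (rule integral_distr) auto
    then show "(\<integral>x. w (x + c) \<partial>lborel) = (\<integral>x. w x \<partial>lborel)"
      by (simp add: lborel_distr_plus add.commute)
  qed
  \<comment> \<open>the shifted argument moves by at most 1, hence the larger ball as common support\<close>
  have "(\<lambda>n. \<integral>x. (1 / h n) *\<^sub>R (w (x + h n *\<^sub>R ?e) - w x) \<partial>lborel) \<longlonglongrightarrow> (\<integral>x. partial i w x \<partial>lborel)"
  proof (rule integral_dominated_convergence[where w="\<lambda>x. indicator (cball 0 (R + 1)) x *\<^sub>R M"])
    show "AE x in lborel. (\<lambda>n. (1 / h n) *\<^sub>R (w (x + h n *\<^sub>R ?e) - w x)) \<longlonglongrightarrow> partial i w x"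
    proof (rule AE_I2)
      fix x
      let ?d = "\<lambda>t. (1 / t) *\<^sub>R (w (x + t *\<^sub>R ?e) - w x) - partial i w x"
      have "((\<lambda>t. norm (w (x + t *\<^sub>R ?e) - w x - t *\<^sub>R partial i w x) / norm t) \<longlongrightarrow> 0) (at 0)"
        using der[of x 0 UNIV] by (simp add: has_derivative_at)
      moreover have "norm (?d t) = norm (w (x + t *\<^sub>R ?e) - w x - t *\<^sub>R partial i w x) / norm t" if "t \<noteq> 0" for t
      proof -
        have "?d t = (1 / t) *\<^sub>R (w (x + t *\<^sub>R ?e) - w x - t *\<^sub>R partial i w x)"
          using that by (simp add: scaleR_diff_right)
        then show ?thesis by simp
      qed
      ultimately have "((\<lambda>t. norm (?d t)) \<longlongrightarrow> 0) (at 0)"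
        by (elim Lim_transform_eventually) (auto simp: eventually_at_filter)
      then have "((\<lambda>t. (1 / t) *\<^sub>R (w (x + t *\<^sub>R ?e) - w x)) \<longlongrightarrow> partial i w x) (at 0)"
        by (rule Lim_null[THEN iffD2, OF tendsto_norm_zero_cancel])
      moreover have "filterlim h (at 0) sequentially"
      proof (subst filterlim_at, intro conjI always_eventually allI)
        show "h \<longlonglongrightarrow> 0"
          using LIMSEQ_inverse_real_of_nat by (simp add: h_def[abs_def] inverse_eq_divide)
      qed (use h in \<open>auto simp: less_imp_neq[symmetric]\<close>)
      ultimately show "(\<lambda>n. (1 / h n) *\<^sub>R (w (x + h n *\<^sub>R ?e) - w x)) \<longlonglongrightarrow> partial i w x"
        by (rule filterlim_compose)
    qed
    show "AE x in lborel. norm ((1 / h n) *\<^sub>R (w (x + h n *\<^sub>R ?e) - w x)) \<le> indicator (cball 0 (R + 1)) x *\<^sub>R M" for n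
    proof (rule AE_I2)
      fix x
      show "norm ((1 / h n) *\<^sub>R (w (x + h n *\<^sub>R ?e) - w x)) \<le> indicator (cball 0 (R + 1)) x *\<^sub>R M"
      proof (cases "x \<in> cball 0 (R + 1)")
        case True
        have "norm ((1 / h n) *\<^sub>R (w (x + h n *\<^sub>R ?e) - w x)) = norm (w (x + h n *\<^sub>R ?e) - w x) / h n"
          using h[of n] by simp
        also have "\<dots> \<le> M" using quot[of x "h n"] h[of n] by (simp add: pos_divide_le_eq)
        finally show ?thesis using True by simp
      next
        case False
        have "norm x \<le> norm (x + h n *\<^sub>R ?e) + norm (h n *\<^sub>R ?e)"
          by (metis add_diff_cancel_right' norm_triangle_ineq4)
        then have "x \<notin> K" "x + h n *\<^sub>R ?e \<notin> K"
          using False R[of x] R[of "x + h n *\<^sub>R ?e"] h[of n] e by auto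
        then show ?thesis using K(2) False by simp
      qed
    qed
    show "integrable lborel (\<lambda>x. indicat_real (cball (0::real^'n) (R + 1)) x *\<^sub>R M)"
      by (rule borel_integrable_compact) auto
  qed auto
  moreover have "(\<integral>x. (1 / h n) *\<^sub>R (w (x + h n *\<^sub>R ?e) - w x) \<partial>lborel) = 0" for n
    using Bochner_Integration.integral_diff[OF shift_int[of "h n *\<^sub>R ?e"] w_int] shift_eq[of "h n *\<^sub>R ?e"]
    by (simp only: integral_scaleR_right) simp
  ultimately show ?thesis by (simp only: LIMSEQ_const_iff)
qed

lemma integral_leb_Q_eq_lborel:
  fixes f :: "real^'n \<Rightarrow> 'x::euclidean_space"
  assumes "f \<in> borel_measurable borel" "\<And>x. x \<notin> Q \<Longrightarrow> f x = 0"
  shows "(\<integral>x. f x \<partial>leb_Q) = (\<integral>x. f x \<partial>lborel)"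
proof -
  have "(\<integral>x. f x \<partial>leb_Q) = (\<integral>x. indicator Q x *\<^sub>R f x \<partial>lebesgue)"
    by (rule integral_restrict_space) (simp add: sets_Q_lebesgue)
  also have "(\<lambda>x. indicator Q x *\<^sub>R f x) = f" using assms(2) by (auto simp: indicator_def)
  also have "(\<integral>x. f x \<partial>lebesgue) = (\<integral>x. f x \<partial>lborel)"
    using assms(1) by (intro integral_completion) simp
  finally show ?thesis .
qed

lemma continuous_L1:
  fixes v :: "real^'n \<Rightarrow> 'x::euclidean_space"
  assumes v: "continuous_on UNIV v" shows "v \<in> L1"
proof -
  have "bounded (v ` closure Q)"
    by (intro compact_imp_bounded compact_continuous_image continuous_on_subset[OF v]) (simp_all add: bounded_Q)
  then obtain M where "\<And>x. x \<in> closure Q \<Longrightarrow> norm (v x) \<le> M"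
    by (auto simp: bounded_iff)
  then have M: "\<And>x. x \<in> Q \<Longrightarrow> norm (v x) \<le> M"
    using closure_subset by blast
  interpret finite_measure "leb_Q :: (real^'n) measure" by (rule finite_measure_leb_Q)
  show ?thesis unfolding L1_def mem_Collect_eq
    by (rule integrable_const_bound[of _ M])
       (auto simp: M space_leb_Q intro!: AE_I2 borel_measurable_leb_Q borel_measurable_continuous_onI v)
qed

lemma smooth_L1: "smooth v \<Longrightarrow> v \<in> L1"
  by (intro continuous_L1 smooth_continuous_on)

lemma regular_partial:
  fixes v :: "real^'n \<Rightarrow> 'x::euclidean_space"
  assumes v: "smooth v" and \<phi>: "\<phi> \<in> test_functions"
  shows "regular v (partial i \<phi>) = - regular (partial i v) \<phi>"
proof -
  obtain K where K: "compact K" "K \<subseteq> Q" "\<And>x. x \<notin> K \<Longrightarrow> \<phi> x = 0"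
    using test_support[OF \<phi>] by blast
  let ?w = "\<lambda>x. \<phi> x *\<^sub>R v x"
  have w: "smooth ?w" by (intro smooth_scaleR test_smooth \<phi> v)
  have p: "partial i ?w = (\<lambda>x. \<phi> x *\<^sub>R partial i v x + partial i \<phi> x *\<^sub>R v x)"
    by (intro ext partial_scaleR smooth_differentiable test_smooth \<phi> v)
  have 0: "(\<integral>x. partial i ?w x \<partial>lborel) = 0"
    by (rule integral_partial_eq_0[OF smooth_differentiable[OF w] smooth_continuous_on[OF smooth_partial[OF w]] K(1)])
       (simp add: K(3))
  have "(\<integral>x. partial i ?w x \<partial>leb_Q) = (\<integral>x. partial i ?w x \<partial>lborel)"
  proof (rule integral_leb_Q_eq_lborel)
    show "partial i ?w \<in> borel_measurable borel"
      by (intro borel_measurable_continuous_onI smooth_continuous_on smooth_partial w)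
    show "partial i ?w x = 0" if "x \<notin> Q" for x
      by (rule partial_eq_0[OF K(1)]) (use K that in auto)
  qed
  also have "(\<integral>x. partial i ?w x \<partial>leb_Q) = regular (partial i v) \<phi> + regular v (partial i \<phi>)"
    unfolding p regular_def
    by (rule Bochner_Integration.integral_add; rule test_regular_integrable)
       (auto intro: test_partial \<phi> smooth_L1 smooth_partial v)
  finally show ?thesis using 0 by (simp add: add_eq_0_iff)
qed

section \<open>Vector measures\<close>

lemma bounded_Radon_sums:
  assumes "bounded_Radon \<mu>" "range A \<subseteq> borel_Q" "disjoint_family A"
  shows "(\<lambda>i. \<mu> (A i)) sums \<mu> (\<Union>i. A i)"
  using assms by (auto simp: bounded_Radon_def)

lemma bounded_Radon_empty:
  fixes \<mu> :: "(real^'n) set \<Rightarrow> 'x::euclidean_space"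
  assumes "bounded_Radon \<mu>" shows "\<mu> {} = 0"
proof -
  have "(\<lambda>i::nat. \<mu> {}) sums \<mu> (\<Union>i::nat. {})"
    by (rule bounded_Radon_sums[OF assms]) (auto simp: disjoint_family_on_def)
  then have "(\<lambda>i::nat. \<mu> {}) \<longlonglongrightarrow> 0" by (intro summable_LIMSEQ_zero sums_summable)
  then show ?thesis by (simp add: LIMSEQ_const_iff)
qed

lemma bounded_Radon_Un:
  fixes \<mu> :: "(real^'n) set \<Rightarrow> 'x::euclidean_space"
  assumes "bounded_Radon \<mu>" "A \<in> borel_Q" "B \<in> borel_Q" "A \<inter> B = {}"
  shows "\<mu> (A \<union> B) = \<mu> A + \<mu> B"
proof -
  define C where "C i = (if i = 0 then A else if i = 1 then B else {})" for i :: nat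
  have "(\<lambda>i. \<mu> (C i)) sums \<mu> (\<Union>i. C i)"
    by (rule bounded_Radon_sums[OF assms(1)]) (use assms in \<open>auto simp: C_def disjoint_family_on_def\<close>)
  moreover have "(\<Union>i. C i) = A \<union> B" by (auto simp: C_def split: if_splits)
  moreover have "(\<lambda>i. \<mu> (C i)) sums (\<Sum>i\<in>{0,1}. \<mu> (C i))"
    by (rule sums_finite) (auto simp: C_def bounded_Radon_empty[OF assms(1)])
  ultimately have "\<mu> (A \<union> B) = (\<Sum>i\<in>{0,1}. \<mu> (C i))" by (metis sums_unique2)
  then show ?thesis by (simp add: C_def)
qed

lemma norm_sum_le_total_variation:
  assumes "finite P" "disjoint P" "P \<subseteq> borel_Q"
  shows "ennreal (\<Sum>A\<in>P. norm (\<mu> A)) \<le> total_variation \<mu>"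
  unfolding total_variation_def
  by (rule SUP_upper2[of P]) (use assms in auto)

lemma total_variation_le:
  assumes "\<And>P. finite P \<Longrightarrow> disjoint P \<Longrightarrow> P \<subseteq> borel_Q \<Longrightarrow> ennreal (\<Sum>A\<in>P. norm (\<mu> A)) \<le> c"
  shows "total_variation \<mu> \<le> c"
  unfolding total_variation_def using assms by (auto intro!: SUP_least)

lemma norm_le_total_variation:
  assumes "bounded_Radon \<mu>" "A \<in> borel_Q"
  shows "norm (\<mu> A) \<le> enn2real (total_variation \<mu>)"
proof -
  have "ennreal (norm (\<mu> A)) \<le> total_variation \<mu>"
    using norm_sum_le_total_variation[of "{A}" \<mu>] assms(2) by auto
  moreover have "total_variation \<mu> < top" using assms(1) by (auto simp: bounded_Radon_def)
  ultimately show ?thesis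
    by (metis enn2real_ennreal enn2real_mono norm_ge_zero)
qed

lemma bounded_Radon_bounded_linear:
  assumes \<mu>: "bounded_Radon \<mu>" and f: "bounded_linear f" "\<And>x. norm (f x) \<le> norm x"
  shows "bounded_Radon (\<lambda>A. f (\<mu> A))" "total_variation (\<lambda>A. f (\<mu> A)) \<le> total_variation \<mu>"
proof -
  show 1: "total_variation (\<lambda>A. f (\<mu> A)) \<le> total_variation \<mu>"
    by (rule total_variation_le)
       (auto intro!: order_trans[OF _ norm_sum_le_total_variation] ennreal_leI sum_mono f)
  show "bounded_Radon (\<lambda>A. f (\<mu> A))"
    using \<mu> 1 bounded_linear.sums[OF f(1)] unfolding bounded_Radon_def
    by (auto intro: le_less_trans)
qed

text \<open>
  The supremum in the definition of the positive part is countably additive: a union of competitors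
  for disjoint sets is a competitor for their union, and a competitor for a countable union is cut
  into competitors for the pieces.
\<close>
lemma positive_part:
  fixes \<nu> :: "(real^'n) set \<Rightarrow> real"
  assumes \<nu>: "bounded_Radon \<nu>"
  shows sets_positive_part: "sets (positive_part \<nu>) = borel_Q"
    and space_positive_part: "space (positive_part \<nu>) = Q"
    and emeasure_positive_part: "A \<in> borel_Q \<Longrightarrow> emeasure (positive_part \<nu>) A =
          (SUP B \<in> {B. B \<in> borel_Q \<and> B \<subseteq> A}. ennreal (\<nu> B))"
proof -
  let ?f = "\<lambda>A. SUP B \<in> {B. B \<in> borel_Q \<and> B \<subseteq> A}. ennreal (\<nu> B)"
  have sp: "space (restrict_space borel Q :: (real^'n) measure) = Q"
    by (simp add: space_restrict_space)
  have sub: "(borel_Q :: (real^'n) set set) \<subseteq> Pow Q" by (auto simp: borel_Q_iff)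
  have ss: "sigma_sets Q borel_Q = (borel_Q :: (real^'n) set set)"
    using sets.sigma_sets_eq[of "restrict_space borel Q :: (real^'n) measure"] by (simp add: sp)
  show sets: "sets (positive_part \<nu>) = borel_Q"
    unfolding positive_part_def by (simp add: sub ss)
  show "space (positive_part \<nu>) = Q"
    unfolding positive_part_def by (simp add: sub)
  have mono: "?f A \<le> ?f B" if "A \<subseteq> B" for A B
    using that by (intro SUP_subset_mono) auto
  have super: "?f A + ?f B \<le> ?f (A \<union> B)" if AB: "A \<inter> B = {}" for A B
  proof -
    have "ennreal (\<nu> A') + ennreal (\<nu> B') \<le> ?f (A \<union> B)"
      if A': "A' \<in> borel_Q" "A' \<subseteq> A" and B': "B' \<in> borel_Q" "B' \<subseteq> B" for A' B'
    proof -
      have 1: "ennreal (\<nu> A') \<le> ?f (A \<union> B)" "ennreal (\<nu> B') \<le> ?f (A \<union> B)" "ennreal (\<nu> (A' \<union> B')) \<le> ?f (A \<union> B)"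
        by (intro SUP_upper; use A' B' in auto)+
      have "\<nu> (A' \<union> B') = \<nu> A' + \<nu> B'"
        using A' B' AB by (intro bounded_Radon_Un \<nu>) auto
      then show ?thesis
        using 1 by (cases "\<nu> A' \<ge> 0"; cases "\<nu> B' \<ge> 0") (auto simp: ennreal_plus[symmetric] ennreal_neg simp del: ennreal_plus)
    qed
    note * = this
    have ne: "{B :: (real^'n) set. B \<in> borel_Q \<and> B \<subseteq> C} \<noteq> {}" for C by auto
    have "?f A + ?f B = (SUP A'\<in>{B. B \<in> borel_Q \<and> B \<subseteq> A}. ennreal (\<nu> A') + ?f B)"
      by (rule ennreal_SUP_add_left[OF ne, symmetric])
    also have "\<dots> \<le> ?f (A \<union> B)"
    proof (rule SUP_least, clarify)
      fix A' assume A': "A' \<in> borel_Q" "A' \<subseteq> A"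
      have "ennreal (\<nu> A') + ?f B = (SUP B'\<in>{B'. B' \<in> borel_Q \<and> B' \<subseteq> B}. ennreal (\<nu> A') + ennreal (\<nu> B'))"
        by (rule ennreal_SUP_add_right[OF ne])
      also have "\<dots> \<le> ?f (A \<union> B)"
        by (rule SUP_least) (use * A' in auto)
      finally show "ennreal (\<nu> A') + ?f B \<le> ?f (A \<union> B)" .
    qed
    finally show ?thesis .
  qed
  have pos: "positive (sets (positive_part \<nu>)) ?f"
  proof -
    have "{B. B \<in> borel_Q \<and> B \<subseteq> {}} = {{} :: (real^'n) set}" by auto
    then show ?thesis by (simp add: positive_def bounded_Radon_empty[OF \<nu>])
  qed
  have ca: "countably_additive (sets (positive_part \<nu>)) ?f"
    unfolding sets
  proof (rule countably_additiveI)
    fix A :: "nat \<Rightarrow> (real^'n) set"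
    assume A: "range A \<subseteq> borel_Q" "disjoint_family A" "(\<Union>i. A i) \<in> borel_Q"
    show "(\<Sum>i. ?f (A i)) = ?f (\<Union>i. A i)"
    proof (rule antisym)
      have fin: "(\<Sum>i<n. ?f (A i)) \<le> ?f (\<Union>i<n. A i)" for n
      proof (induction n)
        case (Suc n)
        have "(\<Sum>i<Suc n. ?f (A i)) \<le> ?f (\<Union>i<n. A i) + ?f (A n)"
          using Suc by (simp add: add_right_mono)
        also have "\<dots> \<le> ?f ((\<Union>i<n. A i) \<union> A n)"
        proof (rule super)
          have "A i \<inter> A n = {}" if "i < n" for i
            using disjoint_family_onD[OF A(2), of i n] that by simp
          then show "(\<Union>i<n. A i) \<inter> A n = {}" by blast
        qed
        finally show ?case by (simp add: lessThan_Suc Un_commute)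
      qed simp
      have "(\<Sum>i. ?f (A i)) + 0 \<le> ?f (\<Union>i. A i)"
      proof (rule ennreal_suminf_bound_add)
        fix n
        have "(\<Sum>i<n. ?f (A i)) \<le> ?f (\<Union>i. A i)"
          by (rule order_trans[OF fin[of n] mono]) blast
        then show "(\<Sum>i<n. ?f (A i)) + 0 \<le> ?f (\<Union>i. A i)" by simp
      qed
      then show "(\<Sum>i. ?f (A i)) \<le> ?f (\<Union>i. A i)" by simp
      show "?f (\<Union>i. A i) \<le> (\<Sum>i. ?f (A i))"
      proof (rule SUP_least, clarify)
        fix B assume B: "B \<in> borel_Q" "B \<subseteq> (\<Union>i. A i)"
        have s: "(\<lambda>i. \<nu> (B \<inter> A i)) sums \<nu> (\<Union>i. B \<inter> A i)"
          by (rule bounded_Radon_sums[OF \<nu>])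
             (use A B(1) in \<open>auto simp: disjoint_family_on_def intro!: sets.Int\<close>)
        have "(\<Union>i. B \<inter> A i) = B" using B by auto
        with s have lim: "(\<lambda>n. \<Sum>i<n. \<nu> (B \<inter> A i)) \<longlonglongrightarrow> \<nu> B" by (simp add: sums_def)
        have "ennreal (\<Sum>i<n. \<nu> (B \<inter> A i)) \<le> (\<Sum>i. ?f (A i))" for n
        proof -
          have "ennreal (\<Sum>i<n. \<nu> (B \<inter> A i)) \<le> ennreal (\<Sum>i<n. max 0 (\<nu> (B \<inter> A i)))"
            by (intro ennreal_leI sum_mono) auto
          also have "\<dots> = (\<Sum>i<n. ennreal (\<nu> (B \<inter> A i)))"
          proof -
            have "ennreal (max 0 x) = ennreal x" for x :: real
              by (cases "x \<ge> 0") (simp_all add: max_def ennreal_neg)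
            then show ?thesis by (subst sum_ennreal[symmetric]) simp_all
          qed
          also have "\<dots> \<le> (\<Sum>i<n. ?f (A i))"
          proof (intro sum_mono SUP_upper)
            fix i
            have "A i \<in> borel_Q" using A(1) by blast
            then show "B \<inter> A i \<in> {B. B \<in> borel_Q \<and> B \<subseteq> A i}" using sets.Int[OF B(1)] by simp
          qed
          also have "\<dots> \<le> (\<Sum>i. ?f (A i))"
            by (intro sum_le_suminf) auto
          finally show ?thesis .
        qed
        then show "ennreal (\<nu> B) \<le> (\<Sum>i. ?f (A i))"
          by (intro tendsto_upperbound[OF tendsto_ennrealI[OF lim]]) auto
      qed
    qed
  qed
  show "emeasure (positive_part \<nu>) A = ?f A" if "A \<in> borel_Q"
    by (rule emeasure_measure_of[OF positive_part_def sub pos ca]) (simp add: sets that)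
qed

lemma positive_part_finite:
  fixes \<nu> :: "(real^'n) set \<Rightarrow> real"
  assumes \<nu>: "bounded_Radon \<nu>"
  shows "finite_measure (positive_part \<nu>)"
    and "measure (positive_part \<nu>) Q \<le> enn2real (total_variation \<nu>)"
proof -
  have Q: "(Q :: (real^'n) set) \<in> borel_Q" by (simp add: borel_Q_iff open_Q)
  have *: "emeasure (positive_part \<nu>) Q \<le> ennreal (enn2real (total_variation \<nu>))"
    unfolding emeasure_positive_part[OF \<nu> Q]
  proof (rule SUP_least, clarify)
    fix B :: "(real^'n) set" assume B: "B \<in> borel_Q"
    show "ennreal (\<nu> B) \<le> ennreal (enn2real (total_variation \<nu>))"
      using norm_le_total_variation[OF \<nu> B] by (intro ennreal_leI) simp
  qed
  show fm: "finite_measure (positive_part \<nu>)"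
    using * by (intro finite_measureI) (auto simp: space_positive_part[OF \<nu>] top_unique)
  show "measure (positive_part \<nu>) Q \<le> enn2real (total_variation \<nu>)"
    using * unfolding measure_def by (simp add: enn2real_leI)
qed

text \<open>
  Inside \<open>A\<close> the competitor \<open>B\<close> for the positive part corresponds to the competitor \<open>A - B\<close> for the negative
  part, and their values differ by \<open>\<nu> A\<close>; hence so do the two suprema.
\<close>
lemma jordan_decomposition:
  fixes \<nu> :: "(real^'n) set \<Rightarrow> real"
  assumes \<nu>: "bounded_Radon \<nu>" and A: "A \<in> borel_Q"
  shows "\<nu> A = measure (positive_part \<nu>) A - measure (positive_part (\<lambda>A. - \<nu> A)) A"
proof -
  have n\<nu>: "bounded_Radon (\<lambda>A. - \<nu> A)"
    using bounded_Radon_bounded_linear(1)[OF \<nu>, of uminus] by (simp add: bounded_linear_minus bounded_linear_ident)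
  interpret p: finite_measure "positive_part \<nu>" by (rule positive_part_finite[OF \<nu>])
  interpret n: finite_measure "positive_part (\<lambda>A. - \<nu> A)" by (rule positive_part_finite[OF n\<nu>])
  have diff: "\<nu> A = \<nu> B + \<nu> (A - B)" if "B \<in> borel_Q" "B \<subseteq> A" for B
    using bounded_Radon_Un[OF \<nu> that(1), of "A - B"] that A by (auto simp: Un_absorb1 sets.Diff)
  have ge: "\<nu> B \<le> measure (positive_part \<nu>) A" if "B \<in> borel_Q" "B \<subseteq> A" for B
  proof -
    have "ennreal (\<nu> B) \<le> emeasure (positive_part \<nu>) A"
      unfolding emeasure_positive_part[OF \<nu> A] by (rule SUP_upper) (use that in auto)
    then show ?thesis by (simp add: p.emeasure_eq_measure)
  qed
  have nge: "- \<nu> B \<le> measure (positive_part (\<lambda>A. - \<nu> A)) A" if "B \<in> borel_Q" "B \<subseteq> A" for B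
  proof -
    have "ennreal (- \<nu> B) \<le> emeasure (positive_part (\<lambda>A. - \<nu> A)) A"
      unfolding emeasure_positive_part[OF n\<nu> A] by (rule SUP_upper) (use that in auto)
    then show ?thesis by (simp add: n.emeasure_eq_measure)
  qed
  have e: "({} :: (real^'n) set) \<in> borel_Q" by simp
  have "measure (positive_part \<nu>) A \<le> \<nu> A + measure (positive_part (\<lambda>A. - \<nu> A)) A"
  proof -
    let ?c = "\<nu> A + measure (positive_part (\<lambda>A. - \<nu> A)) A"
    have c: "\<nu> B \<le> ?c" if "B \<in> borel_Q" "B \<subseteq> A" for B
      using nge[of "A - B"] diff[OF that] that A by (auto simp: sets.Diff)
    have c0: "0 \<le> ?c" using c[OF e] by (simp add: bounded_Radon_empty[OF \<nu>])
    have "emeasure (positive_part \<nu>) A \<le> ennreal ?c"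
      unfolding emeasure_positive_part[OF \<nu> A] by (rule SUP_least) (use c in \<open>auto intro: ennreal_leI\<close>)
    then show ?thesis using c0 by (simp add: p.emeasure_eq_measure)
  qed
  moreover have "measure (positive_part (\<lambda>A. - \<nu> A)) A \<le> measure (positive_part \<nu>) A - \<nu> A"
  proof -
    let ?c = "measure (positive_part \<nu>) A - \<nu> A"
    have c: "- \<nu> B \<le> ?c" if "B \<in> borel_Q" "B \<subseteq> A" for B
      using ge[of "A - B"] diff[OF that] that A by (auto simp: sets.Diff)
    have c0: "0 \<le> ?c" using c[OF e] by (simp add: bounded_Radon_empty[OF \<nu>])
    have "emeasure (positive_part (\<lambda>A. - \<nu> A)) A \<le> ennreal ?c"
      unfolding emeasure_positive_part[OF n\<nu> A] by (rule SUP_least) (use c in \<open>auto intro: ennreal_leI\<close>)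
    then show ?thesis using c0 by (simp add: n.emeasure_eq_measure)
  qed
  ultimately show ?thesis by simp
qed

section \<open>Riemann sums\<close>

text \<open>
  Integrals with respect to vector measures are defined through positive parts of components, an
  operation that is not linear in the measure. Riemann sums over fine Borel partitions are linear, and
  they approximate the integral with an error controlled by the total variation alone. All properties
  of the integral that are needed below are deduced from this.
\<close>
definition fine_partition :: "real \<Rightarrow> (real^'n) set set \<Rightarrow> bool" where
  "fine_partition \<delta> P \<longleftrightarrow> finite P \<and> disjoint P \<and> {} \<notin> P \<and> P \<subseteq> borel_Q \<and> \<Union>P = Q \<and>
     (\<forall>A\<in>P. \<forall>x\<in>A. \<forall>y\<in>A. dist x y < \<delta>)"

lemma fine_partition_exists:
  assumes "\<delta> > 0" shows "\<exists>P :: (real^'n) set set. fine_partition \<delta> P"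
proof -
  have "compact (closure (Q :: (real^'n) set))" by (simp add: bounded_Q)
  then obtain k where k: "finite k" "closure Q \<subseteq> (\<Union>x\<in>k. ball (x::real^'n) (\<delta>/2))"
    using compact_eq_totally_bounded[of "closure (Q :: (real^'n) set)"] assms
    by (meson half_gt_zero)
  have "\<exists>P. finite P \<and> disjoint P \<and> {} \<notin> P \<and> P \<subseteq> borel_Q \<and> \<Union>P = Q \<inter> (\<Union>x\<in>k. ball (x::real^'n) (\<delta>/2)) \<and>
     (\<forall>A\<in>P. \<forall>x\<in>A. \<forall>y\<in>A. dist x y < \<delta>)"
    using k(1)
  proof induction
    case empty
    show ?case by (rule exI[of _ "{}"]) auto
  next
    case (insert z k)
    then obtain P where P: "finite P" "disjoint P" "{} \<notin> P" "P \<subseteq> borel_Q"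
      "\<Union>P = Q \<inter> (\<Union>x\<in>k. ball (x::real^'n) (\<delta>/2))" "\<forall>A\<in>P. \<forall>x\<in>A. \<forall>y\<in>A. dist x y < \<delta>"
      by auto
    define C where "C = Q \<inter> ball z (\<delta>/2) - \<Union>P"
    have C: "C \<in> borel_Q"
      unfolding C_def P(5) borel_Q_iff using borel_open[OF open_Q] insert(1) by (auto intro!: sets.Diff sets.Int sets.finite_UN)
    have small: "dist x y < \<delta>" if "x \<in> C" "y \<in> C" for x y
    proof -
      have "dist x z < \<delta>/2" "dist y z < \<delta>/2" using that by (auto simp: C_def dist_commute)
      then show ?thesis by (rule dist_triangle_half_l)
    qed
    show ?case
    proof (rule exI[of _ "insert C P - {{}}"], intro conjI)
      show "disjoint (insert C P - {{}})"
        using P(2) by (auto simp: disjoint_def C_def)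
      show "\<Union> (insert C P - {{}}) = Q \<inter> (\<Union>x\<in>insert z k. ball x (\<delta>/2))"
      proof -
        have "\<Union> (insert C P - {{}}) = C \<union> \<Union>P" by auto
        also have "\<dots> = (Q \<inter> ball z (\<delta>/2)) \<union> \<Union>P" by (auto simp: C_def)
        finally show ?thesis using P(5) by auto
      qed
      show "\<forall>A\<in>insert C P - {{}}. \<forall>x\<in>A. \<forall>y\<in>A. dist x y < \<delta>"
        using P(6) small by auto
    qed (use P C in auto)
  qed
  moreover have "Q \<inter> (\<Union>x\<in>k. ball (x::real^'n) (\<delta>/2)) = Q" using k(2) closure_subset by blast
  ultimately show ?thesis unfolding fine_partition_def by metis
qed

definition cells :: "nat \<Rightarrow> (real^'n) set set" where
  "cells n = (SOME P. fine_partition (1 / real (Suc n)) P)"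

definition node :: "(real^'n) set \<Rightarrow> real^'n" where
  "node A = (SOME x. x \<in> A)"

definition riemann_sum :: "((real^'n) set \<Rightarrow> 'x::real_vector) \<Rightarrow> (real^'n \<Rightarrow> real) \<Rightarrow> nat \<Rightarrow> 'x" where
  "riemann_sum \<mu> \<phi> n = (\<Sum>A\<in>cells n. \<phi> (node A) *\<^sub>R \<mu> A)"

lemma cells: "fine_partition (1 / real (Suc n)) (cells n)"
  unfolding cells_def by (rule someI_ex[OF fine_partition_exists]) simp

lemma cells_simps:
  shows "finite (cells n)" "disjoint (cells n)" "{} \<notin> cells n" "\<Union>(cells n) = Q"
    "A \<in> cells n \<Longrightarrow> A \<in> borel_Q" "A \<in> cells n \<Longrightarrow> A \<subseteq> Q" "cells n \<subseteq> borel_Q"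
  using cells[of n] by (auto simp: fine_partition_def)

lemma node_in: "A \<in> cells n \<Longrightarrow> node A \<in> A"
  unfolding node_def using cells_simps(3)[of n] by (intro some_in_eq[THEN iffD2]) auto

lemma oscillation_tendsto_0:
  fixes \<phi> :: "real^'n \<Rightarrow> real"
  assumes "\<phi> \<in> test_functions"
  obtains \<omega> where "\<omega> \<longlonglongrightarrow> 0" "\<And>n A x. A \<in> cells n \<Longrightarrow> x \<in> A \<Longrightarrow> \<bar>\<phi> x - \<phi> (node A)\<bar> \<le> \<omega> n" "\<And>n. 0 \<le> \<omega> n"
proof -
  have uc: "uniformly_continuous_on (closure Q) \<phi>"
    by (intro compact_uniformly_continuous test_continuous_on assms) (simp add: bounded_Q)
  obtain M where M: "M \<ge> 0" "\<And>x. \<bar>\<phi> x\<bar> \<le> M" using test_bounded[OF assms] by metis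
  define S where "S n = insert 0 {\<bar>\<phi> x - \<phi> (node A)\<bar> |x A. A \<in> cells n \<and> x \<in> A}" for n
  define \<omega> where "\<omega> n = Sup (S n)" for n
  have bdd: "bdd_above (S n)" for n
  proof (rule bdd_aboveI[of _ "2 * M"])
    fix s assume "s \<in> S n"
    then show "s \<le> 2 * M"
      using M(1) by (auto simp: S_def intro!: order_trans[OF abs_triangle_ineq4] add_mono[OF M(2) M(2), THEN order_trans])
  qed
  show thesis
  proof (rule that)
    show "\<bar>\<phi> x - \<phi> (node A)\<bar> \<le> \<omega> n" if "A \<in> cells n" "x \<in> A" for n A x
      unfolding \<omega>_def by (rule cSup_upper[OF _ bdd]) (use that in \<open>auto simp: S_def\<close>)
    show nn: "0 \<le> \<omega> n" for n
      unfolding \<omega>_def by (rule cSup_upper[OF _ bdd]) (auto simp: S_def)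
    show "\<omega> \<longlonglongrightarrow> 0"
    proof (rule LIMSEQ_I)
      fix r :: real assume "r > 0"
      then have "r/2 > 0" by simp
      then obtain \<delta> where \<delta>: "\<delta> > 0" "\<And>x y. x \<in> closure Q \<Longrightarrow> y \<in> closure Q \<Longrightarrow> dist y x < \<delta> \<Longrightarrow> dist (\<phi> y) (\<phi> x) < r/2"
        using uc unfolding uniformly_continuous_on_def by meson
      obtain N where N: "1 / real (Suc N) < \<delta>"
        using \<delta>(1) nat_approx_posE by blast
      have "\<omega> n \<le> r/2" if n: "n \<ge> N" for n
        unfolding \<omega>_def
      proof (rule cSup_least)
        fix s assume "s \<in> S n"
        then consider "s = 0" | x A where "s = \<bar>\<phi> x - \<phi> (node A)\<bar>" "A \<in> cells n" "x \<in> A"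
          by (auto simp: S_def)
        then show "s \<le> r/2"
        proof cases
          case 2
          have "dist x (node A) < 1 / real (Suc n)"
            using cells[of n] 2 node_in[OF 2(2)] by (auto simp: fine_partition_def)
          also have "\<dots> \<le> 1 / real (Suc N)" using n by (simp add: field_simps)
          finally have "dist x (node A) < \<delta>" using N by simp
          moreover have "x \<in> closure Q" "node A \<in> closure Q"
            using 2 node_in[OF 2(2)] cells_simps(6)[OF 2(2)] closure_subset by blast+
          ultimately have "dist (\<phi> x) (\<phi> (node A)) < r/2" by (intro \<delta>(2))
          then show ?thesis by (simp add: 2 dist_real_def)
        qed (use \<open>r > 0\<close> in simp)
      qed (auto simp: S_def)
      moreover have "r/2 < r" using \<open>r > 0\<close> by simp
      ultimately show "\<exists>no. \<forall>n\<ge>no. norm (\<omega> n - 0) < r"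
        using nn by (metis abs_of_nonneg diff_zero le_less_trans real_norm_def)
    qed
  qed
qed

text \<open>
  On a cell the integrand \<open>\<phi> (X t)\<close> differs from its value at the node by at most the oscillation \<open>e\<close>. The
  map \<open>X\<close> is the identity for densities on \<open>Q\<close>, and a component of a space-filling curve for the measures
  that arise as weak limits.
\<close>
lemma density_riemann_estimate:
  fixes h :: "'a \<Rightarrow> 'x::euclidean_space" and X :: "'a \<Rightarrow> real^'n"
  assumes X: "X \<in> borel_measurable M" and h: "integrable M h" and \<phi>: "\<phi> \<in> test_functions"
    and e: "\<And>A x. A \<in> cells n \<Longrightarrow> x \<in> A \<Longrightarrow> \<bar>\<phi> x - \<phi> (node A)\<bar> \<le> e" and "e \<ge> 0"
  shows "norm ((\<integral>t. \<phi> (X t) *\<^sub>R h t \<partial>M) - riemann_sum (\<lambda>A. \<integral>t. indicator A (X t) *\<^sub>R h t \<partial>M) \<phi> n)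
     \<le> e * (\<integral>t. norm (h t) \<partial>M)"
proof -
  note [measurable] = X borel_measurable_integrable[OF h] test_borel[OF \<phi>]
  obtain C where C: "\<And>x. \<bar>\<phi> x\<bar> \<le> C" using test_bounded[OF \<phi>] by metis
  have bnd: "integrable M (\<lambda>t. g t *\<^sub>R h t)" if [measurable]: "g \<in> borel_measurable M" and "\<And>t. \<bar>g t\<bar> \<le> C" for g and C :: real
  proof (rule Bochner_Integration.integrable_bound[where f="\<lambda>t. C * norm (h t)"])
    have "\<bar>g t\<bar> * norm (h t) \<le> \<bar>C\<bar> * norm (h t)" for t
      using that(2)[of t] by (intro mult_right_mono) auto
    then show "AE t in M. norm (g t *\<^sub>R h t) \<le> norm (C * norm (h t))"
      by (simp add: abs_mult)
  qed (use h in auto)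
  have A[measurable]: "A \<in> sets borel" if "A \<in> cells n" for A
    using cells_simps(5)[OF that] by (simp add: borel_Q_iff)
  have i1: "integrable M (\<lambda>t. \<phi> (X t) *\<^sub>R h t)"
    by (rule bnd[OF _ C]) measurable
  have i2: "integrable M (\<lambda>t. indicat_real A (X t) *\<^sub>R h t)" if "A \<in> cells n" for A
    by (rule bnd[where C=1]) (use A[OF that] in \<open>auto simp: indicator_def\<close>)
  have r: "riemann_sum (\<lambda>A. \<integral>t. indicator A (X t) *\<^sub>R h t \<partial>M) \<phi> n
       = (\<integral>t. (\<Sum>A\<in>cells n. \<phi> (node A) *\<^sub>R (indicator A (X t) *\<^sub>R h t)) \<partial>M)"
    unfolding riemann_sum_def using i2 by (subst Bochner_Integration.integral_sum) (auto simp del: scaleR_scaleR)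
  have i3: "integrable M (\<lambda>t. \<Sum>A\<in>cells n. \<phi> (node A) *\<^sub>R (indicat_real A (X t) *\<^sub>R h t))"
    using i2 by (auto simp del: scaleR_scaleR)
  have "norm ((\<integral>t. \<phi> (X t) *\<^sub>R h t \<partial>M) - riemann_sum (\<lambda>A. \<integral>t. indicator A (X t) *\<^sub>R h t \<partial>M) \<phi> n)
    = norm (\<integral>t. \<phi> (X t) *\<^sub>R h t - (\<Sum>A\<in>cells n. \<phi> (node A) *\<^sub>R (indicat_real A (X t) *\<^sub>R h t)) \<partial>M)"
    unfolding r by (subst Bochner_Integration.integral_diff[OF i1 i3]) simp
  also have "\<dots> \<le> (\<integral>t. norm (\<phi> (X t) *\<^sub>R h t - (\<Sum>A\<in>cells n. \<phi> (node A) *\<^sub>R (indicat_real A (X t) *\<^sub>R h t))) \<partial>M)"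
    by (rule integral_norm_bound)
  also have "\<dots> \<le> (\<integral>t. e * norm (h t) \<partial>M)"
  proof (rule integral_mono)
    fix t
    show "norm (\<phi> (X t) *\<^sub>R h t - (\<Sum>A\<in>cells n. \<phi> (node A) *\<^sub>R (indicat_real A (X t) *\<^sub>R h t))) \<le> e * norm (h t)"
    proof (cases "X t \<in> Q")
      case True
      then obtain A where A: "A \<in> cells n" "X t \<in> A" using cells_simps(4)[of n] by blast
      have "(\<Sum>B\<in>cells n. \<phi> (node B) *\<^sub>R (indicat_real B (X t) *\<^sub>R h t)) = (\<Sum>B\<in>{A}. \<phi> (node B) *\<^sub>R (indicat_real B (X t) *\<^sub>R h t))"
        using A cells_simps(1,2)[of n] by (intro sum.mono_neutral_right) (auto simp: disjoint_def indicator_def)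
      then have "norm (\<phi> (X t) *\<^sub>R h t - (\<Sum>A\<in>cells n. \<phi> (node A) *\<^sub>R (indicat_real A (X t) *\<^sub>R h t)))
          = \<bar>\<phi> (X t) - \<phi> (node A)\<bar> * norm (h t)"
        using A by (simp add: scaleR_left_diff_distrib[symmetric])
      also have "\<dots> \<le> e * norm (h t)" by (intro mult_right_mono e A) auto
      finally show ?thesis .
    next
      case False
      then have "indicat_real A (X t) = 0" if "A \<in> cells n" for A
        using cells_simps(6)[OF that] by (auto simp: indicator_def)
      then show ?thesis using False test_zero[OF \<phi>] \<open>e \<ge> 0\<close> by simp
    qed
  qed (intro integrable_norm Bochner_Integration.integrable_diff i1 i3 integrable_mult_right h)+
  finally show ?thesis using h by simp
qed

lemma measurable_restrict_borel_id: "sets N = borel_Q \<Longrightarrow> (\<lambda>x::real^'n. x) \<in> borel_measurable N"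
  using measurable_cong_sets[of N "restrict_space borel Q" borel borel]
    measurable_restrict_space1[OF measurable_ident[of "borel :: (real^'n) measure"], of Q] by (simp add: id_def)

lemma signed_integral_riemann_estimate:
  fixes \<nu> :: "(real^'n) set \<Rightarrow> real"
  assumes \<nu>: "bounded_Radon \<nu>" and \<phi>: "\<phi> \<in> test_functions"
    and e: "\<And>A x. A \<in> cells n \<Longrightarrow> x \<in> A \<Longrightarrow> \<bar>\<phi> x - \<phi> (node A)\<bar> \<le> e" and "e \<ge> 0"
  shows "\<bar>signed_integral \<nu> \<phi> - riemann_sum \<nu> \<phi> n\<bar> \<le> 2 * e * enn2real (total_variation \<nu>)"
proof -
  have n\<nu>: "bounded_Radon (\<lambda>A. - \<nu> A)" and ntv: "total_variation (\<lambda>A. - \<nu> A) \<le> total_variation \<nu>"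
    using bounded_Radon_bounded_linear[OF \<nu>, of uminus] by (simp_all add: bounded_linear_minus bounded_linear_ident)
  have est: "\<bar>(\<integral>x. \<phi> x \<partial>positive_part \<nu>) - riemann_sum (measure (positive_part \<nu>)) \<phi> n\<bar> \<le> e * enn2real (total_variation \<nu>)"
    if \<nu>: "bounded_Radon \<nu>" for \<nu> :: "(real^'n) set \<Rightarrow> real"
  proof -
    interpret p: finite_measure "positive_part \<nu>" by (rule positive_part_finite[OF \<nu>])
    have "norm ((\<integral>x. \<phi> x *\<^sub>R (1::real) \<partial>positive_part \<nu>) - riemann_sum (\<lambda>A. \<integral>x. indicator A x *\<^sub>R (1::real) \<partial>positive_part \<nu>) \<phi> n)
       \<le> e * (\<integral>x. norm (1::real) \<partial>positive_part \<nu>)"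
      by (rule density_riemann_estimate[OF _ _ \<phi> e \<open>e \<ge> 0\<close>])
         (auto intro!: measurable_restrict_borel_id sets_positive_part \<nu>)
    moreover have "riemann_sum (\<lambda>A. \<integral>x. indicator A x *\<^sub>R (1::real) \<partial>positive_part \<nu>) \<phi> n = riemann_sum (measure (positive_part \<nu>)) \<phi> n"
      unfolding riemann_sum_def
      by (intro sum.cong) (simp_all add: space_positive_part[OF \<nu>] Int_absorb2[OF cells_simps(6)])
    ultimately have "\<bar>(\<integral>x. \<phi> x \<partial>positive_part \<nu>) - riemann_sum (measure (positive_part \<nu>)) \<phi> n\<bar> \<le> e * measure (positive_part \<nu>) Q"
      by (simp add: space_positive_part[OF \<nu>])
    also have "\<dots> \<le> e * enn2real (total_variation \<nu>)"
      by (intro mult_left_mono positive_part_finite \<nu> \<open>e \<ge> 0\<close>)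
    finally show ?thesis .
  qed
  have "riemann_sum \<nu> \<phi> n = riemann_sum (measure (positive_part \<nu>)) \<phi> n - riemann_sum (measure (positive_part (\<lambda>A. - \<nu> A))) \<phi> n"
    unfolding riemann_sum_def sum_subtractf[symmetric]
    by (intro sum.cong refl) (simp add: jordan_decomposition[OF \<nu> cells_simps(5)] right_diff_distrib)
  moreover have "enn2real (total_variation (\<lambda>A. - \<nu> A)) \<le> enn2real (total_variation \<nu>)"
    using \<nu> by (intro enn2real_mono ntv) (auto simp: bounded_Radon_def)
  then have "e * enn2real (total_variation (\<lambda>A. - \<nu> A)) \<le> e * enn2real (total_variation \<nu>)"
    by (intro mult_left_mono \<open>e \<ge> 0\<close>)
  ultimately show ?thesis
    using est[OF \<nu>] est[OF n\<nu>] unfolding signed_integral_def by linarith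
qed

lemma vector_integral_riemann_estimate:
  fixes \<mu> :: "(real^'n) set \<Rightarrow> 'x::euclidean_space" and e :: real
  assumes \<mu>: "bounded_Radon \<mu>" and \<phi>: "\<phi> \<in> test_functions"
    and e: "\<And>A x. A \<in> cells n \<Longrightarrow> x \<in> A \<Longrightarrow> \<bar>\<phi> x - \<phi> (node A)\<bar> \<le> e" and "e \<ge> 0"
  shows "norm (vector_integral \<mu> \<phi> - riemann_sum \<mu> \<phi> n) \<le> 2 * DIM('x) * e * enn2real (total_variation \<mu>)"
proof -
  have "norm (vector_integral \<mu> \<phi> - riemann_sum \<mu> \<phi> n) \<le> (\<Sum>b\<in>Basis. \<bar>(vector_integral \<mu> \<phi> - riemann_sum \<mu> \<phi> n) \<bullet> b\<bar>)"
    by (rule norm_le_l1)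
  also have "\<dots> \<le> (\<Sum>b\<in>(Basis::'x set). 2 * e * enn2real (total_variation \<mu>))"
  proof (rule sum_mono)
    fix b :: 'x assume b: "b \<in> Basis"
    have nb: "norm (x \<bullet> b) \<le> norm x" for x using b by (simp add: Basis_le_norm)
    note c = bounded_Radon_bounded_linear[OF \<mu> bounded_linear_inner_left nb]
    have "vector_integral \<mu> \<phi> \<bullet> b = signed_integral (\<lambda>A. \<mu> A \<bullet> b) \<phi>"
      unfolding vector_integral_def using b by simp
    moreover have "riemann_sum \<mu> \<phi> n \<bullet> b = riemann_sum (\<lambda>A. \<mu> A \<bullet> b) \<phi> n"
      by (simp add: riemann_sum_def inner_sum_left)
    ultimately have "\<bar>(vector_integral \<mu> \<phi> - riemann_sum \<mu> \<phi> n) \<bullet> b\<bar> \<le> 2 * e * enn2real (total_variation (\<lambda>A. \<mu> A \<bullet> b))"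
      using signed_integral_riemann_estimate[OF c(1) \<phi> e \<open>e \<ge> 0\<close>] by (simp add: inner_diff_left)
    also have "\<dots> \<le> 2 * e * enn2real (total_variation \<mu>)"
      using \<open>e \<ge> 0\<close> \<mu> by (intro mult_left_mono enn2real_mono c) (auto simp: bounded_Radon_def)
    finally show "\<bar>(vector_integral \<mu> \<phi> - riemann_sum \<mu> \<phi> n) \<bullet> b\<bar> \<le> 2 * e * enn2real (total_variation \<mu>)" .
  qed
  finally show ?thesis by simp
qed

lemma riemann_sum_tendsto:
  fixes \<mu> :: "(real^'n) set \<Rightarrow> 'x::euclidean_space"
  assumes \<mu>: "bounded_Radon \<mu>" and \<phi>: "\<phi> \<in> test_functions"
  shows "riemann_sum \<mu> \<phi> \<longlonglongrightarrow> vector_integral \<mu> \<phi>"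
proof -
  obtain \<omega> where \<omega>: "\<omega> \<longlonglongrightarrow> 0" "\<And>n A x. A \<in> cells n \<Longrightarrow> x \<in> A \<Longrightarrow> \<bar>\<phi> x - \<phi> (node A)\<bar> \<le> \<omega> n" "\<And>n. 0 \<le> \<omega> n"
    using oscillation_tendsto_0[OF \<phi>] by metis
  have "(\<lambda>n. 2 * DIM('x) * \<omega> n * enn2real (total_variation \<mu>)) \<longlonglongrightarrow> 2 * DIM('x) * (0::real) * enn2real (total_variation \<mu>)"
    by (intro tendsto_intros \<omega>)
  then have lim: "(\<lambda>n. 2 * DIM('x) * \<omega> n * enn2real (total_variation \<mu>)) \<longlonglongrightarrow> 0" by simp
  have "norm (vector_integral \<mu> \<phi> - riemann_sum \<mu> \<phi> n) \<le> 2 * DIM('x) * \<omega> n * enn2real (total_variation \<mu>)" for n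
    by (intro vector_integral_riemann_estimate[OF \<mu> \<phi> \<omega>(2,3)])
  then have "(\<lambda>n. vector_integral \<mu> \<phi> - riemann_sum \<mu> \<phi> n) \<longlonglongrightarrow> 0"
    by (intro Lim_null_comparison[OF always_eventually lim] allI)
  then have "(\<lambda>n. vector_integral \<mu> \<phi> - (vector_integral \<mu> \<phi> - riemann_sum \<mu> \<phi> n)) \<longlonglongrightarrow> vector_integral \<mu> \<phi> - 0"
    by (rule tendsto_diff[OF tendsto_const])
  then show ?thesis by simp
qed

section \<open>Linear combinations and bounds\<close>

lemma total_variation_lincomb:
  fixes \<mu> \<nu> :: "(real^'n) set \<Rightarrow> 'x::euclidean_space"
  shows "total_variation (\<lambda>A. a *\<^sub>R \<mu> A + b *\<^sub>R \<nu> A)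
     \<le> ennreal \<bar>a\<bar> * total_variation \<mu> + ennreal \<bar>b\<bar> * total_variation \<nu>"
proof (rule total_variation_le)
  fix P :: "(real^'n) set set" assume P: "finite P" "disjoint P" "P \<subseteq> borel_Q"
  have "(\<Sum>A\<in>P. norm (a *\<^sub>R \<mu> A + b *\<^sub>R \<nu> A)) \<le> (\<Sum>A\<in>P. \<bar>a\<bar> * norm (\<mu> A) + \<bar>b\<bar> * norm (\<nu> A))"
    by (intro sum_mono norm_triangle_le) simp
  also have "\<dots> = \<bar>a\<bar> * (\<Sum>A\<in>P. norm (\<mu> A)) + \<bar>b\<bar> * (\<Sum>A\<in>P. norm (\<nu> A))"
    by (simp add: sum.distrib sum_distrib_left)
  finally have "ennreal (\<Sum>A\<in>P. norm (a *\<^sub>R \<mu> A + b *\<^sub>R \<nu> A))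
      \<le> ennreal \<bar>a\<bar> * ennreal (\<Sum>A\<in>P. norm (\<mu> A)) + ennreal \<bar>b\<bar> * ennreal (\<Sum>A\<in>P. norm (\<nu> A))"
    by (simp add: ennreal_mult[symmetric] ennreal_plus[symmetric] sum_nonneg ennreal_leI del: ennreal_plus)
  also have "\<dots> \<le> ennreal \<bar>a\<bar> * total_variation \<mu> + ennreal \<bar>b\<bar> * total_variation \<nu>"
    by (intro add_mono mult_left_mono norm_sum_le_total_variation P) auto
  finally show "ennreal (\<Sum>A\<in>P. norm (a *\<^sub>R \<mu> A + b *\<^sub>R \<nu> A))
      \<le> ennreal \<bar>a\<bar> * total_variation \<mu> + ennreal \<bar>b\<bar> * total_variation \<nu>" .
qed

lemma bounded_Radon_lincomb:
  fixes \<mu> \<nu> :: "(real^'n) set \<Rightarrow> 'x::euclidean_space"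
  assumes "bounded_Radon \<mu>" "bounded_Radon \<nu>"
  shows "bounded_Radon (\<lambda>A. a *\<^sub>R \<mu> A + b *\<^sub>R \<nu> A)"
  unfolding bounded_Radon_def
proof (intro conjI allI impI)
  fix A :: "nat \<Rightarrow> (real^'n) set" assume "range A \<subseteq> borel_Q \<and> disjoint_family A"
  then show "(\<lambda>i. a *\<^sub>R \<mu> (A i) + b *\<^sub>R \<nu> (A i)) sums (a *\<^sub>R \<mu> (\<Union>i. A i) + b *\<^sub>R \<nu> (\<Union>i. A i))"
    by (intro sums_add sums_scaleR_right bounded_Radon_sums assms) auto
next
  have "total_variation \<mu> < top" "total_variation \<nu> < top"
    using assms by (auto simp: bounded_Radon_def)
  then have "ennreal \<bar>a\<bar> * total_variation \<mu> + ennreal \<bar>b\<bar> * total_variation \<nu> < top"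
    by (simp add: ennreal_mult_less_top)
  then show "total_variation (\<lambda>A. a *\<^sub>R \<mu> A + b *\<^sub>R \<nu> A) < \<infinity>"
    by (simp add: le_less_trans[OF total_variation_lincomb])
qed

lemma vector_integral_lincomb:
  fixes \<mu> \<nu> :: "(real^'n) set \<Rightarrow> 'x::euclidean_space"
  assumes "bounded_Radon \<mu>" "bounded_Radon \<nu>" and \<phi>: "\<phi> \<in> test_functions"
  shows "vector_integral (\<lambda>A. a *\<^sub>R \<mu> A + b *\<^sub>R \<nu> A) \<phi> = a *\<^sub>R vector_integral \<mu> \<phi> + b *\<^sub>R vector_integral \<nu> \<phi>"
proof -
  have "riemann_sum (\<lambda>A. a *\<^sub>R \<mu> A + b *\<^sub>R \<nu> A) \<phi> = (\<lambda>n. a *\<^sub>R riemann_sum \<mu> \<phi> n + b *\<^sub>R riemann_sum \<nu> \<phi> n)"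
    by (simp add: riemann_sum_def fun_eq_iff scaleR_add_right sum.distrib scaleR_sum_right mult.commute)
  moreover have "(\<lambda>n. a *\<^sub>R riemann_sum \<mu> \<phi> n + b *\<^sub>R riemann_sum \<nu> \<phi> n) \<longlonglongrightarrow> a *\<^sub>R vector_integral \<mu> \<phi> + b *\<^sub>R vector_integral \<nu> \<phi>"
    by (intro tendsto_add tendsto_scaleR tendsto_const riemann_sum_tendsto assms)
  ultimately have "riemann_sum (\<lambda>A. a *\<^sub>R \<mu> A + b *\<^sub>R \<nu> A) \<phi> \<longlonglongrightarrow> a *\<^sub>R vector_integral \<mu> \<phi> + b *\<^sub>R vector_integral \<nu> \<phi>"
    by simp
  then show ?thesis
    by (rule LIMSEQ_unique[OF riemann_sum_tendsto[OF bounded_Radon_lincomb[OF assms(1,2)] \<phi>]])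
qed

lemma norm_vector_integral_le:
  fixes \<mu> :: "(real^'n) set \<Rightarrow> 'x::euclidean_space"
  assumes \<mu>: "bounded_Radon \<mu>" and \<phi>: "\<phi> \<in> test_functions" and M: "\<And>x. \<bar>\<phi> x\<bar> \<le> M"
  shows "norm (vector_integral \<mu> \<phi>) \<le> M * enn2real (total_variation \<mu>)"
proof (rule tendsto_upperbound[OF tendsto_norm[OF riemann_sum_tendsto[OF \<mu> \<phi>]]])
  have M0: "M \<ge> 0" using M[of 0] by simp
  have "norm (riemann_sum \<mu> \<phi> n) \<le> M * enn2real (total_variation \<mu>)" for n
  proof -
    have "norm (riemann_sum \<mu> \<phi> n) \<le> (\<Sum>A\<in>cells n. M * norm (\<mu> A))"
      unfolding riemann_sum_def by (intro sum_norm_le) (simp add: M mult_right_mono)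
    also have "\<dots> = M * (\<Sum>A\<in>cells n. norm (\<mu> A))" by (simp add: sum_distrib_left)
    also have "(\<Sum>A\<in>cells n. norm (\<mu> A)) \<le> enn2real (total_variation \<mu>)"
    proof -
      have "ennreal (\<Sum>A\<in>cells n. norm (\<mu> A)) \<le> total_variation \<mu>"
        by (rule norm_sum_le_total_variation) (simp_all add: cells_simps)
      then have "enn2real (ennreal (\<Sum>A\<in>cells n. norm (\<mu> A))) \<le> enn2real (total_variation \<mu>)"
        by (rule enn2real_mono) (use \<mu> in \<open>simp add: bounded_Radon_def\<close>)
      then show ?thesis by (simp add: sum_nonneg)
    qed
    finally show ?thesis using M0 by (simp add: mult_left_mono)
  qed
  then show "\<forall>\<^sub>F n in sequentially. norm (riemann_sum \<mu> \<phi> n) \<le> M * enn2real (total_variation \<mu>)"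
    by simp
qed simp

section \<open>The measure norm of a distribution\<close>

lemma Mb_norm_le: "represents \<mu> T \<Longrightarrow> Mb_norm T \<le> total_variation \<mu>"
  unfolding Mb_norm_def by (rule INF_lower) simp

lemma Mb_norm_less:
  assumes "Mb_norm T < c"
  obtains \<mu> where "represents \<mu> T" "total_variation \<mu> < c"
  using assms unfolding Mb_norm_def by (auto simp: INF_less_iff)

lemma Mb_norm_less_top_iff: "Mb_norm T < top \<longleftrightarrow> (\<exists>\<mu>. represents \<mu> T)"
proof
  assume "\<exists>\<mu>. represents \<mu> T"
  then obtain \<mu> where "represents \<mu> T" by blast
  then show "Mb_norm T < top"
    using Mb_norm_le[of \<mu> T] by (auto simp: represents_def bounded_Radon_def intro: le_less_trans)
qed (auto elim: Mb_norm_less)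

lemma represents_cong: "(\<And>\<phi>. \<phi> \<in> test_functions \<Longrightarrow> S \<phi> = T \<phi>) \<Longrightarrow> represents \<mu> S \<longleftrightarrow> represents \<mu> T"
  by (simp add: represents_def)

lemma Mb_norm_cong: "(\<And>\<phi>. \<phi> \<in> test_functions \<Longrightarrow> S \<phi> = T \<phi>) \<Longrightarrow> Mb_norm S = Mb_norm T"
  unfolding Mb_norm_def by (simp cong: represents_cong)

lemma represents_lincomb:
  fixes \<mu> \<nu> :: "(real^'n) set \<Rightarrow> 'x::euclidean_space"
  assumes "represents \<mu> S" "represents \<nu> T"
  shows "represents (\<lambda>A. a *\<^sub>R \<mu> A + b *\<^sub>R \<nu> A) (\<lambda>\<phi>. a *\<^sub>R S \<phi> + b *\<^sub>R T \<phi>)"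
  using assms by (simp add: represents_def bounded_Radon_lincomb vector_integral_lincomb)

text \<open>
  Almost optimal representing measures of \<open>S\<close> and \<open>T\<close> combine to a representing measure of the linear
  combination.
\<close>
lemma Mb_norm_lincomb:
  fixes S T :: "('n::finite, 'x::euclidean_space) functional"
  assumes "a \<noteq> 0" "b \<noteq> 0"
  shows "Mb_norm (\<lambda>\<phi>. a *\<^sub>R S \<phi> + b *\<^sub>R T \<phi>) \<le> ennreal \<bar>a\<bar> * Mb_norm S + ennreal \<bar>b\<bar> * Mb_norm T"
proof (rule ennreal_le_epsilon)
  fix e :: real
  assume fin: "ennreal \<bar>a\<bar> * Mb_norm S + ennreal \<bar>b\<bar> * Mb_norm T < top" and e: "0 < e"
  then have fS: "Mb_norm S < top" and fT: "Mb_norm T < top"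
    using assms by (auto simp: ennreal_mult_less_top less_top)
  have "Mb_norm S < Mb_norm S + ennreal (e / (2 * \<bar>a\<bar>))" "Mb_norm T < Mb_norm T + ennreal (e / (2 * \<bar>b\<bar>))"
    using fS fT e assms by (auto simp: ennreal_add_left_cancel_less[of _ 0, simplified])
  then obtain \<mu> \<nu> where \<mu>: "represents \<mu> S" "total_variation \<mu> < Mb_norm S + ennreal (e / (2 * \<bar>a\<bar>))"
    and \<nu>: "represents \<nu> T" "total_variation \<nu> < Mb_norm T + ennreal (e / (2 * \<bar>b\<bar>))"
    by (elim Mb_norm_less)
  have "Mb_norm (\<lambda>\<phi>. a *\<^sub>R S \<phi> + b *\<^sub>R T \<phi>) \<le> total_variation (\<lambda>A. a *\<^sub>R \<mu> A + b *\<^sub>R \<nu> A)"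
    by (intro Mb_norm_le represents_lincomb \<mu> \<nu>)
  also have "\<dots> \<le> ennreal \<bar>a\<bar> * total_variation \<mu> + ennreal \<bar>b\<bar> * total_variation \<nu>"
    by (rule total_variation_lincomb)
  also have "\<dots> \<le> ennreal \<bar>a\<bar> * (Mb_norm S + ennreal (e / (2 * \<bar>a\<bar>))) + ennreal \<bar>b\<bar> * (Mb_norm T + ennreal (e / (2 * \<bar>b\<bar>)))"
    using \<mu>(2) \<nu>(2) by (intro add_mono mult_left_mono) auto
  also have "\<dots> = ennreal \<bar>a\<bar> * Mb_norm S + ennreal \<bar>b\<bar> * Mb_norm T + (ennreal \<bar>a\<bar> * ennreal (e / (2 * \<bar>a\<bar>)) + ennreal \<bar>b\<bar> * ennreal (e / (2 * \<bar>b\<bar>)))"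
    by (simp add: distrib_left ac_simps)
  also have "ennreal \<bar>a\<bar> * ennreal (e / (2 * \<bar>a\<bar>)) = ennreal (e/2)"
    using e assms by (subst ennreal_mult[symmetric]) auto
  also have "ennreal \<bar>b\<bar> * ennreal (e / (2 * \<bar>b\<bar>)) = ennreal (e/2)"
    using e assms by (subst ennreal_mult[symmetric]) auto
  also have "ennreal (e/2) + ennreal (e/2) = ennreal e"
    using e by (subst ennreal_plus[symmetric]) auto
  finally show "Mb_norm (\<lambda>\<phi>. a *\<^sub>R S \<phi> + b *\<^sub>R T \<phi>) \<le> ennreal \<bar>a\<bar> * Mb_norm S + ennreal \<bar>b\<bar> * Mb_norm T + ennreal e" .
qed

lemma Mb_norm_add:
  fixes S T :: "('n::finite, 'x::euclidean_space) functional"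
  shows "Mb_norm (\<lambda>\<phi>. S \<phi> + T \<phi>) \<le> Mb_norm S + Mb_norm T"
  using Mb_norm_lincomb[of 1 1 S T] by simp

lemma Mb_norm_scaleR:
  fixes T :: "('n::finite, 'x::euclidean_space) functional"
  assumes "a \<noteq> 0"
  shows "Mb_norm (\<lambda>\<phi>. a *\<^sub>R T \<phi>) \<le> ennreal \<bar>a\<bar> * Mb_norm T"
proof -
  have "Mb_norm (\<lambda>\<phi>. (a/2) *\<^sub>R T \<phi> + (a/2) *\<^sub>R T \<phi>) \<le> ennreal \<bar>a/2\<bar> * Mb_norm T + ennreal \<bar>a/2\<bar> * Mb_norm T"
    using assms by (intro Mb_norm_lincomb) auto
  also have "\<dots> = (ennreal \<bar>a/2\<bar> + ennreal \<bar>a/2\<bar>) * Mb_norm T" by (simp add: distrib_right)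
  also have "ennreal \<bar>a/2\<bar> + ennreal \<bar>a/2\<bar> = ennreal \<bar>a\<bar>" by (subst ennreal_plus[symmetric]) auto
  finally show ?thesis by (simp add: scaleR_add_left[symmetric])
qed

lemma norm_functional_le_Mb_norm:
  fixes T :: "('n::finite, 'x::euclidean_space) functional"
  assumes T: "Mb_norm T \<le> ennreal c" "c \<ge> 0" and \<phi>: "\<phi> \<in> test_functions" and M: "\<And>x. \<bar>\<phi> x\<bar> \<le> M"
  shows "norm (T \<phi>) \<le> M * c"
proof (rule field_le_epsilon)
  fix e :: real assume e: "0 < e"
  have M0: "M \<ge> 0" using M[of 0] by simp
  define d where "d = e / (M + 1)"
  have d: "d > 0" "M * d \<le> e" using e M0 by (auto simp: d_def field_simps)
  have "Mb_norm T < ennreal (c + d)"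
    using T d by (intro le_less_trans[OF T(1)] ennreal_lessI) auto
  then obtain \<mu> where \<mu>: "represents \<mu> T" "total_variation \<mu> < ennreal (c + d)" by (rule Mb_norm_less)
  have "norm (T \<phi>) \<le> M * enn2real (total_variation \<mu>)"
    using \<mu>(1) \<phi> M norm_vector_integral_le[of \<mu> \<phi> M] by (auto simp: represents_def)
  also have "\<dots> \<le> M * (c + d)"
    using \<mu>(2) T d M0 by (intro mult_left_mono enn2real_leI) auto
  also have "\<dots> \<le> M * c + e" using d by (simp add: distrib_left)
  finally show "norm (T \<phi>) \<le> M * c + e" .
qed

section \<open>Measures with densities\<close>

lemma sum_indicator_disjoint_le_1:
  assumes "finite P" "disjoint P" shows "(\<Sum>A\<in>P. indicat_real A x) \<le> 1"
proof (cases "\<exists>A\<in>P. x \<in> A")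
  case True
  then obtain A where A: "A \<in> P" "x \<in> A" by blast
  have "(\<Sum>B\<in>P. indicat_real B x) = (\<Sum>B\<in>{A}. indicat_real B x)"
    using A assms by (intro sum.mono_neutral_right) (auto simp: disjoint_def indicator_def)
  then show ?thesis using A by simp
next
  case False
  then have "(\<Sum>B\<in>P. indicat_real B x) = 0" by (intro sum.neutral) auto
  then show ?thesis by simp
qed

text \<open>
  Here the measure is given by a density with respect to \<open>M\<close>, pushed forward by \<open>X\<close>. Its integrals have
  the expected form because both sides are limits of the same Riemann sums.
\<close>
lemma density_Radon:
  fixes h :: "'a \<Rightarrow> 'x::euclidean_space" and X :: "'a \<Rightarrow> real^'n"
  assumes X: "X \<in> borel_measurable M" and h: "integrable M h"
  defines "\<mu> \<equiv> \<lambda>A. \<integral>t. indicator A (X t) *\<^sub>R h t \<partial>M"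
  shows "bounded_Radon \<mu>"
    and "total_variation \<mu> \<le> ennreal (\<integral>t. norm (h t) \<partial>M)"
    and "\<phi> \<in> test_functions \<Longrightarrow> vector_integral \<mu> \<phi> = (\<integral>t. \<phi> (X t) *\<^sub>R h t \<partial>M)"
proof -
  note [measurable] = X borel_measurable_integrable[OF h]
  have int: "integrable M (\<lambda>t. indicat_real A (X t) *\<^sub>R h t)" if [measurable]: "A \<in> sets borel" for A
    by (rule Bochner_Integration.integrable_bound[OF h]) (auto simp: indicator_def)
  have int': "integrable M (\<lambda>t. indicat_real A (X t) * norm (h t))" if [measurable]: "A \<in> sets borel" for A
    by (rule Bochner_Integration.integrable_bound[OF h]) (auto simp: indicator_def)
  show tv: "total_variation \<mu> \<le> ennreal (\<integral>t. norm (h t) \<partial>M)"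
  proof (rule total_variation_le, rule ennreal_leI)
    fix P :: "(real^'n) set set" assume P: "finite P" "disjoint P" "P \<subseteq> borel_Q"
    have Pb: "A \<in> sets borel" if "A \<in> P" for A using P that by (auto simp: borel_Q_iff)
    have "(\<Sum>A\<in>P. norm (\<mu> A)) \<le> (\<Sum>A\<in>P. \<integral>t. indicat_real A (X t) * norm (h t) \<partial>M)"
      unfolding \<mu>_def by (intro sum_mono order_trans[OF integral_norm_bound]) simp
    also have "\<dots> = (\<integral>t. (\<Sum>A\<in>P. indicat_real A (X t) * norm (h t)) \<partial>M)"
      by (rule Bochner_Integration.integral_sum[symmetric]) (intro int' Pb)
    also have "\<dots> \<le> (\<integral>t. norm (h t) \<partial>M)"
    proof (rule integral_mono)
      show "integrable M (\<lambda>t. \<Sum>A\<in>P. indicat_real A (X t) * norm (h t))"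
        by (intro Bochner_Integration.integrable_sum int' Pb)
      show "(\<Sum>A\<in>P. indicat_real A (X t) * norm (h t)) \<le> norm (h t)" for t
        using mult_right_mono[OF sum_indicator_disjoint_le_1[OF P(1,2), of "X t"], of "norm (h t)"]
        by (simp add: sum_distrib_right)
    qed (use h in simp)
    finally show "(\<Sum>A\<in>P. norm (\<mu> A)) \<le> (\<integral>t. norm (h t) \<partial>M)" .
  qed
  show br: "bounded_Radon \<mu>"
    unfolding bounded_Radon_def
  proof (intro conjI allI impI)
    show "total_variation \<mu> < \<infinity>" using tv by (rule le_less_trans) simp
    fix A :: "nat \<Rightarrow> (real^'n) set" assume A: "range A \<subseteq> borel_Q \<and> disjoint_family A"
    then have "A i \<in> borel_Q" for i by blast
    then have Ab [measurable]: "A i \<in> sets borel" for i by (simp add: borel_Q_iff)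
    then have Un [measurable]: "(\<Union>i. A i) \<in> sets borel" by (intro sets.countable_UN) auto
    have sums: "(\<lambda>i. indicat_real (A i) x) sums indicator (\<Union>i. A i) x" for x
      by (rule indicator_sums) (use A in \<open>auto simp: disjoint_family_on_def\<close>)
    have "(\<lambda>n. \<integral>t. (\<Sum>i<n. indicat_real (A i) (X t)) *\<^sub>R h t \<partial>M) \<longlonglongrightarrow> (\<integral>t. indicat_real (\<Union>i. A i) (X t) *\<^sub>R h t \<partial>M)"
    proof (rule integral_dominated_convergence[where w="\<lambda>t. norm (h t)"])
      show "AE t in M. (\<lambda>n. (\<Sum>i<n. indicat_real (A i) (X t)) *\<^sub>R h t) \<longlonglongrightarrow> indicat_real (\<Union>i. A i) (X t) *\<^sub>R h t"
        using sums by (intro AE_I2 tendsto_scaleR tendsto_const) (simp add: sums_def)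
      show "AE t in M. norm ((\<Sum>i<n. indicat_real (A i) (X t)) *\<^sub>R h t) \<le> norm (h t)" for n
      proof (rule AE_I2)
        fix t
        have "(\<Sum>i<n. indicat_real (A i) (X t)) \<le> (\<Sum>i. indicat_real (A i) (X t))"
          by (rule sum_le_suminf) (use sums[of "X t"] in \<open>auto simp: sums_iff\<close>)
        also have "\<dots> = indicat_real (\<Union>i. A i) (X t)" using sums_unique[OF sums[of "X t"]] by (rule sym)
        also have "\<dots> \<le> 1" by (rule indicator_le_1)
        finally have "(\<Sum>i<n. indicat_real (A i) (X t)) \<le> 1" .
        then show "norm ((\<Sum>i<n. indicat_real (A i) (X t)) *\<^sub>R h t) \<le> norm (h t)"
          by (simp add: abs_of_nonneg sum_nonneg mult_left_le_one_le)
      qed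
    qed (use h in auto)
    moreover have "(\<integral>t. (\<Sum>i<n. indicat_real (A i) (X t)) *\<^sub>R h t \<partial>M) = (\<Sum>i<n. \<mu> (A i))" for n
      unfolding \<mu>_def scaleR_sum_left by (rule Bochner_Integration.integral_sum) (intro int Ab)
    ultimately show "(\<lambda>i. \<mu> (A i)) sums \<mu> (\<Union>i. A i)"
      unfolding sums_def by (simp add: \<mu>_def)
  qed
  show "vector_integral \<mu> \<phi> = (\<integral>t. \<phi> (X t) *\<^sub>R h t \<partial>M)" if \<phi>: "\<phi> \<in> test_functions"
  proof -
    obtain \<omega> where \<omega>: "\<omega> \<longlonglongrightarrow> 0" "\<And>n A x. A \<in> cells n \<Longrightarrow> x \<in> A \<Longrightarrow> \<bar>\<phi> x - \<phi> (node A)\<bar> \<le> \<omega> n" "\<And>n. 0 \<le> \<omega> n"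
      using oscillation_tendsto_0[OF \<phi>] by metis
    have "(\<lambda>n. \<omega> n * (\<integral>t. norm (h t) \<partial>M)) \<longlonglongrightarrow> 0 * (\<integral>t. norm (h t) \<partial>M)"
      by (intro tendsto_intros \<omega>)
    then have lim: "(\<lambda>n. \<omega> n * (\<integral>t. norm (h t) \<partial>M)) \<longlonglongrightarrow> 0" by simp
    have "norm ((\<integral>t. \<phi> (X t) *\<^sub>R h t \<partial>M) - riemann_sum \<mu> \<phi> n) \<le> \<omega> n * (\<integral>t. norm (h t) \<partial>M)" for n
      unfolding \<mu>_def by (intro density_riemann_estimate X h \<phi> \<omega>)
    then have "(\<lambda>n. (\<integral>t. \<phi> (X t) *\<^sub>R h t \<partial>M) - riemann_sum \<mu> \<phi> n) \<longlonglongrightarrow> 0"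
      by (intro Lim_null_comparison[OF always_eventually lim] allI)
    from tendsto_diff[OF tendsto_const this, of "\<integral>t. \<phi> (X t) *\<^sub>R h t \<partial>M"]
    have "riemann_sum \<mu> \<phi> \<longlonglongrightarrow> (\<integral>t. \<phi> (X t) *\<^sub>R h t \<partial>M)" by simp
    then show ?thesis by (rule LIMSEQ_unique[OF riemann_sum_tendsto[OF br \<phi>]])
  qed
qed

lemma L1_norm_eq: "v \<in> L1 \<Longrightarrow> L1_norm v = ennreal (\<integral>x. norm (v x) \<partial>leb_Q)"
  unfolding L1_norm_def L1_def by (intro nn_integral_eq_integral) auto

lemma represents_regular:
  fixes v :: "real^'n \<Rightarrow> 'x::euclidean_space"
  assumes "v \<in> L1"
  shows "represents (\<lambda>A. \<integral>x. indicator A x *\<^sub>R v x \<partial>leb_Q) (regular v)"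
    and Mb_norm_regular: "Mb_norm (regular v) \<le> L1_norm v"
proof -
  have id: "(\<lambda>x. x) \<in> borel_measurable (leb_Q :: (real^'n) measure)"
    by (rule borel_measurable_leb_Q) simp
  have v: "integrable leb_Q v" using assms by (simp add: L1_def)
  note d = density_Radon[OF id v]
  show r: "represents (\<lambda>A. \<integral>x. indicator A x *\<^sub>R v x \<partial>leb_Q) (regular v)"
    using d(1,3) by (simp add: represents_def regular_def)
  show "Mb_norm (regular v) \<le> L1_norm v"
    using Mb_norm_le[OF r] d(2) L1_norm_eq[OF assms] by auto
qed

section \<open>A space-filling curve\<close>

text \<open>
  The term \<open>arccos (cos (pi * t)) / pi\<close> is the distance of \<open>t\<close> to the nearest even integer. Hence \<open>zigzag\<close> is
  \<open>0\<close> within distance \<open>1/3\<close> of the even integers and \<open>1\<close> within distance \<open>1/3\<close> of the odd integers. Applied to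
  \<open>3 ^ m * t\<close>, it reads off the digit number \<open>m\<close> of a ternary expansion with digits \<open>0\<close> and \<open>2\<close>.
\<close>
definition zigzag :: "real \<Rightarrow> real" where
  "zigzag t = min 1 (max 0 (3 * (arccos (cos (pi * t)) / pi) - 1))"

text \<open>
  The \<open>j\<close>-th coordinate of Schoenberg's space-filling curve in dimension \<open>d\<close>: the ternary digits of \<open>t\<close> at the
  positions congruent to \<open>j\<close> modulo \<open>d\<close> become the binary digits of the coordinate.
\<close>
definition schoenberg :: "nat \<Rightarrow> nat \<Rightarrow> real \<Rightarrow> real" where
  "schoenberg d j t = (\<Sum>k. zigzag (3 ^ (d * k + j) * t) / 2 ^ Suc k)"

lemma zigzag_bounds: "0 \<le> zigzag t" "zigzag t \<le> 1"
  by (auto simp: zigzag_def)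

lemma continuous_on_zigzag: "continuous_on UNIV zigzag"
  unfolding zigzag_def[abs_def] by (intro continuous_intros) auto

lemma zigzag_shift:
  assumes "even m" "0 \<le> s" "s \<le> 1"
  shows "zigzag (real m + s) = min 1 (max 0 (3 * s - 1))"
proof -
  obtain k where m: "m = 2 * k" using assms(1) by auto
  have "pi * (real m + s) = pi * s + 2 * real k * pi" by (simp add: m algebra_simps)
  then have "cos (pi * (real m + s)) = cos (pi * s)"
    using cos.plus_of_nat[of "pi * s" k] by (simp add: mult_ac)
  then show ?thesis
    using assms by (simp add: zigzag_def arccos_cos)
qed

lemma continuous_on_schoenberg: "continuous_on UNIV (schoenberg d j)"
proof -
  have "uniform_limit UNIV (\<lambda>n t. \<Sum>k<n. zigzag (3 ^ (d * k + j) * t) / 2 ^ Suc k) (schoenberg d j) sequentially"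
    unfolding schoenberg_def
  proof (rule Weierstrass_m_test)
    show "norm (zigzag (3 ^ (d * k + j) * t) / 2 ^ Suc k) \<le> (1/2) ^ Suc k" for k t
      using zigzag_bounds[of "3 ^ (d * k + j) * t"] by (simp add: power_divide divide_right_mono)
    show "summable (\<lambda>k. (1/2::real) ^ Suc k)" by (subst summable_Suc_iff) (simp add: summable_geometric)
  qed
  then show ?thesis
    by (rule uniform_limit_theorem[rotated])
       (auto intro!: always_eventually continuous_intros continuous_on_compose2[OF continuous_on_zigzag])
qed

text \<open>
  Multiplication by \<open>3 ^ m\<close> turns the digits before position \<open>m\<close> into an even integer and leaves a remainder
  that lies in \<open>{0..1/3}\<close> or in \<open>{2/3..1}\<close> according to the digit at position \<open>m\<close>.
\<close>
lemma schoenberg_digits: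
  fixes c :: "nat \<Rightarrow> nat" and K :: nat
  assumes c: "\<And>i. c i \<le> 1" and d: "j < d"
  defines "t \<equiv> \<Sum>i<d*K. 2 * real (c i) / 3 ^ Suc i"
  shows "schoenberg d j t = (\<Sum>k<K. real (c (d * k + j)) / 2 ^ Suc k)"
    and "0 \<le> t" "t \<le> 1"
proof -
  have geo: "(\<Sum>i\<in>{m..<n}. 2 * real (c i) / 3 ^ Suc i) \<le> 1 / 3 ^ m" for m n
  proof (cases "m \<le> n")
    case True
    have "(\<Sum>i\<in>{m..<n}. 2 * real (c i) / 3 ^ Suc i) \<le> 1 / 3 ^ m - 1 / 3 ^ n"
      using True
    proof (induction n rule: dec_induct)
      case (step n)
      have "2 * real (c n) / 3 ^ Suc n \<le> 2 / 3 ^ Suc n"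
        using c[of n] by (intro divide_right_mono) auto
      then show ?case using step by (simp add: sum.atLeastLessThan_Suc)
    qed simp
    then show ?thesis by (rule order_trans) simp
  qed simp
  show "0 \<le> t" by (auto simp: t_def intro!: sum_nonneg)
  show "t \<le> 1" using geo[of 0 "d*K"] by (simp add: t_def lessThan_atLeast0)
  have digit: "zigzag (3 ^ m * t) = (if m < d * K then real (c m) else 0)" for m
  proof -
    let ?L = "d * K"
    define low where "low = (\<Sum>i<min m ?L. 2 * c i * 3 ^ (m - Suc i))"
    define hi where "hi = 3 ^ m * (\<Sum>i\<in>{m..<?L}. 2 * real (c i) / 3 ^ Suc i)"
    have split: "{..<?L} = {..<min m ?L} \<union> {m..<?L}" by auto
    have "3 ^ m * t = 3 ^ m * (\<Sum>i<min m ?L. 2 * real (c i) / 3 ^ Suc i) + hi"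
      unfolding t_def hi_def split
      by (subst sum.union_disjoint) (auto simp: distrib_left)
    also have "3 ^ m * (\<Sum>i<min m ?L. 2 * real (c i) / 3 ^ Suc i) = real low"
      unfolding low_def sum_distrib_left of_nat_sum
    proof (rule sum.cong)
      fix i assume "i \<in> {..<min m ?L}"
      then have "m = (m - Suc i) + Suc i" by auto
      then have "(3::real) ^ m = 3 ^ (m - Suc i) * 3 ^ Suc i" by (metis power_add)
      then show "3 ^ m * (2 * real (c i) / 3 ^ Suc i) = real (2 * c i * 3 ^ (m - Suc i))" by simp
    qed simp
    finally have eq: "3 ^ m * t = real low + hi" .
    have even: "even low" unfolding low_def by (intro dvd_sum) simp
    have hi0: "0 \<le> hi" by (auto simp: hi_def intro!: mult_nonneg_nonneg sum_nonneg)
    have hi_le: "hi \<le> 1"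
      using mult_left_mono[OF geo[of m ?L], of "3 ^ m"] by (simp add: hi_def)
    have zz: "zigzag (3 ^ m * t) = min 1 (max 0 (3 * hi - 1))"
      unfolding eq by (rule zigzag_shift[OF even hi0 hi_le])
    show ?thesis
    proof (cases "m < ?L")
      case False
      then show ?thesis using zz by (simp add: hi_def)
    next
      case True
      define r where "r = 3 ^ m * (\<Sum>i\<in>{Suc m..<?L}. 2 * real (c i) / 3 ^ Suc i)"
      have "hi = 2 * real (c m) / 3 + r"
        unfolding hi_def r_def using True by (simp add: sum.atLeast_Suc_lessThan distrib_left)
      moreover have "0 \<le> r" by (auto simp: r_def intro!: mult_nonneg_nonneg sum_nonneg)
      moreover have "r \<le> 1/3"
        using mult_left_mono[OF geo[of "Suc m" ?L], of "3 ^ m"] by (simp add: r_def)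
      moreover have "c m = 0 \<or> c m = 1" using c[of m] by auto
      ultimately show ?thesis using True zz by auto
    qed
  qed
  have lt: "d * k + j < d * K \<longleftrightarrow> k < K" for k
  proof
    assume "d * k + j < d * K"
    then have "d * k < d * K" by linarith
    then show "k < K" using d by simp
  next
    assume "k < K"
    then have "d * Suc k \<le> d * K" by (intro mult_left_mono) auto
    then show "d * k + j < d * K" using d by simp
  qed
  have "(\<lambda>k. zigzag (3 ^ (d * k + j) * t) / 2 ^ Suc k) sums (\<Sum>k<K. zigzag (3 ^ (d * k + j) * t) / 2 ^ Suc k)"
    by (rule sums_finite) (auto simp: digit lt)
  then show "schoenberg d j t = (\<Sum>k<K. real (c (d * k + j)) / 2 ^ Suc k)"
    unfolding schoenberg_def by (simp add: sums_unique[symmetric] digit lt)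
qed

lemma binary_approximation:
  fixes x :: real
  assumes "0 \<le> x" "x \<le> 1"
  shows "\<exists>b :: nat \<Rightarrow> nat. (\<forall>k. b k \<le> 1) \<and> \<bar>x - (\<Sum>k<K. real (b k) / 2 ^ Suc k)\<bar> \<le> 1 / 2 ^ K"
proof -
  have "\<exists>b :: nat \<Rightarrow> nat. (\<forall>k. b k \<le> 1) \<and> 0 \<le> x - (\<Sum>k<K. real (b k) / 2 ^ Suc k) \<and>
      x - (\<Sum>k<K. real (b k) / 2 ^ Suc k) \<le> 1 / 2 ^ K"
  proof (induction K)
    case 0
    show ?case by (rule exI[of _ "\<lambda>_. 0"]) (use assms in auto)
  next
    case (Suc K)
    then obtain b where b: "\<forall>k. b k \<le> (1::nat)" "0 \<le> x - (\<Sum>k<K. real (b k) / 2 ^ Suc k)"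
      "x - (\<Sum>k<K. real (b k) / 2 ^ Suc k) \<le> 1 / 2 ^ K" by auto
    define v where "v = (if x - (\<Sum>k<K. real (b k) / 2 ^ Suc k) \<ge> 1 / 2 ^ Suc K then 1 else 0 :: nat)"
    have "(\<Sum>k<K. real ((b(K := v)) k) / 2 ^ Suc k) = (\<Sum>k<K. real (b k) / 2 ^ Suc k)"
      by (rule sum.cong) auto
    then have s: "(\<Sum>k<Suc K. real ((b(K := v)) k) / 2 ^ Suc k) = (\<Sum>k<K. real (b k) / 2 ^ Suc k) + real v / 2 ^ Suc K"
      by simp
    have half: "1 / 2 ^ K = 1 / 2 ^ Suc K + 1 / (2::real) ^ Suc K" by simp
    define y where "y = x - (\<Sum>k<K. real (b k) / 2 ^ Suc k)"
    define q where "q = 1 / (2::real) ^ Suc K"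
    have y: "0 \<le> y" "y \<le> q + q" using b(2,3) half by (simp_all only: y_def q_def)
    have v: "v = (if y \<ge> q then 1 else 0)" by (simp only: v_def y_def q_def)
    have "x - (\<Sum>k<Suc K. real ((b(K := v)) k) / 2 ^ Suc k) = y - real v * q"
      by (simp only: s) (simp add: y_def q_def)
    moreover have "0 \<le> y - real v * q" "y - real v * q \<le> q"
      using y by (simp_all add: v)
    moreover have "\<forall>k. (b(K := v)) k \<le> 1" using b(1) by (auto simp: v_def)
    ultimately show ?case by (intro exI[of _ "b(K := v)"]) (simp add: q_def)
  qed
  then obtain b :: "nat \<Rightarrow> nat" where "\<forall>k. b k \<le> 1" "0 \<le> x - (\<Sum>k<K. real (b k) / 2 ^ Suc k)"
      "x - (\<Sum>k<K. real (b k) / 2 ^ Suc k) \<le> 1 / 2 ^ K" by blast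
  then show ?thesis by (intro exI[of _ b]) (simp only: abs_of_nonneg simp_thms)
qed

text \<open>
  Prescribing finitely many binary digits in every coordinate reaches a dense set of points of the
  cube; the image of \<open>{0..1}\<close> is compact and hence contains the cube.
\<close>
theorem space_filling_curve:
  obtains Z :: "real \<Rightarrow> 'a::euclidean_space"
  where "continuous_on UNIV Z" "cbox (- One) One \<subseteq> Z ` {0..1}"
proof -
  let ?d = "DIM('a)"
  obtain e where e: "bij_betw e (Basis :: 'a set) {0..<?d}"
    using ex_bij_betw_finite_nat[OF finite_Basis] by blast
  have e_lt: "e b < ?d" if "b \<in> Basis" for b using e that by (auto simp: bij_betw_def)
  define Z :: "real \<Rightarrow> 'a" where "Z t = (\<Sum>b\<in>Basis. (2 * schoenberg ?d (e b) t - 1) *\<^sub>R b)" for t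
  have cont: "continuous_on UNIV Z"
    unfolding Z_def by (intro continuous_intros continuous_on_schoenberg)
  have "closed (Z ` {0..1})"
    by (intro compact_imp_closed compact_continuous_image continuous_on_subset[OF cont]) auto
  moreover have "\<exists>y\<in>Z ` {0..1}. dist y z < \<epsilon>" if z: "z \<in> cbox (- One) One" and \<epsilon>: "\<epsilon> > 0" for z \<epsilon>
  proof -
    have "\<exists>K. 2 * real ?d * (1 / 2) ^ K < \<epsilon>"
    proof -
      obtain K where "(1/2::real) ^ K < \<epsilon> / (2 * real ?d)"
        using real_arch_pow_inv[of "\<epsilon> / (2 * real ?d)" "1/2"] \<epsilon> by auto
      then show ?thesis by (auto simp: field_simps)
    qed
    then obtain K where K: "2 * real ?d * (1 / 2) ^ K < \<epsilon>" by blast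
    have "\<exists>\<beta>. (\<forall>k. \<beta> k \<le> (1::nat)) \<and> \<bar>(z \<bullet> b + 1) / 2 - (\<Sum>k<K. real (\<beta> k) / 2 ^ Suc k)\<bar> \<le> 1 / 2 ^ K"
      if "b \<in> Basis" for b
    proof (rule binary_approximation)
      have "-1 \<le> z \<bullet> b" "z \<bullet> b \<le> 1" using z that by (auto simp: mem_box)
      then show "0 \<le> (z \<bullet> b + 1) / 2" "(z \<bullet> b + 1) / 2 \<le> 1" by auto
    qed
    then obtain \<beta> where \<beta>: "\<And>b k. b \<in> Basis \<Longrightarrow> \<beta> b k \<le> (1::nat)"
      "\<And>b. b \<in> Basis \<Longrightarrow> \<bar>(z \<bullet> b + 1) / 2 - (\<Sum>k<K. real (\<beta> b k) / 2 ^ Suc k)\<bar> \<le> 1 / 2 ^ K"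
      by metis
    define c where "c i = \<beta> (inv_into Basis e (i mod ?d)) (i div ?d)" for i
    have inv: "inv_into Basis e (e b) = b" if "b \<in> Basis" for b
      using e that by (simp add: bij_betw_def inv_into_f_f)
    have c1: "c i \<le> 1" for i
    proof -
      have "i mod ?d \<in> e ` Basis" using e by (simp add: bij_betw_def)
      then have "inv_into Basis e (i mod ?d) \<in> Basis" by (rule inv_into_into)
      then show ?thesis unfolding c_def by (rule \<beta>(1))
    qed
    have c2: "c (?d * k + e b) = \<beta> b k" if "b \<in> Basis" for b k
      using e_lt[OF that] inv[OF that] by (simp add: c_def)
    define t where "t = (\<Sum>i<?d*K. 2 * real (c i) / 3 ^ Suc i)"
    have t01: "t \<in> {0..1}"
      using schoenberg_digits(2,3)[of c 0 ?d K] c1 by (simp add: t_def)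
    have sch: "schoenberg ?d (e b) t = (\<Sum>k<K. real (\<beta> b k) / 2 ^ Suc k)" if "b \<in> Basis" for b
      unfolding t_def by (subst schoenberg_digits(1)) (use c1 c2[OF that] e_lt[OF that] in auto)
    have "dist (Z t) z \<le> (\<Sum>b\<in>Basis. \<bar>(Z t - z) \<bullet> b\<bar>)"
      unfolding dist_norm by (rule norm_le_l1)
    also have "\<dots> \<le> (\<Sum>b\<in>(Basis::'a set). 2 * (1 / 2) ^ K)"
    proof (rule sum_mono)
      fix b :: 'a assume b: "b \<in> Basis"
      have "Z t \<bullet> b = 2 * schoenberg ?d (e b) t - 1" using b by (simp add: Z_def)
      then have "(Z t - z) \<bullet> b = - 2 * ((z \<bullet> b + 1) / 2 - schoenberg ?d (e b) t)"
        by (simp add: inner_diff_left field_simps)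
      then have "\<bar>(Z t - z) \<bullet> b\<bar> = 2 * \<bar>(z \<bullet> b + 1) / 2 - schoenberg ?d (e b) t\<bar>"
        by (simp only: abs_mult)
      also have "\<dots> \<le> 2 * (1 / 2 ^ K)" using \<beta>(2)[OF b] by (simp add: sch[OF b])
      finally show "\<bar>(Z t - z) \<bullet> b\<bar> \<le> 2 * (1 / 2) ^ K" by (simp add: power_divide)
    qed
    also have "\<dots> = 2 * real ?d * (1 / 2) ^ K" by simp
    also have "\<dots> < \<epsilon>" by (rule K)
    finally show ?thesis using t01 by blast
  qed
  ultimately have "cbox (- One) One \<subseteq> Z ` {0..1}"
    using closed_approachable[of "Z ` {0..1}"] by (intro subsetI) blast
  with cont show thesis by (rule that)
qed

section \<open>Weak compactness and lower semicontinuity\<close>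

lemma discrete_real_distribution:
  fixes w :: "'i \<Rightarrow> real" and p :: "'i \<Rightarrow> real"
  assumes I: "finite I" and w: "\<And>i. i \<in> I \<Longrightarrow> 0 \<le> w i" "(\<Sum>i\<in>I. w i) = 1"
  defines "\<Gamma> \<equiv> distr (point_measure I (\<lambda>i. ennreal (w i))) borel p"
  shows "real_distribution \<Gamma>"
    and "\<And>A. A \<in> sets borel \<Longrightarrow> p ` I \<subseteq> A \<Longrightarrow> measure \<Gamma> A = 1"
    and "\<And>F :: real \<Rightarrow> 'x::euclidean_space. F \<in> borel_measurable borel \<Longrightarrow> (\<integral>t. F t \<partial>\<Gamma>) = (\<Sum>i\<in>I. w i *\<^sub>R F (p i))"
proof -
  have p: "p \<in> measurable (point_measure I (\<lambda>i. ennreal (w i))) borel" by simp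
  have one: "emeasure (point_measure I (\<lambda>i. ennreal (w i))) I = 1"
    by (subst emeasure_point_measure_finite[OF I subset_refl]) (simp add: w sum_ennreal)
  interpret pm: prob_space "point_measure I (\<lambda>i. ennreal (w i))"
    by (rule prob_spaceI) (simp add: one space_point_measure)
  interpret G: prob_space \<Gamma> unfolding \<Gamma>_def by (rule pm.prob_space_distr[OF p])
  show "real_distribution \<Gamma>" by unfold_locales (simp add: \<Gamma>_def)
  show "measure \<Gamma> A = 1" if "A \<in> sets borel" "p ` I \<subseteq> A" for A
  proof -
    have "p -` A \<inter> I = I" using that(2) by auto
    then have "emeasure \<Gamma> A = 1"
      unfolding \<Gamma>_def using that(1) by (simp add: emeasure_distr[OF p] space_point_measure one)
    then show ?thesis by (simp add: measure_def)
  qed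
  show "(\<integral>t. F t \<partial>\<Gamma>) = (\<Sum>i\<in>I. w i *\<^sub>R F (p i))" if "F \<in> borel_measurable borel" for F :: "real \<Rightarrow> 'x"
    unfolding \<Gamma>_def by (subst integral_distr[OF p that]) (simp add: lebesgue_integral_point_measure_finite I w)
qed

text \<open>
  This is weak sequential compactness of bounded vector measures, together with lower semicontinuity
  of the total variation. Each measure is replaced by a discrete one, with an atom at the node of every
  cell, and the atom is remembered together with the direction of the mass that it carries. This gives
  a positive measure on pairs (position, unit vector). A space-filling curve lifts it to a probability
  measure on the interval \<open>{0..1}\<close>, where Helly's selection theorem applies. The limit measure \<open>M\<close> on the line is pushed
  back to \<open>Q\<close> with the direction \<open>Y\<close> as density. Since \<open>Y\<close> takes values in the unit ball, the total
  variation is at most the limit of the masses.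
\<close>
theorem represents_limit:
  fixes T :: "('n::finite, 'x::euclidean_space) functional"
  assumes rep: "\<And>n. represents (\<mu> n) (S n)" and tv: "\<And>n. total_variation (\<mu> n) \<le> ennreal (c n)"
    and c: "c \<longlonglongrightarrow> C" "\<And>n. 0 < c n" and lim: "\<And>\<phi>. \<phi> \<in> test_functions \<Longrightarrow> (\<lambda>n. S n \<phi>) \<longlonglongrightarrow> T \<phi>"
  shows "\<exists>\<nu>. represents \<nu> T \<and> total_variation \<nu> \<le> ennreal C"
proof -
  have br: "bounded_Radon (\<mu> n)" and S: "\<phi> \<in> test_functions \<Longrightarrow> S n \<phi> = vector_integral (\<mu> n) \<phi>" for n \<phi>
    using rep[of n] by (auto simp: represents_def)
  obtain Z :: "real \<Rightarrow> (real^'n) \<times> 'x" where Z: "continuous_on UNIV Z" "cbox (- One) One \<subseteq> Z ` {0..1}"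
    using space_filling_curve by blast
  define X where "X t = fst (Z t)" for t
  \<comment> \<open>The curve fills a cube that contains the pairs of a point of Q and a vector of the unit ball;
    truncation puts the direction into the unit ball everywhere.\<close>
  define Y where "Y t = (1 / max 1 (norm (snd (Z t)))) *\<^sub>R snd (Z t)" for t
  have X: "continuous_on UNIV X" unfolding X_def by (intro continuous_intros Z)
  have Y: "continuous_on UNIV Y" unfolding Y_def by (intro continuous_intros Z) (auto simp: max_def)
  have Y1: "norm (Y t) \<le> 1" for t by (simp add: Y_def divide_le_eq)
  have in_box: "(x, y) \<in> cbox (- One) One" if x: "x \<in> insert 0 Q" and y: "norm y \<le> 1" for x :: "real^'n" and y :: 'x
  proof -
    have "\<bar>x \<bullet> u\<bar> \<le> 1" if u_Basis: "u \<in> Basis" for u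
    proof -
      obtain i where u: "u = axis i 1" using u_Basis by (auto simp: Basis_vec_def)
      have "x \<bullet> u = x $ i" by (simp add: u inner_axis)
      moreover have "- 1/2 \<le> x $ i" "x $ i \<le> 1/2" using x by (auto simp: Q_def intro: less_imp_le)
      ultimately show ?thesis by (simp add: abs_le_iff)
    qed
    moreover have "\<bar>y \<bullet> u\<bar> \<le> 1" if "u \<in> Basis" for u
      using Basis_le_norm[OF that, of y] y by linarith
    ultimately have "\<bar>(x, y) \<bullet> b\<bar> \<le> 1" if "b \<in> Basis" for b
      using that by (auto simp: Basis_prod_def)
    then show ?thesis
      by (auto simp: mem_box abs_le_iff)
  qed
  \<comment> \<open>The empty set is not a cell. It serves as the index of an additional atom at the origin with
    direction zero, which carries the missing mass and turns the discrete measure into a probability.\<close>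
  define z where "z n A = (if A = {} then (0, 0) else (node A, sgn (\<mu> n A)))" for n A
  define w where "w n A = (if A = {} then 1 - (\<Sum>B\<in>cells n. norm (\<mu> n B) / c n) else norm (\<mu> n A) / c n)" for n A
  define p where "p n A = (SOME t. t \<in> {0..1} \<and> Z t = z n A)" for n A
  let ?I = "\<lambda>n. insert {} (cells n :: (real^'n) set set)"
  have p: "p n A \<in> {0..1}" "Z (p n A) = z n A" if A: "A \<in> ?I n" for n A
  proof -
    have "z n A \<in> cbox (- One) One"
    proof (cases "A = {}")
      case False
      then have "node A \<in> Q" using A node_in[of A n] cells_simps(6)[of A n] by blast
      moreover have "norm (sgn (\<mu> n A)) \<le> 1" by (cases "\<mu> n A = 0") (simp_all add: norm_sgn)
      ultimately show ?thesis using False by (simp add: z_def in_box)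
    qed (auto simp: z_def intro!: in_box)
    then have "\<exists>t. t \<in> {0..1} \<and> Z t = z n A" using Z(2) by (metis imageE subsetD)
    then show "p n A \<in> {0..1}" "Z (p n A) = z n A" unfolding p_def by (metis (mono_tags, lifting) someI_ex)+
  qed
  have Xp: "X (p n A) = (if A = {} then 0 else node A)" and Yp: "Y (p n A) = (if A = {} then 0 else sgn (\<mu> n A))"
    if "A \<in> ?I n" for n A
    using p(2)[OF that] by (auto simp: X_def Y_def z_def norm_sgn)
  have sum_norm: "(\<Sum>B\<in>cells n. norm (\<mu> n B)) \<le> c n" for n
  proof -
    have "ennreal (\<Sum>B\<in>cells n. norm (\<mu> n B)) \<le> ennreal (c n)"
      by (intro order_trans[OF norm_sum_le_total_variation tv]) (simp_all add: cells_simps)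
    then show ?thesis using less_imp_le[OF c(2)] by simp
  qed
  have w0: "0 \<le> w n A" for n A
    using sum_norm[of n] less_imp_le[OF c(2)[of n]] c(2)[of n] by (auto simp: w_def sum_divide_distrib[symmetric])
  have w1: "(\<Sum>A\<in>?I n. w n A) = 1" for n
  proof -
    have "(\<Sum>A\<in>cells n. w n A) = (\<Sum>B\<in>cells n. norm (\<mu> n B) / c n)"
      by (rule sum.cong) (use cells_simps(3)[of n] in \<open>auto simp: w_def\<close>)
    moreover have "w n {} = 1 - (\<Sum>B\<in>cells n. norm (\<mu> n B) / c n)" by (simp add: w_def)
    ultimately show ?thesis by (subst sum.insert[OF cells_simps(1,3)]) simp
  qed
  define \<Gamma> where "\<Gamma> n = distr (point_measure (?I n) (\<lambda>A. ennreal (w n A))) borel (p n)" for n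
  have fin: "finite (?I n)" for n by (simp add: cells_simps)
  have rd: "real_distribution (\<Gamma> n)" for n
    unfolding \<Gamma>_def by (rule discrete_real_distribution(1)[OF fin w0 w1])
  have "tight \<Gamma>"
    unfolding tight_def
  proof (intro conjI allI impI rd)
    fix \<epsilon> :: real assume "0 < \<epsilon>"
    have "measure (\<Gamma> n) {-1<..1} = 1" for n
      unfolding \<Gamma>_def
    proof (rule discrete_real_distribution(2)[OF fin w0 w1])
      show "p n ` ?I n \<subseteq> {-1<..1}"
      proof
        fix s assume "s \<in> p n ` ?I n"
        then obtain A where A: "A \<in> ?I n" "s = p n A" by blast
        show "s \<in> {-1<..1}" using p(1)[OF A(1)] A(2) by simp
      qed
    qed simp
    then show "\<exists>a b. a < b \<and> (\<forall>n. 1 - \<epsilon> < measure (\<Gamma> n) {a<..b})"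
      using \<open>0 < \<epsilon>\<close> by (intro exI[of _ "-1"] exI[of _ 1]) simp
  qed
  then obtain r M where r: "strict_mono (r :: nat \<Rightarrow> nat)" and M: "real_distribution M"
    and conv: "weak_conv_m (\<Gamma> \<circ> id \<circ> r) M"
    using tight_imp_convergent_subsubsequence[of \<Gamma> id] by (auto simp: strict_mono_id)
  interpret M: real_distribution M by fact
  have borelX: "X \<in> borel_measurable M" and borelY: "Y \<in> borel_measurable M"
    using X Y by (simp_all add: borel_measurable_continuous_onI cong: measurable_cong_sets[OF M.events_eq_borel refl])
  define h where "h t = C *\<^sub>R Y t" for t
  have C0: "0 \<le> C" by (rule LIMSEQ_le_const[OF c(1)]) (auto intro: less_imp_le c(2))
  have nh: "norm (h t) \<le> C" for t
    using mult_left_mono[OF Y1[of t] C0] C0 by (simp add: h_def)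
  have h: "integrable M h"
    by (rule M.integrable_const_bound[of _ C]) (use nh borelY in \<open>auto simp: h_def[abs_def]\<close>)
  have "T \<phi> = (\<integral>t. \<phi> (X t) *\<^sub>R h t \<partial>M)" if \<phi>: "\<phi> \<in> test_functions" for \<phi>
  proof -
    obtain B where B: "B \<ge> 0" "\<And>x. \<bar>\<phi> x\<bar> \<le> B" using test_bounded[OF \<phi>] by metis
    define F where "F t = \<phi> (X t) *\<^sub>R Y t" for t
    have contF: "continuous_on UNIV F"
      unfolding F_def by (intro continuous_intros Y continuous_on_compose2[OF test_continuous_on[OF \<phi>] X]) auto
    have Fb: "norm (F t) \<le> B" for t
      using mult_mono[OF B(2)[of "X t"] Y1[of t]] B(1) by (simp add: F_def)
    have "(\<lambda>n. integral\<^sup>L ((\<Gamma> \<circ> id \<circ> r) n) F) \<longlonglongrightarrow> integral\<^sup>L M F"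
    proof (rule weak_conv_imp_integral_bdd_continuous_conv[OF _ M conv])
      show "real_distribution ((\<Gamma> \<circ> id \<circ> r) n)" for n using rd by simp
      show "isCont F t" for t using contF by (simp add: continuous_on_eq_continuous_at)
      show "norm (F t) \<le> B" for t by (rule Fb)
    qed
    then have "(\<lambda>n. c (r n) *\<^sub>R integral\<^sup>L (\<Gamma> (r n)) F) \<longlonglongrightarrow> C *\<^sub>R integral\<^sup>L M F"
      by (intro tendsto_scaleR LIMSEQ_subseq_LIMSEQ[OF c(1) r, unfolded o_def]) simp
    moreover have "c n *\<^sub>R integral\<^sup>L (\<Gamma> n) F = riemann_sum (\<mu> n) \<phi> n" for n
    proof -
      have "integral\<^sup>L (\<Gamma> n) F = (\<Sum>A\<in>?I n. w n A *\<^sub>R F (p n A))"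
        unfolding \<Gamma>_def
        by (rule discrete_real_distribution(3)[OF fin w0 w1]) (intro borel_measurable_continuous_onI contF)
      also have "\<dots> = (\<Sum>A\<in>cells n. w n A *\<^sub>R F (p n A))"
        by (subst sum.insert[OF cells_simps(1,3)]) (simp add: F_def Yp)
      also have "\<dots> = (\<Sum>A\<in>cells n. (1 / c n) *\<^sub>R (\<phi> (node A) *\<^sub>R \<mu> n A))"
      proof (rule sum.cong)
        fix A :: "(real^'n) set" assume A: "A \<in> cells n"
        then have ne: "A \<noteq> {}" using cells_simps(3)[of n] by blast
        have "(norm (\<mu> n A) / c n) *\<^sub>R (\<phi> (node A) *\<^sub>R sgn (\<mu> n A)) = (1 / c n) *\<^sub>R (\<phi> (node A) *\<^sub>R \<mu> n A)"
          by (cases "\<mu> n A = 0") (simp_all add: sgn_div_norm)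
        then show "w n A *\<^sub>R F (p n A) = (1 / c n) *\<^sub>R (\<phi> (node A) *\<^sub>R \<mu> n A)"
          using A ne by (simp add: F_def Xp Yp w_def)
      qed simp
      also have "\<dots> = (1 / c n) *\<^sub>R riemann_sum (\<mu> n) \<phi> n"
        by (simp add: riemann_sum_def scaleR_sum_right)
      finally show ?thesis using c(2)[of n] by simp
    qed
    ultimately have 1: "(\<lambda>n. riemann_sum (\<mu> (r n)) \<phi> (r n)) \<longlonglongrightarrow> C *\<^sub>R integral\<^sup>L M F" by simp
    obtain \<omega> where \<omega>: "\<omega> \<longlonglongrightarrow> 0" "\<And>n A x. A \<in> cells n \<Longrightarrow> x \<in> A \<Longrightarrow> \<bar>\<phi> x - \<phi> (node A)\<bar> \<le> \<omega> n" "\<And>n. 0 \<le> \<omega> n"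
      using oscillation_tendsto_0[OF \<phi>] by metis
    have est: "norm (S n \<phi> - riemann_sum (\<mu> n) \<phi> n) \<le> 2 * DIM('x) * \<omega> n * c n" for n
    proof -
      have "norm (S n \<phi> - riemann_sum (\<mu> n) \<phi> n) \<le> 2 * DIM('x) * \<omega> n * enn2real (total_variation (\<mu> n))"
        unfolding S[OF \<phi>] by (rule vector_integral_riemann_estimate[OF br \<phi> \<omega>(2,3)])
      also have "\<dots> \<le> 2 * DIM('x) * \<omega> n * c n"
        using enn2real_leI[OF less_imp_le[OF c(2)] tv[of n]] \<omega>(3)[of n] by (intro mult_left_mono) auto
      finally show ?thesis .
    qed
    have "(\<lambda>n. 2 * DIM('x) * \<omega> n * c n) \<longlonglongrightarrow> 2 * DIM('x) * (0::real) * C"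
      by (intro tendsto_intros \<omega> c)
    then have z: "(\<lambda>n. 2 * DIM('x) * \<omega> n * c n) \<longlonglongrightarrow> 0" by simp
    have "(\<lambda>n. S n \<phi> - riemann_sum (\<mu> n) \<phi> n) \<longlonglongrightarrow> 0"
      by (intro Lim_null_comparison[OF always_eventually z] allI est)
    from tendsto_diff[OF lim[OF \<phi>] this] have "(\<lambda>n. riemann_sum (\<mu> n) \<phi> n) \<longlonglongrightarrow> T \<phi>" by simp
    from LIMSEQ_subseq_LIMSEQ[OF this r] have "(\<lambda>n. riemann_sum (\<mu> (r n)) \<phi> (r n)) \<longlonglongrightarrow> T \<phi>"
      by (simp add: o_def)
    then have "T \<phi> = C *\<^sub>R integral\<^sup>L M F" by (rule LIMSEQ_unique[OF _ 1])
    also have "\<dots> = (\<integral>t. C *\<^sub>R F t \<partial>M)" by simp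
    also have "\<dots> = (\<integral>t. \<phi> (X t) *\<^sub>R h t \<partial>M)" by (simp add: F_def h_def mult.commute)
    finally show ?thesis .
  qed
  moreover note d = density_Radon[OF borelX h]
  ultimately have "represents (\<lambda>A. \<integral>t. indicator A (X t) *\<^sub>R h t \<partial>M) T"
    by (simp add: represents_def)
  moreover have "(\<integral>t. norm (h t) \<partial>M) \<le> (\<integral>t. C \<partial>M)"
    by (rule integral_mono) (use h nh in auto)
  then have "(\<integral>t. norm (h t) \<partial>M) \<le> C" using M.prob_space by simp
  then have "total_variation (\<lambda>A. \<integral>t. indicator A (X t) *\<^sub>R h t \<partial>M) \<le> ennreal C"
    by (intro order_trans[OF d(2)] ennreal_leI)
  ultimately show ?thesis by blast
qed

corollary Mb_norm_lower_semicontinuous: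
  fixes T :: "('n::finite, 'x::euclidean_space) functional"
  assumes lim: "\<And>\<phi>. \<phi> \<in> test_functions \<Longrightarrow> (\<lambda>n. S n \<phi>) \<longlonglongrightarrow> T \<phi>"
  shows "Mb_norm T \<le> liminf (\<lambda>n. Mb_norm (S n))"
proof (cases "liminf (\<lambda>n. Mb_norm (S n)) = top")
  case False
  obtain r where r: "strict_mono (r :: nat \<Rightarrow> nat)" "((\<lambda>n. Mb_norm (S n)) \<circ> r) \<longlonglongrightarrow> liminf (\<lambda>n. Mb_norm (S n))"
    using liminf_subseq_lim by blast
  obtain C where C: "0 \<le> C" "liminf (\<lambda>n. Mb_norm (S n)) = ennreal C"
    using False by (cases "liminf (\<lambda>n. Mb_norm (S n))") auto
  have "\<exists>N. \<forall>n\<ge>N. Mb_norm (S (r n)) < ennreal (C + 1)"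
    using order_tendstoD(2)[OF r(2), of "ennreal (C + 1)"] C
    by (auto simp: eventually_sequentially ennreal_less_iff)
  then obtain N where N: "\<And>n. n \<ge> N \<Longrightarrow> Mb_norm (S (r n)) < ennreal (C + 1)" by blast
  define s where "s n = r (n + N)" for n
  have fin: "Mb_norm (S (s n)) < top" for n
    using N[of "n + N"] by (auto simp: s_def intro: less_trans)
  have s: "(\<lambda>n. Mb_norm (S (s n))) \<longlonglongrightarrow> ennreal C"
    using LIMSEQ_ignore_initial_segment[OF r(2), of N] C(2) by (simp add: s_def o_def)
  have sm: "strict_mono s" using r(1) by (auto simp: s_def strict_mono_def)
  define c where "c n = enn2real (Mb_norm (S (s n))) + 1 / real (Suc n)" for n
  have "(\<lambda>n. enn2real (Mb_norm (S (s n)))) \<longlonglongrightarrow> enn2real (ennreal C)"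
    using tendsto_enn2real[OF s C(1)] C by simp
  then have c: "c \<longlonglongrightarrow> C"
    using tendsto_add[OF _ LIMSEQ_inverse_real_of_nat, of "\<lambda>n. enn2real (Mb_norm (S (s n)))" C] C
    by (simp add: c_def[abs_def] inverse_eq_divide)
  have cp: "0 < c n" for n by (simp add: c_def add_nonneg_pos)
  have "Mb_norm (S (s n)) < ennreal (c n)" for n
    using fin[of n] unfolding c_def by (cases "Mb_norm (S (s n))") (auto simp: ennreal_less_iff)
  then have "\<exists>\<mu>. represents \<mu> (S (s n)) \<and> total_variation \<mu> < ennreal (c n)" for n
    by (meson Mb_norm_less)
  then obtain \<mu> where \<mu>: "\<And>n. represents (\<mu> n) (S (s n))" "\<And>n. total_variation (\<mu> n) < ennreal (c n)"
    by metis
  have "(\<lambda>n. S (s n) \<phi>) \<longlonglongrightarrow> T \<phi>" if "\<phi> \<in> test_functions" for \<phi>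
    using LIMSEQ_subseq_LIMSEQ[OF lim[OF that] sm] by (simp add: o_def)
  then obtain \<nu> where "represents \<nu> T" "total_variation \<nu> \<le> ennreal C"
    using represents_limit[OF \<mu>(1) less_imp_le[OF \<mu>(2)] c cp] by blast
  then show ?thesis using Mb_norm_le[of \<nu> T] C(2) by (auto intro: order_trans)
qed simp

section \<open>The space of square integrable functions\<close>

lemma ennreal_lincomb:
  assumes "0 \<le> a" "0 \<le> b" "0 \<le> x" "0 \<le> y"
  shows "ennreal a * ennreal x + ennreal b * ennreal y = ennreal (a * x + b * y)"
  using assms by (simp add: ennreal_mult)

lemma L2_norm_sq_parallelogram:
  fixes u w :: "real^'n \<Rightarrow> real"
  assumes [measurable]: "u \<in> borel_measurable leb_Q" "w \<in> borel_measurable leb_Q"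
  shows "L2_norm_sq (\<lambda>x. (u x + w x) / 2) + ennreal (1/4) * L2_norm_sq (\<lambda>x. u x - w x)
    = ennreal (1/2) * L2_norm_sq u + ennreal (1/2) * L2_norm_sq w"
proof -
  have "L2_norm_sq (\<lambda>x. (u x + w x) / 2) + ennreal (1/4) * L2_norm_sq (\<lambda>x. u x - w x)
      = (\<integral>\<^sup>+x. ennreal (((u x + w x) / 2)\<^sup>2) + ennreal (1/4) * ennreal ((u x - w x)\<^sup>2) \<partial>leb_Q)"
    unfolding L2_norm_sq_def by (subst nn_integral_add) (simp_all add: nn_integral_cmult)
  also have "\<dots> = (\<integral>\<^sup>+x. ennreal (1/2) * ennreal ((u x)\<^sup>2) + ennreal (1/2) * ennreal ((w x)\<^sup>2) \<partial>leb_Q)"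
  proof (rule nn_integral_cong)
    fix x
    have "((u x + w x) / 2)\<^sup>2 + 1/4 * (u x - w x)\<^sup>2 = 1/2 * (u x)\<^sup>2 + 1/2 * (w x)\<^sup>2"
      by (simp add: power2_eq_square field_simps)
    moreover have "ennreal (1/2) * ennreal ((u x)\<^sup>2) + ennreal (1/2) * ennreal ((w x)\<^sup>2) = ennreal (1/2 * (u x)\<^sup>2 + 1/2 * (w x)\<^sup>2)"
      by (rule ennreal_lincomb) simp_all
    moreover have "ennreal 1 * ennreal (((u x + w x) / 2)\<^sup>2) + ennreal (1/4) * ennreal ((u x - w x)\<^sup>2)
        = ennreal (1 * ((u x + w x) / 2)\<^sup>2 + 1/4 * (u x - w x)\<^sup>2)"
      by (rule ennreal_lincomb) simp_all
    ultimately show "ennreal (((u x + w x) / 2)\<^sup>2) + ennreal (1/4) * ennreal ((u x - w x)\<^sup>2)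
        = ennreal (1/2) * ennreal ((u x)\<^sup>2) + ennreal (1/2) * ennreal ((w x)\<^sup>2)"
      by (simp only: ennreal_1 mult_1)
  qed
  also have "\<dots> = ennreal (1/2) * L2_norm_sq u + ennreal (1/2) * L2_norm_sq w"
    unfolding L2_norm_sq_def by (subst nn_integral_add) (simp_all add: nn_integral_cmult)
  finally show ?thesis .
qed

lemma L2_norm_sq_minus_commute: "L2_norm_sq (\<lambda>x. u x - w x) = L2_norm_sq (\<lambda>x. w x - u x)"
  unfolding L2_norm_sq_def by (simp add: power2_commute)

lemma L2_norm_sq_le_sum:
  fixes u w :: "real^'n \<Rightarrow> real"
  assumes [measurable]: "u \<in> borel_measurable leb_Q" "w \<in> borel_measurable leb_Q"
  shows "L2_norm_sq u \<le> ennreal 2 * L2_norm_sq (\<lambda>x. u x - w x) + ennreal 2 * L2_norm_sq w"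
proof -
  have "L2_norm_sq u \<le> (\<integral>\<^sup>+x. ennreal 2 * ennreal ((u x - w x)\<^sup>2) + ennreal 2 * ennreal ((w x)\<^sup>2) \<partial>leb_Q)"
    unfolding L2_norm_sq_def
  proof (rule nn_integral_mono)
    fix x
    have "2 * (u x - w x)\<^sup>2 + 2 * (w x)\<^sup>2 - (u x)\<^sup>2 = (u x - 2 * w x)\<^sup>2"
      by (simp add: power2_eq_square algebra_simps)
    then have "(u x)\<^sup>2 \<le> 2 * (u x - w x)\<^sup>2 + 2 * (w x)\<^sup>2"
      using zero_le_power2[of "u x - 2 * w x"] by linarith
    then have "ennreal ((u x)\<^sup>2) \<le> ennreal (2 * (u x - w x)\<^sup>2 + 2 * (w x)\<^sup>2)" by (rule ennreal_leI)
    also have "ennreal (2 * (u x - w x)\<^sup>2 + 2 * (w x)\<^sup>2) = ennreal 2 * ennreal ((u x - w x)\<^sup>2) + ennreal 2 * ennreal ((w x)\<^sup>2)"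
      by (rule ennreal_lincomb[symmetric]) simp_all
    finally show "ennreal ((u x)\<^sup>2) \<le> ennreal 2 * ennreal ((u x - w x)\<^sup>2) + ennreal 2 * ennreal ((w x)\<^sup>2)" .
  qed
  also have "\<dots> = ennreal 2 * L2_norm_sq (\<lambda>x. u x - w x) + ennreal 2 * L2_norm_sq w"
    unfolding L2_norm_sq_def by (subst nn_integral_add) (simp_all add: nn_integral_cmult)
  finally show ?thesis .
qed

text \<open>
  The dimension is passed as a type argument, because nothing else determines it.
\<close>
definition vol_Q :: "'n::finite itself \<Rightarrow> real" where
  "vol_Q _ = measure (leb_Q :: (real^'n) measure) Q"

lemma emeasure_leb_Q: "emeasure (leb_Q :: (real^'n) measure) Q = ennreal (vol_Q TYPE('n))"
proof -
  interpret finite_measure "leb_Q :: (real^'n) measure" by (rule finite_measure_leb_Q)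
  show ?thesis by (simp add: emeasure_eq_measure vol_Q_def)
qed

text \<open>
  The pointwise inequality \<open>\<bar>s\<bar> \<le> a * s\<^sup>2 + 1 / a\<close> replaces the Cauchy-Schwarz inequality. A large \<open>a\<close> shows that
  convergence in \<open>L\<^sup>2\<close> implies convergence in \<open>L\<^sup>1\<close>.
\<close>
lemma L1_norm_le_L2_norm_sq:
  fixes u :: "real^'n \<Rightarrow> real"
  assumes [measurable]: "u \<in> borel_measurable leb_Q" and a: "a > 0"
  shows "L1_norm u \<le> ennreal a * L2_norm_sq u + ennreal (vol_Q TYPE('n) / a)"
proof -
  have "L1_norm u \<le> (\<integral>\<^sup>+x. ennreal a * ennreal ((u x)\<^sup>2) + ennreal (1/a) \<partial>leb_Q)"
    unfolding L1_norm_def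
  proof (rule nn_integral_mono)
    fix x
    have "(a * \<bar>u x\<bar> - 1/2)\<^sup>2 = a\<^sup>2 * (u x)\<^sup>2 + 1/4 - a * \<bar>u x\<bar>"
      by (simp add: power2_diff power_mult_distrib power_divide)
    then have "a * \<bar>u x\<bar> \<le> a\<^sup>2 * (u x)\<^sup>2 + 1/4" using zero_le_power2[of "a * \<bar>u x\<bar> - 1/2"] by linarith
    also have "\<dots> \<le> a * (a * (u x)\<^sup>2 + 1/a)" using a by (simp add: power2_eq_square field_simps)
    finally have "\<bar>u x\<bar> \<le> a * (u x)\<^sup>2 + 1/a" using a by simp
    then have "ennreal \<bar>u x\<bar> \<le> ennreal (a * (u x)\<^sup>2 + 1/a)" by (rule ennreal_leI)
    also have "ennreal (a * (u x)\<^sup>2 + 1/a) = ennreal a * ennreal ((u x)\<^sup>2) + ennreal (1/a)"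
      using a by (simp add: ennreal_mult)
    finally show "ennreal (norm (u x)) \<le> ennreal a * ennreal ((u x)\<^sup>2) + ennreal (1/a)" by simp
  qed
  also have "\<dots> = ennreal a * L2_norm_sq u + ennreal (1/a) * ennreal (vol_Q TYPE('n))"
    unfolding L2_norm_sq_def emeasure_leb_Q[symmetric] by (subst nn_integral_add) (simp_all add: nn_integral_cmult space_leb_Q)
  also have "ennreal (1/a) * ennreal (vol_Q TYPE('n)) = ennreal (vol_Q TYPE('n) / a)"
    using a by (subst ennreal_mult[symmetric]) (auto simp: vol_Q_def)
  finally show ?thesis .
qed

lemma L1_I: "v \<in> borel_measurable leb_Q \<Longrightarrow> L1_norm v < top \<Longrightarrow> v \<in> L1"
  unfolding L1_def L1_norm_def by (simp add: integrable_iff_bounded)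

lemma L1_norm_tendsto_0:
  fixes d :: "nat \<Rightarrow> real^'n \<Rightarrow> real"
  assumes [measurable]: "\<And>n. d n \<in> borel_measurable leb_Q" and lim: "(\<lambda>n. L2_norm_sq (d n)) \<longlonglongrightarrow> 0"
  shows "(\<lambda>n. L1_norm (d n)) \<longlonglongrightarrow> 0"
proof (rule order_tendstoI)
  fix e :: ennreal assume "0 < e"
  then obtain e' where e': "0 < e'" "ennreal e' \<le> e"
    by (cases e) (auto intro: that[of 1])
  have v0: "vol_Q TYPE('n) \<ge> 0" by (simp add: vol_Q_def)
  define a where "a = 2 * (vol_Q TYPE('n) + 1) / e'"
  have a: "a > 0" "vol_Q TYPE('n) / a < e' / 2"
    using e' v0 by (auto simp: a_def field_simps add_pos_nonneg)
  have "\<forall>\<^sub>F n in sequentially. L2_norm_sq (d n) < ennreal (e' / (2 * a))"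
    using order_tendstoD(2)[OF lim] a e' by simp
  then show "\<forall>\<^sub>F n in sequentially. L1_norm (d n) < e"
  proof eventually_elim
    case (elim n)
    have "L1_norm (d n) \<le> ennreal a * L2_norm_sq (d n) + ennreal (vol_Q TYPE('n) / a)"
      by (rule L1_norm_le_L2_norm_sq) (use a in auto)
    also have "\<dots> \<le> ennreal a * ennreal (e' / (2 * a)) + ennreal (vol_Q TYPE('n) / a)"
      using elim by (intro add_mono mult_left_mono) auto
    also have "\<dots> = ennreal (e' / 2 + vol_Q TYPE('n) / a)"
      using a e' v0 by (simp add: ennreal_mult[symmetric])
    also have "\<dots> < ennreal e'" using a(2) e'(1) by (intro ennreal_lessI) linarith+
    finally show ?case using e' by simp
  qed
qed simp

text \<open>
  A subsequence with rapidly decreasing increments converges almost everywhere, since the series of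
  the increments has a finite integral; Fatou's lemma identifies its limit as the limit in \<open>L\<^sup>2\<close>.
\<close>
lemma L2_complete:
  fixes u :: "nat \<Rightarrow> real^'n \<Rightarrow> real"
  assumes [measurable]: "\<And>n. u n \<in> borel_measurable leb_Q"
    and cauchy: "\<And>e. e > 0 \<Longrightarrow> \<exists>N. \<forall>n\<ge>N. \<forall>m\<ge>n. L2_norm_sq (\<lambda>x. u n x - u m x) < ennreal e"
  obtains r w where "strict_mono (r :: nat \<Rightarrow> nat)" "w \<in> borel_measurable leb_Q"
    "AE x in leb_Q. (\<lambda>n. u (r n) x) \<longlonglongrightarrow> w x" "(\<lambda>n. L2_norm_sq (\<lambda>x. u n x - w x)) \<longlonglongrightarrow> 0"
proof -
  \<comment> \<open>The rate (1/4)^k for squared norms, used with weight a = 2^k in the bound of the L1 norm,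
    makes the L1 norms of the increments decrease like (1/2)^k.\<close>
  have "\<forall>k. \<exists>N. \<forall>n\<ge>N. \<forall>m\<ge>n. L2_norm_sq (\<lambda>x. u n x - u m x) < ennreal ((1/4) ^ k)"
    using cauchy by simp
  then obtain N where N: "\<And>k n m. n \<ge> N k \<Longrightarrow> m \<ge> n \<Longrightarrow> L2_norm_sq (\<lambda>x. u n x - u m x) < ennreal ((1/4) ^ k)"
    by metis
  define r where "r k = (\<Sum>i\<le>k. N i) + k" for k
  have r: "strict_mono r" by (rule strict_monoI_Suc) (simp add: r_def)
  have rN: "r k \<ge> N k" for k
    unfolding r_def by (rule trans_le_add1) (rule member_le_sum, auto)
  define d where "d k x = \<bar>u (r k) x - u (r (Suc k)) x\<bar>" for k x
  have dm [measurable]: "d k \<in> borel_measurable leb_Q" for k unfolding d_def by measurable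
  have dk: "(\<integral>\<^sup>+x. ennreal (d k x) \<partial>leb_Q) \<le> ennreal ((1 + vol_Q TYPE('n)) * (1/2) ^ k)" for k
  proof -
    have "(\<integral>\<^sup>+x. ennreal (d k x) \<partial>leb_Q) = L1_norm (\<lambda>x. u (r k) x - u (r (Suc k)) x)"
      by (simp add: L1_norm_def d_def)
    also have "\<dots> \<le> ennreal (2 ^ k) * L2_norm_sq (\<lambda>x. u (r k) x - u (r (Suc k)) x) + ennreal (vol_Q TYPE('n) / 2 ^ k)"
      by (rule L1_norm_le_L2_norm_sq) auto
    also have "\<dots> \<le> ennreal (2 ^ k) * ennreal ((1/4) ^ k) + ennreal (vol_Q TYPE('n) / 2 ^ k)"
      using N[OF rN[of k], of "r (Suc k)"] r
      by (intro add_mono mult_left_mono) (auto simp: strict_mono_less_eq less_imp_le)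
    also have "\<dots> = ennreal (2 ^ k * (1/4) ^ k + vol_Q TYPE('n) / 2 ^ k)"
      by (subst ennreal_plus) (auto simp: vol_Q_def ennreal_mult)
    also have "2 ^ k * (1/4) ^ k + vol_Q TYPE('n) / 2 ^ k = (1 + vol_Q TYPE('n)) * (1/2) ^ k"
      by (simp add: power_mult_distrib[symmetric] power_divide field_simps)
    finally show ?thesis .
  qed
  have sm: "summable (\<lambda>k. (1 + vol_Q TYPE('n)) * (1/2) ^ k)"
    by (intro summable_mult summable_geometric) simp
  have "(\<integral>\<^sup>+x. (\<Sum>k. ennreal (d k x)) \<partial>leb_Q) = (\<Sum>k. \<integral>\<^sup>+x. ennreal (d k x) \<partial>leb_Q)"
    by (rule nn_integral_suminf) simp
  also have "\<dots> \<le> (\<Sum>k. ennreal ((1 + vol_Q TYPE('n)) * (1/2) ^ k))"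
    by (intro suminf_le dk summableI)
  finally have "(\<integral>\<^sup>+x. (\<Sum>k. ennreal (d k x)) \<partial>leb_Q) \<le> (\<Sum>k. ennreal ((1 + vol_Q TYPE('n)) * (1/2) ^ k))" .
  moreover have "(\<Sum>k. ennreal ((1 + vol_Q TYPE('n)) * (1/2) ^ k)) \<noteq> top"
    by (rule ennreal_suminf_neq_top[OF sm]) (simp add: vol_Q_def)
  ultimately have "(\<integral>\<^sup>+x. (\<Sum>k. ennreal (d k x)) \<partial>leb_Q) \<noteq> \<infinity>" by (auto simp: top_unique)
  then have "AE x in leb_Q. (\<Sum>k. ennreal (d k x)) \<noteq> \<infinity>"
    by (intro nn_integral_PInf_AE) measurable
  then have conv: "AE x in leb_Q. convergent (\<lambda>k. u (r k) x)"
  proof eventually_elim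
    case (elim x)
    have "summable (\<lambda>k. d k x)"
      using elim by (intro summable_suminf_not_top) (auto simp: d_def)
    then have "summable (\<lambda>k. u (r (Suc k)) x - u (r k) x)"
      by (intro summable_norm_cancel[of "\<lambda>k. u (r (Suc k)) x - u (r k) x"]) (simp add: d_def abs_minus_commute)
    then have "convergent (\<lambda>n. (\<Sum>k<n. u (r (Suc k)) x - u (r k) x) + u (r 0) x)"
      by (intro convergent_add convergent_const) (simp add: summable_iff_convergent)
    then show ?case by (simp add: sum_lessThan_telescope[of "\<lambda>k. u (r k) x"])
  qed
  define w where "w x = lim (\<lambda>k. u (r k) x)" for x
  have wm [measurable]: "w \<in> borel_measurable leb_Q" unfolding w_def by measurable
  have ae: "AE x in leb_Q. (\<lambda>k. u (r k) x) \<longlonglongrightarrow> w x"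
    using conv by eventually_elim (simp add: w_def convergent_LIMSEQ_iff)
  have "(\<lambda>n. L2_norm_sq (\<lambda>x. u n x - w x)) \<longlonglongrightarrow> 0"
  proof (rule order_tendstoI)
    fix e :: ennreal assume "0 < e"
    then obtain e'' where "0 < e''" "e'' < e" using dense by blast
    then obtain e' where e': "0 < e'" "ennreal e' < e"
      by (cases e'') (auto simp: ennreal_less_iff)
    obtain K where K: "\<And>n m. n \<ge> K \<Longrightarrow> m \<ge> n \<Longrightarrow> L2_norm_sq (\<lambda>x. u n x - u m x) < ennreal e'"
      using cauchy[OF e'(1)] by blast
    have "L2_norm_sq (\<lambda>x. u n x - w x) < e" if n: "n \<ge> K" for n
    proof -
      have "L2_norm_sq (\<lambda>x. u n x - w x) = (\<integral>\<^sup>+x. liminf (\<lambda>k. ennreal ((u n x - u (r k) x)\<^sup>2)) \<partial>leb_Q)"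
        unfolding L2_norm_sq_def
      proof (rule nn_integral_cong_AE, use ae in eventually_elim)
        case (elim x)
        have "(\<lambda>k. ennreal ((u n x - u (r k) x)\<^sup>2)) \<longlonglongrightarrow> ennreal ((u n x - w x)\<^sup>2)"
          by (intro tendsto_intros elim)
        then show ?case by (intro lim_imp_Liminf[symmetric]) simp_all
      qed
      also have "\<dots> \<le> liminf (\<lambda>k. L2_norm_sq (\<lambda>x. u n x - u (r k) x))"
        unfolding L2_norm_sq_def by (rule nn_integral_liminf) measurable
      also have "\<dots> \<le> ennreal e'"
      proof (rule Liminf_le)
        show "\<forall>\<^sub>F k in sequentially. L2_norm_sq (\<lambda>x. u n x - u (r k) x) \<le> ennreal e'"
          using eventually_ge_at_top[of n]
        proof eventually_elim
          case (elim k)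
          then have "r k \<ge> n" using strict_mono_imp_increasing[OF r] order_trans by blast
          then show ?case using K[OF n] by (simp add: less_imp_le)
        qed
      qed simp
      finally show ?thesis using e' by simp
    qed
    then show "\<forall>\<^sub>F n in sequentially. L2_norm_sq (\<lambda>x. u n x - w x) < e"
      by (auto simp: eventually_sequentially)
  qed simp
  then show thesis by (rule that[OF r wm ae])
qed

lemma L2_norm_sq_Fatou:
  fixes u :: "nat \<Rightarrow> real^'n \<Rightarrow> real"
  assumes [measurable]: "\<And>n. u n \<in> borel_measurable leb_Q" "g \<in> borel_measurable leb_Q"
    and ae: "AE x in leb_Q. (\<lambda>n. u n x) \<longlonglongrightarrow> w x"
  shows "L2_norm_sq (\<lambda>x. w x - g x) \<le> liminf (\<lambda>n. L2_norm_sq (\<lambda>x. u n x - g x))"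
proof -
  have "L2_norm_sq (\<lambda>x. w x - g x) = (\<integral>\<^sup>+x. liminf (\<lambda>k. ennreal ((u k x - g x)\<^sup>2)) \<partial>leb_Q)"
    unfolding L2_norm_sq_def
  proof (rule nn_integral_cong_AE, use ae in eventually_elim)
    case (elim x)
    have "(\<lambda>k. ennreal ((u k x - g x)\<^sup>2)) \<longlonglongrightarrow> ennreal ((w x - g x)\<^sup>2)"
      by (intro tendsto_intros elim)
    then show ?case by (intro lim_imp_Liminf[symmetric]) simp_all
  qed
  also have "\<dots> \<le> liminf (\<lambda>k. L2_norm_sq (\<lambda>x. u k x - g x))"
    unfolding L2_norm_sq_def by (rule nn_integral_liminf) measurable
  finally show ?thesis .
qed

section \<open>Midpoint hulls\<close>

text \<open>
  The hull of \<open>A\<close> under an abstract midpoint operation stands for the convex hull. Elements will be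
  tuples of functions and functionals, and every convex bound that holds on \<open>A\<close> holds on the hull.
\<close>
inductive_set midhull :: "('a \<Rightarrow> 'a \<Rightarrow> 'a) \<Rightarrow> 'a set \<Rightarrow> 'a set" for mid A where
  base: "x \<in> A \<Longrightarrow> x \<in> midhull mid A"
| mid: "x \<in> midhull mid A \<Longrightarrow> y \<in> midhull mid A \<Longrightarrow> mid x y \<in> midhull mid A"

lemma midhull_mono:
  assumes "x \<in> midhull mid A" "A \<subseteq> B" shows "x \<in> midhull mid B"
  using assms by (induction rule: midhull.induct) (auto intro: midhull.intros)

text \<open>
  A Hilbert space version of Mazur's lemma. The infimum \<open>d n\<close> of the squared norm over the hull of the
  \<open>n\<close>-th tail increases with \<open>n\<close> and is bounded. Since midpoints stay in the hull, the parallelogram law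
  shows that almost minimal elements of these hulls form a Cauchy sequence.
\<close>
lemma mazur_midpoint:
  fixes X :: "nat \<Rightarrow> 'a" and q :: "'a \<Rightarrow> real" and D :: "'a \<Rightarrow> 'a \<Rightarrow> real"
  assumes q: "\<And>x. x \<in> midhull mid (range X) \<Longrightarrow> 0 \<le> q x \<and> q x \<le> K"
    and para: "\<And>x y. x \<in> midhull mid (range X) \<Longrightarrow> y \<in> midhull mid (range X) \<Longrightarrow>
        q (mid x y) + D x y / 4 \<le> (q x + q y) / 2"
  obtains w where "\<And>n. w n \<in> midhull mid (X ` {n..})"
    "\<And>e. e > 0 \<Longrightarrow> \<exists>N. \<forall>n\<ge>N. \<forall>m\<ge>n. D (w n) (w m) < e"
proof -
  let ?H = "\<lambda>n. midhull mid (X ` {n..})"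
  have sub: "?H n \<subseteq> midhull mid (range X)" for n by (intro subsetI, elim midhull_mono) auto
  have anti: "?H m \<subseteq> ?H n" if "n \<le> m" for n m
    using that by (intro subsetI, elim midhull_mono) auto
  have ne: "X n \<in> ?H n" for n by (auto intro: midhull.base)
  define d where "d n = Inf (q ` ?H n)" for n
  have bdd: "bdd_below (q ` ?H n)" for n using q sub by (intro bdd_belowI[of _ 0]) blast
  have d_le: "d n \<le> q x" if "x \<in> ?H n" for n x
    unfolding d_def by (rule cInf_lower[OF _ bdd]) (use that in auto)
  have mono: "d n \<le> d m" if "n \<le> m" for n m
    unfolding d_def by (rule cInf_superset_mono[OF _ bdd]) (use anti[OF that] ne in auto)
  have up: "d n \<le> K" for n using d_le[OF ne] q sub ne by (meson order_trans subsetD)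
  have "0 \<le> d n" for n
    unfolding d_def by (rule cInf_greatest) (use ne q sub in blast)+
  then have "Bseq d" by (intro BseqI'[of d K]) (simp add: up)
  then have "convergent d" using mono by (intro Bseq_mono_convergent) auto
  then have cd: "Cauchy d" by (rule convergent_Cauchy)
  have "\<exists>x. x \<in> ?H n \<and> q x < d n + 1 / real (Suc n)" for n
  proof -
    have "Inf (q ` ?H n) < d n + 1 / real (Suc n)" by (simp add: d_def)
    then show ?thesis using cInf_lessD[of "q ` ?H n"] ne by blast
  qed
  then obtain w where w: "\<And>n. w n \<in> ?H n" "\<And>n. q (w n) < d n + 1 / real (Suc n)" by metis
  show thesis
  proof (rule that[OF w(1)])
    fix e :: real assume e: "e > 0"
    obtain N1 where N1: "\<And>m n. m \<ge> N1 \<Longrightarrow> n \<ge> N1 \<Longrightarrow> \<bar>d m - d n\<bar> < e / 8"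
      using cd e unfolding Cauchy_def by (metis dist_real_def divide_pos_pos zero_less_numeral)
    obtain N2 where N2: "1 / real (Suc N2) < e / 16" using e nat_approx_posE[of "e/16"] by auto
    show "\<exists>N. \<forall>n\<ge>N. \<forall>m\<ge>n. D (w n) (w m) < e"
    proof (intro exI[of _ "max N1 N2"] allI impI)
      fix n m assume n: "n \<ge> max N1 N2" and m: "m \<ge> n"
      have mid: "mid (w n) (w m) \<in> ?H n" using w(1) anti[OF m] by (intro midhull.mid) auto
      have "q (mid (w n) (w m)) + D (w n) (w m) / 4 \<le> (q (w n) + q (w m)) / 2"
        using w(1) sub by (intro para) blast+
      moreover have "d n \<le> q (mid (w n) (w m))" by (rule d_le[OF mid])
      moreover have "1 / real (Suc n) \<le> 1 / real (Suc N2)" "1 / real (Suc m) \<le> 1 / real (Suc N2)"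
        using n m by (auto simp: field_simps)
      moreover have "\<bar>d m - d n\<bar> < e / 8" using n m by (intro N1) simp_all
      then have "d m - d n < e / 8" by linarith
      ultimately show "D (w n) (w m) < e"
        using w(2)[of n] w(2)[of m] N2 e by argo
    qed
  qed
qed

section \<open>Limits inferior of extended nonnegative reals\<close>

lemma liminf_add_ennreal:
  fixes f g :: "nat \<Rightarrow> ennreal"
  shows "liminf f + liminf g \<le> liminf (\<lambda>n. f n + g n)"
proof -
  have inc: "incseq (\<lambda>n. INF m\<in>{n..}. h m)" for h :: "nat \<Rightarrow> ennreal"
    by (intro incseq_SucI INF_superset_mono) auto
  have "liminf f + liminf g = (SUP n. (INF m\<in>{n..}. f m) + (INF m\<in>{n..}. g m))"
    unfolding liminf_SUP_INF by (rule ennreal_SUP_add[OF inc inc, symmetric])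
  also have "\<dots> \<le> (SUP n. INF m\<in>{n..}. f m + g m)"
    by (intro SUP_mono' INF_greatest add_mono INF_lower)
  finally show ?thesis unfolding liminf_SUP_INF .
qed

lemma liminf_cmult_ennreal:
  fixes f :: "nat \<Rightarrow> ennreal"
  shows "c * liminf f \<le> liminf (\<lambda>n. c * f n)"
proof -
  have "c * liminf f = (SUP n. c * (INF m\<in>{n..}. f m))"
    unfolding liminf_SUP_INF by (rule SUP_mult_left_ennreal)
  also have "\<dots> \<le> (SUP n. INF m\<in>{n..}. c * f m)"
    by (intro SUP_mono' INF_greatest mult_left_mono INF_lower) auto
  finally show ?thesis unfolding liminf_SUP_INF .
qed

section \<open>Functions as distributions\<close>

lemma L1_borel: "v \<in> L1 \<Longrightarrow> v \<in> borel_measurable leb_Q"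
  by (simp add: L1_def)

lemma L1_norm_less_top: "v \<in> L1 \<Longrightarrow> L1_norm v < top"
  by (simp add: L1_norm_eq)

lemma L1_lincomb: "v \<in> L1 \<Longrightarrow> w \<in> L1 \<Longrightarrow> (\<lambda>x. a *\<^sub>R v x + b *\<^sub>R w x) \<in> L1"
  by (simp add: L1_def)

lemma L1_diff: "v \<in> L1 \<Longrightarrow> w \<in> L1 \<Longrightarrow> (\<lambda>x. v x - w x) \<in> L1"
  by (simp add: L1_def)

lemma L1_norm_midpoint_le:
  fixes v v' w :: "real^'n \<Rightarrow> 'x::euclidean_space"
  assumes "v \<in> L1" "v' \<in> L1" "w \<in> L1"
  shows "L1_norm (\<lambda>x. (1/2) *\<^sub>R v x + (1/2) *\<^sub>R v' x - w x)
    \<le> ennreal (1/2) * L1_norm (\<lambda>x. v x - w x) + ennreal (1/2) * L1_norm (\<lambda>x. v' x - w x)"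
proof -
  note [measurable] = assms[THEN L1_borel]
  have "L1_norm (\<lambda>x. (1/2) *\<^sub>R v x + (1/2) *\<^sub>R v' x - w x)
    \<le> (\<integral>\<^sup>+x. ennreal (1/2) * ennreal (norm (v x - w x)) + ennreal (1/2) * ennreal (norm (v' x - w x)) \<partial>leb_Q)"
    unfolding L1_norm_def
  proof (rule nn_integral_mono)
    fix x
    have "w x = (1/2) *\<^sub>R w x + (1/2) *\<^sub>R w x" unfolding scaleR_add_left[symmetric] by simp
    then have "(1/2) *\<^sub>R v x + (1/2) *\<^sub>R v' x - w x = (1/2) *\<^sub>R v x + (1/2) *\<^sub>R v' x - ((1/2) *\<^sub>R w x + (1/2) *\<^sub>R w x)"
      by (rule arg_cong)
    also have "\<dots> = (1/2) *\<^sub>R (v x - w x) + (1/2) *\<^sub>R (v' x - w x)"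
      unfolding scaleR_diff_right by simp
    finally have "(1/2) *\<^sub>R v x + (1/2) *\<^sub>R v' x - w x = (1/2) *\<^sub>R (v x - w x) + (1/2) *\<^sub>R (v' x - w x)" .
    then have "norm ((1/2) *\<^sub>R v x + (1/2) *\<^sub>R v' x - w x) \<le> 1/2 * norm (v x - w x) + 1/2 * norm (v' x - w x)"
      using norm_triangle_ineq[of "(1/2) *\<^sub>R (v x - w x)" "(1/2) *\<^sub>R (v' x - w x)"] by simp
    then have "ennreal (norm ((1/2) *\<^sub>R v x + (1/2) *\<^sub>R v' x - w x)) \<le> ennreal (1/2 * norm (v x - w x) + 1/2 * norm (v' x - w x))"
      by (rule ennreal_leI)
    also have "\<dots> = ennreal (1/2) * ennreal (norm (v x - w x)) + ennreal (1/2) * ennreal (norm (v' x - w x))"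
      by (rule ennreal_lincomb[symmetric]) simp_all
    finally show "ennreal (norm ((1/2) *\<^sub>R v x + (1/2) *\<^sub>R v' x - w x))
      \<le> ennreal (1/2) * ennreal (norm (v x - w x)) + ennreal (1/2) * ennreal (norm (v' x - w x))" .
  qed
  also have "\<dots> = ennreal (1/2) * L1_norm (\<lambda>x. v x - w x) + ennreal (1/2) * L1_norm (\<lambda>x. v' x - w x)"
    unfolding L1_norm_def by (subst nn_integral_add) (simp_all add: nn_integral_cmult)
  finally show ?thesis .
qed

lemma regular_lincomb:
  assumes "v \<in> L1" "w \<in> L1" "\<phi> \<in> test_functions"
  shows "regular (\<lambda>x. a *\<^sub>R v x + b *\<^sub>R w x) \<phi> = a *\<^sub>R regular v \<phi> + b *\<^sub>R regular w \<phi>"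
proof -
  note i = test_regular_integrable[OF assms(3) assms(1)] test_regular_integrable[OF assms(3) assms(2)]
  have "regular (\<lambda>x. a *\<^sub>R v x + b *\<^sub>R w x) \<phi> = (\<integral>x. a *\<^sub>R (\<phi> x *\<^sub>R v x) + b *\<^sub>R (\<phi> x *\<^sub>R w x) \<partial>leb_Q)"
    unfolding regular_def by (simp add: scaleR_add_right mult.commute)
  also have "\<dots> = a *\<^sub>R regular v \<phi> + b *\<^sub>R regular w \<phi>"
    unfolding regular_def by (subst Bochner_Integration.integral_add) (use i in \<open>simp_all del: scaleR_scaleR\<close>)
  finally show ?thesis .
qed

lemma regular_diff:
  assumes "v \<in> L1" "w \<in> L1" "\<phi> \<in> test_functions"
  shows "regular (\<lambda>x. v x - w x) \<phi> = regular v \<phi> - regular w \<phi>"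
  using regular_lincomb[OF assms, of 1 "-1"] by simp

lemma norm_regular_le:
  fixes v :: "real^'n \<Rightarrow> 'x::euclidean_space"
  assumes "v \<in> L1" "L1_norm v \<le> ennreal c" "c \<ge> 0" "\<phi> \<in> test_functions" "\<And>x. \<bar>\<phi> x\<bar> \<le> M"
  shows "norm (regular v \<phi>) \<le> M * c"
  by (rule norm_functional_le_Mb_norm[OF order_trans[OF Mb_norm_regular[OF assms(1)] assms(2)] assms(3,4,5)])

lemma regular_tendsto:
  fixes v :: "nat \<Rightarrow> real^'n \<Rightarrow> 'x::euclidean_space"
  assumes v: "\<And>n. v n \<in> L1" "w \<in> L1" and lim: "(\<lambda>n. L1_norm (\<lambda>x. v n x - w x)) \<longlonglongrightarrow> 0" and \<phi>: "\<phi> \<in> test_functions"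
  shows "(\<lambda>n. regular (v n) \<phi>) \<longlonglongrightarrow> regular w \<phi>"
proof -
  obtain M where M: "\<And>x. \<bar>\<phi> x\<bar> \<le> M" using test_bounded[OF \<phi>] by metis
  have "(\<lambda>n. L1_norm (\<lambda>x. v n x - w x)) \<longlonglongrightarrow> ennreal 0" using lim by simp
  then have "(\<lambda>n. enn2real (L1_norm (\<lambda>x. v n x - w x))) \<longlonglongrightarrow> 0" by (rule tendsto_enn2real) simp
  then have z: "(\<lambda>n. M * enn2real (L1_norm (\<lambda>x. v n x - w x))) \<longlonglongrightarrow> 0" by (rule tendsto_mult_right_zero)
  have "norm (regular (v n) \<phi> - regular w \<phi>) \<le> M * enn2real (L1_norm (\<lambda>x. v n x - w x))" for n
    unfolding regular_diff[OF v(1) v(2) \<phi>, symmetric]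
    by (rule norm_regular_le) (use L1_diff[OF v] L1_norm_less_top[OF L1_diff[OF v]] M \<phi> in auto)
  then have "(\<lambda>n. regular (v n) \<phi> - regular w \<phi>) \<longlonglongrightarrow> 0"
    by (intro Lim_null_comparison[OF always_eventually z] allI)
  then show ?thesis by (simp add: LIM_zero_iff)
qed

section \<open>The distributional gradient and first order operators\<close>

lemma distr_grad_nth: "distr_grad T \<phi> $ i = - T (partial i \<phi>)"
  by (simp add: distr_grad_def distr_partial_def)

lemma distr_grad_regular_lincomb:
  assumes "u \<in> L1" "w \<in> L1" "\<phi> \<in> test_functions"
  shows "distr_grad (regular (\<lambda>x. a * u x + b * w x)) \<phi> = a *\<^sub>R distr_grad (regular u) \<phi> + b *\<^sub>R distr_grad (regular w) \<phi>"
  using regular_lincomb[OF assms(1,2) test_partial[OF assms(3)], of a b]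
  by (simp add: vec_eq_iff distr_grad_nth)

lemma distr_grad_regular_tendsto:
  fixes u :: "nat \<Rightarrow> real^'n \<Rightarrow> real"
  assumes "\<And>n. u n \<in> L1" "w \<in> L1" "(\<lambda>n. L1_norm (\<lambda>x. u n x - w x)) \<longlonglongrightarrow> 0" "\<phi> \<in> test_functions"
  shows "(\<lambda>n. distr_grad (regular (u n)) \<phi>) \<longlonglongrightarrow> distr_grad (regular w) \<phi>"
  by (rule vec_tendstoI) (unfold distr_grad_nth, intro tendsto_minus regular_tendsto assms test_partial)

lemma apply_op_nth: "apply_op B T \<phi> $ l $ j = (\<Sum>i\<in>UNIV. \<Sum>k\<in>UNIV. B $ i $ l $ j $ k * - (T (partial i \<phi>) $ k))"
  by (simp add: apply_op_def distr_partial_def)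

lemma apply_op_regular_lincomb:
  assumes "v \<in> L1" "w \<in> L1" "\<phi> \<in> test_functions"
  shows "apply_op B (regular (\<lambda>x. a *\<^sub>R v x + b *\<^sub>R w x)) \<phi> = a *\<^sub>R apply_op B (regular v) \<phi> + b *\<^sub>R apply_op B (regular w) \<phi>"
proof -
  have "regular (\<lambda>x. a *\<^sub>R v x + b *\<^sub>R w x) (partial i \<phi>) = a *\<^sub>R regular v (partial i \<phi>) + b *\<^sub>R regular w (partial i \<phi>)" for i
    by (rule regular_lincomb[OF assms(1,2) test_partial[OF assms(3)]])
  then show ?thesis
    by (simp add: vec_eq_iff apply_op_nth sum_distrib_left sum.distrib[symmetric] algebra_simps)
qed

lemma apply_op_diff: "apply_op (B - B') T \<phi> = apply_op B T \<phi> - apply_op B' T \<phi>"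
  by (simp add: vec_eq_iff apply_op_nth sum_subtractf[symmetric] algebra_simps)

lemma apply_op_regular_tendsto:
  fixes v :: "nat \<Rightarrow> real^'n \<Rightarrow> real^'n"
  assumes B: "Bs \<longlonglongrightarrow> B" and v: "\<And>n. v n \<in> L1" "w \<in> L1" "(\<lambda>n. L1_norm (\<lambda>x. v n x - w x)) \<longlonglongrightarrow> 0"
    and \<phi>: "\<phi> \<in> test_functions"
  shows "(\<lambda>n. apply_op (Bs n) (regular (v n)) \<phi>) \<longlonglongrightarrow> apply_op B (regular w) \<phi>"
proof (intro vec_tendstoI, unfold apply_op_nth)
  fix l j
  show "(\<lambda>n. \<Sum>i\<in>UNIV. \<Sum>k\<in>UNIV. Bs n $ i $ l $ j $ k * - (regular (v n) (partial i \<phi>) $ k))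
    \<longlonglongrightarrow> (\<Sum>i\<in>UNIV. \<Sum>k\<in>UNIV. B $ i $ l $ j $ k * - (regular w (partial i \<phi>) $ k))"
    by (intro tendsto_sum tendsto_mult tendsto_minus tendsto_vec_nth B regular_tendsto[OF v] test_partial \<phi>)
qed

lemma represents_add_regular:
  assumes "represents \<mu> (\<lambda>\<phi>. S \<phi> - regular v \<phi>)" "v \<in> L1"
  shows "\<exists>\<mu>. represents \<mu> S"
proof -
  have "Mb_norm (\<lambda>\<phi>. (S \<phi> - regular v \<phi>) + regular v \<phi>) \<le> Mb_norm (\<lambda>\<phi>. S \<phi> - regular v \<phi>) + Mb_norm (regular v)"
    by (rule Mb_norm_add)
  also have "\<dots> < top"
  proof -
    have "Mb_norm (\<lambda>\<phi>. S \<phi> - regular v \<phi>) < top" "Mb_norm (regular v) < top"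
      unfolding Mb_norm_less_top_iff using assms(1) represents_regular(1)[OF assms(2)] by blast+
    then show ?thesis by simp
  qed
  finally show ?thesis by (simp add: Mb_norm_less_top_iff)
qed

lemma BV_iff: "u \<in> BV \<longleftrightarrow> u \<in> L1 \<and> Mb_norm (distr_grad (regular u)) < top"
  by (auto simp: BV_def Mb_norm_less_top_iff)

lemma BV_op_iff: "v \<in> BV_op B \<longleftrightarrow> v \<in> L1 \<and> Mb_norm (apply_op B (regular v)) < top"
  by (auto simp: BV_op_def Mb_norm_less_top_iff)

abbreviation grad_defect :: "(real^'n \<Rightarrow> real) \<Rightarrow> (real^'n::finite \<Rightarrow> real^'n) \<Rightarrow> ennreal" where
  "grad_defect u v \<equiv> Mb_norm (\<lambda>\<phi>. distr_grad (regular u) \<phi> - regular v \<phi>)"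

lemma Mb_norm_grad_midpoint:
  fixes u u' :: "real^'n \<Rightarrow> real"
  assumes "u \<in> L1" "u' \<in> L1" "v \<in> L1" "v' \<in> L1"
  shows "Mb_norm (\<lambda>\<phi>. distr_grad (regular (\<lambda>x. (u x + u' x) / 2)) \<phi> - regular (\<lambda>x. (1/2) *\<^sub>R v x + (1/2) *\<^sub>R v' x) \<phi>)
    \<le> ennreal (1/2) * grad_defect u v
      + ennreal (1/2) * Mb_norm (\<lambda>\<phi>. distr_grad (regular u') \<phi> - regular v' \<phi>)"
proof -
  have eq: "(\<lambda>x. (u x + u' x) / 2) = (\<lambda>x. 1/2 * u x + 1/2 * u' x)" by (auto simp: field_simps)
  have "Mb_norm (\<lambda>\<phi>. distr_grad (regular (\<lambda>x. (u x + u' x) / 2)) \<phi> - regular (\<lambda>x. (1/2) *\<^sub>R v x + (1/2) *\<^sub>R v' x) \<phi>)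
     = Mb_norm (\<lambda>\<phi>. (1/2) *\<^sub>R (distr_grad (regular u) \<phi> - regular v \<phi>) + (1/2) *\<^sub>R (distr_grad (regular u') \<phi> - regular v' \<phi>))"
  proof (rule Mb_norm_cong)
    fix \<phi> :: "real^'n \<Rightarrow> real" assume \<phi>: "\<phi> \<in> test_functions"
    show "distr_grad (regular (\<lambda>x. (u x + u' x) / 2)) \<phi> - regular (\<lambda>x. (1/2) *\<^sub>R v x + (1/2) *\<^sub>R v' x) \<phi>
      = (1/2) *\<^sub>R (distr_grad (regular u) \<phi> - regular v \<phi>) + (1/2) *\<^sub>R (distr_grad (regular u') \<phi> - regular v' \<phi>)"
      unfolding eq distr_grad_regular_lincomb[OF assms(1,2) \<phi>] regular_lincomb[OF assms(3,4) \<phi>]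
      by (simp add: scaleR_diff_right)
  qed
  also have "\<dots> \<le> ennreal \<bar>1/2\<bar> * grad_defect u v
      + ennreal \<bar>1/2\<bar> * Mb_norm (\<lambda>\<phi>. distr_grad (regular u') \<phi> - regular v' \<phi>)"
    by (rule Mb_norm_lincomb) auto
  finally show ?thesis by simp
qed

text \<open>
  For smooth \<open>v\<close> integration by parts turns \<open>apply_op B (regular v)\<close> into integration against a continuous
  function that depends linearly on the coefficients \<open>B\<close>. So \<open>v\<close> is admissible for all operators at
  once, with a continuous dependence on the operator.
\<close>
lemma apply_op_smooth:
  fixes v :: "real^'n \<Rightarrow> real^'n"
  assumes v: "smooth v"
  obtains G where "\<And>B. Mb_norm (apply_op B (regular v)) \<le> ennreal (G * norm B)" "G \<ge> 0"
proof -
  define H where "H x = (\<Sum>l\<in>(UNIV::'n set). \<Sum>j\<in>(UNIV::'n set). \<Sum>i\<in>UNIV. \<Sum>k\<in>(UNIV::'n set). norm (partial i v x))" for x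
  have pc: "continuous_on UNIV (partial i v)" for i by (intro smooth_continuous_on smooth_partial v)
  have H: "H \<in> L1" unfolding H_def by (intro continuous_L1 continuous_intros pc)
  have H0: "0 \<le> H x" for x unfolding H_def by (intro sum_nonneg) simp
  define G where "G = (\<integral>x. H x \<partial>leb_Q)"
  have "Mb_norm (apply_op B (regular v)) \<le> ennreal (G * norm B)" for B :: "'n operator"
  proof -
    define g :: "real^'n \<Rightarrow> real^'n^'n" where "g x = (\<chi> l j. \<Sum>i\<in>UNIV. \<Sum>k\<in>UNIV. B $ i $ l $ j $ k * (partial i v x $ k))" for x
    have g: "g \<in> L1" unfolding g_def by (intro continuous_L1 continuous_intros pc)
    have reg: "apply_op B (regular v) \<phi> = regular g \<phi>" if \<phi>: "\<phi> \<in> test_functions" for \<phi>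
    proof -
      have int: "integrable leb_Q (\<lambda>x. \<phi> x *\<^sub>R partial i v x)" for i
        by (intro test_regular_integrable \<phi> smooth_L1 smooth_partial v)
      have nth: "regular f \<phi> $ m = (\<integral>x. \<phi> x *\<^sub>R (f x $ m) \<partial>leb_Q)" if "f \<in> L1" for f :: "real^'n \<Rightarrow> ('y::euclidean_space)^'n" and m
        using integral_bounded_linear[OF bounded_linear_vec_nth test_regular_integrable[OF \<phi> that], of m]
        by (simp add: regular_def)
      have comp: "(\<lambda>x. f x $ m) \<in> L1" if "f \<in> L1" for f :: "real^'n \<Rightarrow> ('y::euclidean_space)^'n" and m
        using that integrable_bounded_linear[OF bounded_linear_vec_nth, of leb_Q f m] by (simp add: L1_def)
      have "regular g \<phi> $ l $ j = (\<integral>x. \<phi> x *\<^sub>R (g x $ l $ j) \<partial>leb_Q)" for l j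
        using nth[OF g, of l] nth[OF comp[OF g, of l], of j] by (simp add: regular_def)
      also have "(\<integral>x. \<phi> x *\<^sub>R (g x $ l $ j) \<partial>leb_Q)
        = (\<integral>x. (\<Sum>i\<in>UNIV. \<Sum>k\<in>UNIV. B $ i $ l $ j $ k * (\<phi> x *\<^sub>R partial i v x $ k)) \<partial>leb_Q)" for l j
        by (simp add: g_def sum_distrib_left mult_ac)
      also have "\<dots> l j = (\<Sum>i\<in>UNIV. \<Sum>k\<in>UNIV. B $ i $ l $ j $ k * (regular (partial i v) \<phi> $ k))" for l j
      proof -
        have ik: "integrable leb_Q (\<lambda>x. \<phi> x *\<^sub>R partial i v x $ k)" for i k
          using test_regular_integrable[OF \<phi> comp[OF smooth_L1[OF smooth_partial[OF v]]]] by simp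
        show ?thesis
          using ik by (simp add: nth[OF smooth_L1[OF smooth_partial[OF v]]])
      qed
      finally have "regular g \<phi> $ l $ j = (\<Sum>i\<in>UNIV. \<Sum>k\<in>UNIV. B $ i $ l $ j $ k * (regular (partial i v) \<phi> $ k))" for l j .
      then show ?thesis
        by (simp add: vec_eq_iff apply_op_nth regular_partial[OF v \<phi>])
    qed
    have "norm (g x) \<le> norm B * H x" for x
    proof -
      have entry: "\<bar>B $ i $ l $ j $ k\<bar> \<le> norm B" for i l j k
        using component_le_norm_cart[of "B $ i $ l $ j" k] Finite_Cartesian_Product.norm_nth_le[of "B $ i $ l" j]
          Finite_Cartesian_Product.norm_nth_le[of "B $ i" l] Finite_Cartesian_Product.norm_nth_le[of B i] by linarith
      have "norm (g x) \<le> (\<Sum>l\<in>UNIV. norm (g x $ l))"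
        unfolding norm_vec_def by (rule L2_set_le_sum) simp
      also have "\<dots> \<le> (\<Sum>l\<in>UNIV. \<Sum>j\<in>UNIV. norm (g x $ l $ j))"
        by (intro sum_mono) (subst norm_vec_def, rule L2_set_le_sum, simp)
      also have "\<dots> \<le> (\<Sum>l\<in>(UNIV::'n set). \<Sum>j\<in>(UNIV::'n set). \<Sum>i\<in>UNIV. \<Sum>k\<in>(UNIV::'n set). norm B * norm (partial i v x))"
      proof (intro sum_mono)
        fix l j
        have "norm (g x $ l $ j) = \<bar>\<Sum>i\<in>UNIV. \<Sum>k\<in>UNIV. B $ i $ l $ j $ k * (partial i v x $ k)\<bar>"
          by (simp add: g_def)
        also have "\<dots> \<le> (\<Sum>i\<in>UNIV. \<Sum>k\<in>UNIV. \<bar>B $ i $ l $ j $ k * (partial i v x $ k)\<bar>)"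
          by (intro order_trans[OF sum_abs] sum_mono order_refl)
        also have "\<dots> \<le> (\<Sum>i\<in>UNIV. \<Sum>k\<in>(UNIV::'n set). norm B * norm (partial i v x))"
          unfolding abs_mult by (intro sum_mono mult_mono entry component_le_norm_cart) simp_all
        finally show "norm (g x $ l $ j) \<le> (\<Sum>i\<in>UNIV. \<Sum>k\<in>(UNIV::'n set). norm B * norm (partial i v x))" .
      qed
      also have "\<dots> = norm B * H x" by (simp only: H_def sum_distrib_left)
      finally show ?thesis .
    qed
    then have "L1_norm g \<le> (\<integral>\<^sup>+x. ennreal (norm B) * ennreal (norm (H x)) \<partial>leb_Q)"
      unfolding L1_norm_def using H0 by (intro nn_integral_mono) (simp add: ennreal_mult[symmetric] ennreal_leI)
    also have "\<dots> = ennreal (norm B) * L1_norm H"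
      unfolding L1_norm_def using L1_borel[OF H] by (intro nn_integral_cmult) simp
    also have "\<dots> = ennreal (G * norm B)"
      using H0 by (simp add: L1_norm_eq[OF H] G_def ennreal_mult[symmetric] mult.commute integral_nonneg_AE)
    finally have "L1_norm g \<le> ennreal (G * norm B)" .
    with Mb_norm_regular[OF g] show ?thesis using Mb_norm_cong[of "apply_op B (regular v)" "regular g", OF reg] by simp
  qed
  moreover have "G \<ge> 0" unfolding G_def using H0 by (intro integral_nonneg_AE) simp
  ultimately show thesis by (rule that)
qed

section \<open>The auxiliary fields are bounded\<close>

lemma L1_norm_scaleR:
  assumes "v \<in> L1" shows "L1_norm (\<lambda>x. a *\<^sub>R v x) = ennreal \<bar>a\<bar> * L1_norm v"
  unfolding L1_norm_def using L1_borel[OF assms]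
  by (subst nn_integral_cmult[symmetric]) (simp_all add: ennreal_mult)

lemma L1_norm_AE_cong: "AE x in leb_Q. v x = w x \<Longrightarrow> L1_norm v = L1_norm w"
  unfolding L1_norm_def by (intro nn_integral_cong_AE) auto

lemma distr_grad_regular_bound:
  fixes \<phi> :: "real^'n \<Rightarrow> real"
  assumes \<phi>: "\<phi> \<in> test_functions" and "K \<ge> 0"
  obtains C where "\<And>u. u \<in> L1 \<Longrightarrow> L1_norm u \<le> ennreal K \<Longrightarrow> norm (distr_grad (regular u) \<phi>) \<le> C"
proof -
  have "\<exists>M. \<forall>x. \<bar>partial i \<phi> x\<bar> \<le> M" for i
    using test_bounded[OF test_partial[OF \<phi>]] by metis
  then obtain M where M: "\<And>i x. \<bar>partial i \<phi> x\<bar> \<le> M i" by metis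
  show thesis
  proof (rule that)
    fix u :: "real^'n \<Rightarrow> real" assume u: "u \<in> L1" "L1_norm u \<le> ennreal K"
    have "norm (distr_grad (regular u) \<phi>) \<le> (\<Sum>i\<in>UNIV. \<bar>distr_grad (regular u) \<phi> $ i\<bar>)"
      by (rule norm_le_l1_cart)
    also have "\<dots> \<le> (\<Sum>i\<in>UNIV. M i * K)"
    proof (rule sum_mono)
      fix i
      have "norm (regular u (partial i \<phi>)) \<le> M i * K"
        by (rule norm_regular_le[OF u assms(2) test_partial[OF \<phi>] M])
      then show "\<bar>distr_grad (regular u) \<phi> $ i\<bar> \<le> M i * K" by (simp add: distr_grad_nth)
    qed
    finally show "norm (distr_grad (regular u) \<phi>) \<le> (\<Sum>i\<in>UNIV. M i * K)" .
  qed
qed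

lemma apply_op_regular_scaleR:
  assumes "v \<in> L1" "\<phi> \<in> test_functions"
  shows "apply_op B (regular (\<lambda>x. a *\<^sub>R v x)) \<phi> = a *\<^sub>R apply_op B (regular v) \<phi>"
  using apply_op_regular_lincomb[OF assms(1,1,2), of B a 0] by simp

lemma regular_scaleR:
  assumes "v \<in> L1" "\<phi> \<in> test_functions"
  shows "regular (\<lambda>x. a *\<^sub>R v x) \<phi> = a *\<^sub>R regular v \<phi>"
  using regular_lincomb[OF assms(1,1,2), of a 0] by simp

text \<open>
  Otherwise normalize: dividing by \<open>t j = L1_norm (v (n j))\<close>, which tends to infinity, gives fields of norm
  one to which the compactness property applies. By it a subsequence converges in \<open>L\<^sup>1\<close> to some \<open>w\<close> of
  norm one. But the functions \<open>u\<close> are bounded in \<open>L\<^sup>1\<close>, so that their gradients are scaled to zero in the sense of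
  distributions, and so are the differences between gradients and fields. Hence \<open>w = 0\<close> by the fundamental lemma, a contradiction.
\<close>
lemma auxiliary_fields_bounded:
  fixes Bs :: "nat \<Rightarrow> 'n::finite operator"
  assumes compact: "compactness_property \<Sigma>" and bounded: "linf_bounded \<Sigma>"
    and Bs: "\<And>n. Bs n \<in> \<Sigma>" and u: "\<And>n. u n \<in> L1" and v: "\<And>n. v n \<in> BV_op (Bs n)"
    and K: "K \<ge> 0" "\<And>n. L1_norm (u n) \<le> ennreal K"
      "\<And>n. grad_defect (u n) (v n) \<le> ennreal K"
      "\<And>n. Mb_norm (apply_op (Bs n) (regular (v n))) \<le> ennreal K"
  shows "\<exists>C\<ge>0. \<forall>n. L1_norm (v n) \<le> ennreal C"
proof (rule ccontr)
  assume no: "\<not> (\<exists>C\<ge>0. \<forall>n. L1_norm (v n) \<le> ennreal C)"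
  have vL: "v n \<in> L1" for n using v by (simp add: BV_op_iff)
  have "\<exists>n. ennreal (real j + 1) < L1_norm (v n)" for j
  proof -
    have "0 \<le> real j + 1" by simp
    then show ?thesis using no by (meson not_le)
  qed
  then obtain n where n: "\<And>j. ennreal (real j + 1) < L1_norm (v (n j))" by metis
  define t where "t j = enn2real (L1_norm (v (n j)))" for j
  have t: "L1_norm (v (n j)) = ennreal (t j)" for j
    unfolding t_def using L1_norm_less_top[OF vL] by simp
  have tj: "real j + 1 < t j" for j using n[of j] unfolding t by (subst (asm) ennreal_less_iff) auto
  have tpos: "0 < t j" and t1: "1 \<le> t j" for j using tj[of j] by simp_all
  define vt where "vt j x = (1 / t j) *\<^sub>R v (n j) x" for j x
  have vtL: "vt j \<in> L1" for j
    using L1_lincomb[OF vL vL, of "1 / t j" "n j" 0] by (simp add: vt_def[abs_def])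
  have vt1: "L1_norm (vt j) = 1" for j
    using tpos[of j] unfolding vt_def[abs_def]
    by (simp add: L1_norm_scaleR[OF vL] t ennreal_mult[symmetric])
  have vtB: "Mb_norm (apply_op (Bs (n j)) (regular (vt j))) \<le> ennreal K" for j
  proof -
    have "Mb_norm (apply_op (Bs (n j)) (regular (vt j))) = Mb_norm (\<lambda>\<phi>. (1 / t j) *\<^sub>R apply_op (Bs (n j)) (regular (v (n j))) \<phi>)"
      unfolding vt_def[abs_def] by (intro Mb_norm_cong apply_op_regular_scaleR vL)
    also have "\<dots> \<le> ennreal \<bar>1 / t j\<bar> * Mb_norm (apply_op (Bs (n j)) (regular (v (n j))))"
      by (rule Mb_norm_scaleR) (use tpos[of j] in simp)
    also have "\<dots> \<le> 1 * ennreal K"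
      using t1[of j] by (intro mult_mono K(4)) (auto simp: abs_if)
    finally show ?thesis by simp
  qed
  have vtBV: "vt j \<in> BV_op (Bs (n j))" for j
    using vtL vtB[of j] by (auto simp: BV_op_iff intro: le_less_trans)
  obtain L where L: "\<And>B. B \<in> \<Sigma> \<Longrightarrow> linf_norm B \<le> L" using bounded by (auto simp: linf_bounded_def)
  have "(SUP j. ennreal (linf_norm (Bs (n j))) + BV_op_norm (Bs (n j)) (vt j)) \<le> ennreal L + (1 + ennreal K)"
    unfolding BV_op_norm_def using vtB by (intro SUP_least add_mono ennreal_leI L Bs) (auto simp: vt1)
  also have "\<dots> < \<infinity>" by simp
  finally have "(\<forall>j. Bs (n j) \<in> \<Sigma> \<and> vt j \<in> BV_op (Bs (n j))) \<and>
      (SUP j. ennreal (linf_norm (Bs (n j))) + BV_op_norm (Bs (n j)) (vt j)) < \<infinity>"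
    using Bs vtBV by simp
  from compact[unfolded compactness_property_def, rule_format, OF this]
  obtain B w r where w: "w \<in> BV_op (B :: 'n operator)" and r: "strict_mono (r :: nat \<Rightarrow> nat)"
    and lim: "(\<lambda>j. L1_norm (\<lambda>x. vt (r j) x - w x)) \<longlonglongrightarrow> 0" by blast
  have wL: "w \<in> L1" using w by (simp add: BV_op_iff)
  have "regular w \<phi> = 0" if \<phi>: "\<phi> \<in> test_functions" for \<phi>
  proof -
    obtain C where C: "\<And>u. u \<in> L1 \<Longrightarrow> L1_norm u \<le> ennreal K \<Longrightarrow> norm (distr_grad (regular u) \<phi>) \<le> C"
      using distr_grad_regular_bound[OF \<phi> K(1)] by blast
    obtain M where M: "\<And>x. \<bar>\<phi> x\<bar> \<le> M" using test_bounded[OF \<phi>] by metis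
    have "norm (regular (vt j) \<phi>) \<le> (C + M * K) / (real j + 1)" for j
    proof -
      have "norm (regular (v (n j)) \<phi>)
          = norm (distr_grad (regular (u (n j))) \<phi> - (distr_grad (regular (u (n j))) \<phi> - regular (v (n j)) \<phi>))" by simp
      also have "\<dots> \<le> norm (distr_grad (regular (u (n j))) \<phi>) + norm (distr_grad (regular (u (n j))) \<phi> - regular (v (n j)) \<phi>)"
        by (rule norm_triangle_ineq4)
      also have "\<dots> \<le> C + M * K"
        by (intro add_mono C u K(2) norm_functional_le_Mb_norm[OF K(3) K(1) \<phi> M])
      finally have b: "norm (regular (v (n j)) \<phi>) \<le> C + M * K" .
      have "norm (regular (vt j) \<phi>) = norm (regular (v (n j)) \<phi>) / t j"
        unfolding vt_def[abs_def] regular_scaleR[OF vL \<phi>] using tpos[of j] by simp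
      also have "\<dots> \<le> (C + M * K) / (real j + 1)"
        by (rule frac_le) (use b tj[of j] order_trans[OF norm_ge_zero b] in auto)
      finally show ?thesis .
    qed
    moreover have z: "(\<lambda>j. (C + M * K) / (real j + 1)) \<longlonglongrightarrow> 0" by real_asymp
    ultimately have "(\<lambda>j. regular (vt j) \<phi>) \<longlonglongrightarrow> 0"
      by (intro Lim_null_comparison[OF always_eventually z] allI)
    from LIMSEQ_subseq_LIMSEQ[OF this r] have "(\<lambda>j. regular (vt (r j)) \<phi>) \<longlonglongrightarrow> 0" by (simp add: o_def)
    moreover have "(\<lambda>j. regular (vt (r j)) \<phi>) \<longlonglongrightarrow> regular w \<phi>"
      by (rule regular_tendsto[OF vtL wL lim \<phi>])
    ultimately show ?thesis using LIMSEQ_unique by blast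
  qed
  then have ae: "AE x in leb_Q. w x = 0" by (rule fundamental_lemma[OF wL])
  have "L1_norm (\<lambda>x. vt (r j) x - w x) = 1" for j
    unfolding vt1[of "r j", symmetric] by (rule L1_norm_AE_cong) (use ae in eventually_elim, simp)
  then show False using lim by (simp add: LIMSEQ_const_iff)
qed

section \<open>The energy and its convexity\<close>

text \<open>
  A state \<open>(u, v, S)\<close> collects an image, an auxiliary field and a functional that stands for the operator
  applied to the field. Keeping \<open>S\<close> as a separate entry makes averages of states with different
  operators meaningful.
\<close>
type_synonym 'n state = "(real^'n \<Rightarrow> real) \<times> (real^'n \<Rightarrow> real^'n) \<times> ('n, real^'n^'n) functional"

definition energy :: "(real^'n \<Rightarrow> real) \<Rightarrow> real \<times> real \<Rightarrow> 'n::finite state \<Rightarrow> ennreal" where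
  "energy f \<alpha> = (\<lambda>(u, v, S). L2_norm_sq (\<lambda>x. u x - f x)
     + ennreal (fst \<alpha>) * grad_defect u v
     + ennreal (snd \<alpha>) * Mb_norm S)"

definition midpoint3 :: "'n::finite state \<Rightarrow> 'n state \<Rightarrow> 'n state" where
  "midpoint3 = (\<lambda>(u, v, S) (u', v', S').
     (\<lambda>x. (u x + u' x) / 2, \<lambda>x. (1/2) *\<^sub>R v x + (1/2) *\<^sub>R v' x, \<lambda>\<phi>. (1/2) *\<^sub>R S \<phi> + (1/2) *\<^sub>R S' \<phi>))"

lemma L2_parallelogram_shifted:
  fixes u u' f :: "real^'n \<Rightarrow> real"
  assumes [measurable]: "u \<in> borel_measurable leb_Q" "u' \<in> borel_measurable leb_Q" "f \<in> borel_measurable leb_Q"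
  shows "L2_norm_sq (\<lambda>x. (u x + u' x) / 2 - f x) + ennreal (1/4) * L2_norm_sq (\<lambda>x. u x - u' x)
    = ennreal (1/2) * L2_norm_sq (\<lambda>x. u x - f x) + ennreal (1/2) * L2_norm_sq (\<lambda>x. u' x - f x)"
proof -
  have eq: "(\<lambda>x. (u x + u' x) / 2 - f x) = (\<lambda>x. ((u x - f x) + (u' x - f x)) / 2)"
    "(\<lambda>x. u x - u' x) = (\<lambda>x. (u x - f x) - (u' x - f x))" by (auto simp: field_simps)
  show ?thesis unfolding eq by (rule L2_norm_sq_parallelogram) auto
qed

text \<open>
  Strong convexity: the squared \<open>L\<^sup>2\<close> distance contributes its parallelogram defect.
\<close>
lemma energy_midpoint:
  assumes "u \<in> L1" "u' \<in> L1" "v \<in> L1" "v' \<in> L1" and f: "f \<in> borel_measurable leb_Q"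
  shows "energy f \<alpha> (midpoint3 (u, v, S) (u', v', S')) + ennreal (1/4) * L2_norm_sq (\<lambda>x. u x - u' x)
    \<le> ennreal (1/2) * energy f \<alpha> (u, v, S) + ennreal (1/2) * energy f \<alpha> (u', v', S')"
proof -
  let ?G = grad_defect
  have g: "?G (\<lambda>x. (u x + u' x) / 2) (\<lambda>x. (1/2) *\<^sub>R v x + (1/2) *\<^sub>R v' x) \<le> ennreal (1/2) * ?G u v + ennreal (1/2) * ?G u' v'"
    by (rule Mb_norm_grad_midpoint) (fact assms)+
  have s: "Mb_norm (\<lambda>\<phi>. (1/2) *\<^sub>R S \<phi> + (1/2) *\<^sub>R S' \<phi>) \<le> ennreal (1/2) * Mb_norm S + ennreal (1/2) * Mb_norm S'"
    using Mb_norm_lincomb[of "1/2" "1/2" S S'] by simp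
  have "energy f \<alpha> (midpoint3 (u, v, S) (u', v', S')) + ennreal (1/4) * L2_norm_sq (\<lambda>x. u x - u' x)
    = (L2_norm_sq (\<lambda>x. (u x + u' x) / 2 - f x) + ennreal (1/4) * L2_norm_sq (\<lambda>x. u x - u' x))
      + ennreal (fst \<alpha>) * ?G (\<lambda>x. (u x + u' x) / 2) (\<lambda>x. (1/2) *\<^sub>R v x + (1/2) *\<^sub>R v' x)
      + ennreal (snd \<alpha>) * Mb_norm (\<lambda>\<phi>. (1/2) *\<^sub>R S \<phi> + (1/2) *\<^sub>R S' \<phi>)"
    by (simp only: energy_def midpoint3_def prod.case ac_simps)
  also have "\<dots> \<le> (ennreal (1/2) * L2_norm_sq (\<lambda>x. u x - f x) + ennreal (1/2) * L2_norm_sq (\<lambda>x. u' x - f x))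
      + ennreal (fst \<alpha>) * (ennreal (1/2) * ?G u v + ennreal (1/2) * ?G u' v')
      + ennreal (snd \<alpha>) * (ennreal (1/2) * Mb_norm S + ennreal (1/2) * Mb_norm S')"
    unfolding L2_parallelogram_shifted[OF L1_borel[OF assms(1)] L1_borel[OF assms(2)] f]
    by (intro add_mono order_refl mult_left_mono g s) auto
  also have "\<dots> = ennreal (1/2) * energy f \<alpha> (u, v, S) + ennreal (1/2) * energy f \<alpha> (u', v', S')"
    by (simp only: energy_def prod.case distrib_left ac_simps)
  finally show ?thesis .
qed

lemma energy_lower_semicontinuous:
  fixes U :: "nat \<Rightarrow> real^'n \<Rightarrow> real"
  assumes U: "\<And>n. U n \<in> L1" "u \<in> L1" and f: "f \<in> borel_measurable leb_Q"
    and V: "\<And>n. V n \<in> L1" "v \<in> L1"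
    and ae: "AE x in leb_Q. (\<lambda>n. U n x) \<longlonglongrightarrow> u x" and Ulim: "(\<lambda>n. L1_norm (\<lambda>x. U n x - u x)) \<longlonglongrightarrow> 0"
    and Vlim: "(\<lambda>n. L1_norm (\<lambda>x. V n x - v x)) \<longlonglongrightarrow> 0"
    and Slim: "\<And>\<phi>. \<phi> \<in> test_functions \<Longrightarrow> (\<lambda>n. S n \<phi>) \<longlonglongrightarrow> T \<phi>"
  shows "energy f \<alpha> (u, v, T) \<le> liminf (\<lambda>n. energy f \<alpha> (U n, V n, S n))"
proof -
  let ?G = grad_defect
  have g: "?G u v \<le> liminf (\<lambda>n. ?G (U n) (V n))"
    by (intro Mb_norm_lower_semicontinuous tendsto_diff distr_grad_regular_tendsto regular_tendsto U V Ulim Vlim)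
  have s: "Mb_norm T \<le> liminf (\<lambda>n. Mb_norm (S n))"
    by (rule Mb_norm_lower_semicontinuous) (rule Slim)
  have l: "L2_norm_sq (\<lambda>x. u x - f x) \<le> liminf (\<lambda>n. L2_norm_sq (\<lambda>x. U n x - f x))"
    by (rule L2_norm_sq_Fatou[OF L1_borel[OF U(1)] f ae])
  have "energy f \<alpha> (u, v, T) \<le> liminf (\<lambda>n. L2_norm_sq (\<lambda>x. U n x - f x))
      + liminf (\<lambda>n. ennreal (fst \<alpha>) * ?G (U n) (V n)) + liminf (\<lambda>n. ennreal (snd \<alpha>) * Mb_norm (S n))"
    unfolding energy_def prod.case
    by (intro add_mono l order_trans[OF _ liminf_cmult_ennreal] mult_left_mono g s) auto
  also have "\<dots> \<le> liminf (\<lambda>n. energy f \<alpha> (U n, V n, S n))"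
    unfolding energy_def prod.case
    by (intro order_trans[OF _ liminf_add_ennreal] add_mono order_refl)
  finally show ?thesis .
qed

lemma energy_change_weights:
  assumes M: "grad_defect u v \<le> ennreal K" "Mb_norm S \<le> ennreal K" and K: "K \<ge> 0"
    and e: "energy f \<beta> (u, v, S) \<le> ennreal a" and a: "a \<ge> 0"
  shows "energy f \<alpha> (u, v, S) \<le> ennreal (a + (\<bar>fst \<alpha> - fst \<beta>\<bar> + \<bar>snd \<alpha> - snd \<beta>\<bar>) * K)"
proof -
  have *: "ennreal x * m \<le> ennreal y * m + ennreal (\<bar>x - y\<bar> * K)" if "m \<le> ennreal K" for x y m
  proof -
    have "ennreal x \<le> ennreal (max 0 y + \<bar>x - y\<bar>)" by (rule ennreal_leI) simp
    also have "\<dots> = ennreal y + ennreal \<bar>x - y\<bar>"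
      by (subst ennreal_plus) (auto simp: max_def ennreal_neg)
    finally have "ennreal x * m \<le> (ennreal y + ennreal \<bar>x - y\<bar>) * m" by (rule mult_right_mono) simp
    also have "\<dots> = ennreal y * m + ennreal \<bar>x - y\<bar> * m" by (rule distrib_right)
    also have "\<dots> \<le> ennreal y * m + ennreal \<bar>x - y\<bar> * ennreal K"
      using that by (intro add_mono mult_left_mono order_refl) auto
    finally show ?thesis using K by (simp add: ennreal_mult)
  qed
  let ?g = "grad_defect u v"
  have "energy f \<alpha> (u, v, S) \<le> L2_norm_sq (\<lambda>x. u x - f x)
      + (ennreal (fst \<beta>) * ?g + ennreal (\<bar>fst \<alpha> - fst \<beta>\<bar> * K)) + (ennreal (snd \<beta>) * Mb_norm S + ennreal (\<bar>snd \<alpha> - snd \<beta>\<bar> * K))"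
    unfolding energy_def prod.case by (intro add_mono order_refl * M)
  also have "\<dots> = energy f \<beta> (u, v, S) + (ennreal (\<bar>fst \<alpha> - fst \<beta>\<bar> * K) + ennreal (\<bar>snd \<alpha> - snd \<beta>\<bar> * K))"
    unfolding energy_def prod.case by (simp only: ac_simps)
  also have "\<dots> \<le> ennreal a + (ennreal (\<bar>fst \<alpha> - fst \<beta>\<bar> * K) + ennreal (\<bar>snd \<alpha> - snd \<beta>\<bar> * K))"
    by (intro add_mono e order_refl)
  also have "\<dots> = ennreal (a + (\<bar>fst \<alpha> - fst \<beta>\<bar> + \<bar>snd \<alpha> - snd \<beta>\<bar>) * K)"
    using a K by (simp add: distrib_right)
  finally show ?thesis .
qed

text \<open>
  A convex functional whose values along the sequence are asymptotically at most \<open>\<beta>\<close> inherits this bound on the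
  hulls of the tails.
\<close>
lemma midhull_convex_limit:
  fixes F :: "'a \<Rightarrow> ennreal"
  assumes y: "\<And>n. y n \<in> midhull mid (X ` {n..})"
    and convex: "\<And>a b. a \<in> midhull mid (range X) \<Longrightarrow> b \<in> midhull mid (range X) \<Longrightarrow>
        F (mid a b) \<le> ennreal (1/2) * F a + ennreal (1/2) * F b"
    and b: "\<And>k. F (X k) \<le> ennreal (b k)" "b \<longlonglongrightarrow> \<beta>" and e: "e > 0"
  shows "\<forall>\<^sub>F n in sequentially. F (y n) \<le> ennreal (\<beta> + e)"
proof -
  have "\<forall>\<^sub>F k in sequentially. b k < \<beta> + e" by (rule order_tendstoD(2)[OF b(2)]) (use e in simp)
  then obtain N where N: "\<And>k. k \<ge> N \<Longrightarrow> b k < \<beta> + e" by (auto simp: eventually_sequentially)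
  have "F (y n) \<le> ennreal (\<beta> + e)" if n: "n \<ge> N" for n
  proof -
    have "x \<in> midhull mid (range X) \<and> F x \<le> ennreal (\<beta> + e)" if "x \<in> midhull mid (X ` {n..})" for x
      using that
    proof induction
      case (base x)
      then obtain k where k: "k \<ge> n" "x = X k" by auto
      have "F x \<le> ennreal (b k)" using b(1) k by simp
      also have "\<dots> \<le> ennreal (\<beta> + e)" using N[of k] k n by (intro ennreal_leI) simp
      finally show ?case using k by (auto intro: midhull.base)
    next
      case (mid x z)
      have "F (mid x z) \<le> ennreal (1/2) * F x + ennreal (1/2) * F z" using mid.IH by (intro convex) auto
      also have "\<dots> \<le> ennreal (1/2) * ennreal (\<beta> + e) + ennreal (1/2) * ennreal (\<beta> + e)"
        using mid.IH by (intro add_mono mult_left_mono) auto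
      also have "\<dots> = (ennreal (1/2) + ennreal (1/2)) * ennreal (\<beta> + e)" by (rule distrib_right[symmetric])
      also have "ennreal (1/2) + ennreal (1/2) = 1" by (subst ennreal_plus[symmetric]) auto
      finally show ?case using mid.IH by (auto intro: midhull.mid)
    qed
    with y show ?thesis by blast
  qed
  then show ?thesis by (auto simp: eventually_sequentially)
qed

lemma ennreal_tendsto_0I:
  fixes f :: "nat \<Rightarrow> ennreal"
  assumes "\<And>e. e > 0 \<Longrightarrow> \<forall>\<^sub>F n in sequentially. f n \<le> ennreal e"
  shows "f \<longlonglongrightarrow> 0"
proof (rule order_tendstoI)
  fix a :: ennreal assume "0 < a"
  then obtain a' where a': "0 < a'" "a' < a" using dense by blast
  then obtain e where e: "0 < e" "ennreal e < a"
    by (cases a') (auto simp: ennreal_less_iff)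
  from assms[OF e(1)] show "\<forall>\<^sub>F n in sequentially. f n < a"
    by eventually_elim (use e(2) in auto)
qed simp

section \<open>Compactness along varying operators\<close>

lemma L2_norm_sq_less_top: "f \<in> L2 \<Longrightarrow> L2_norm_sq f < top"
  and L2_borel: "f \<in> L2 \<Longrightarrow> f \<in> borel_measurable leb_Q"
  by (simp_all add: L2_def)

lemma L1_norm_le_fidelity:
  fixes u f :: "real^'n \<Rightarrow> real"
  assumes "u \<in> borel_measurable leb_Q" and f: "f \<in> L2"
  shows "L1_norm u \<le> ennreal 2 * L2_norm_sq (\<lambda>x. u x - f x) + (ennreal 2 * L2_norm_sq f + ennreal (vol_Q TYPE('n)))"
proof -
  have "L1_norm u \<le> L2_norm_sq u + ennreal (vol_Q TYPE('n))"
    using L1_norm_le_L2_norm_sq[OF assms(1), of 1] by simp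
  also have "\<dots> \<le> (ennreal 2 * L2_norm_sq (\<lambda>x. u x - f x) + ennreal 2 * L2_norm_sq f) + ennreal (vol_Q TYPE('n))"
    by (intro add_mono order_refl L2_norm_sq_le_sum assms(1) L2_borel f)
  finally show ?thesis by (simp add: add.assoc)
qed

lemma level2_functional_le_energy:
  assumes "v \<in> BV_op B"
  shows "level2_functional f \<alpha> B u \<le> energy f \<alpha> (u, v, apply_op B (regular v))"
  unfolding level2_functional_def PGV2_def energy_def prod.case add.assoc
  by (intro add_mono order_refl INF_lower2[OF assms])

lemma level2_functional_less:
  assumes "level2_functional f \<alpha> B u < ennreal a"
  obtains v where "v \<in> BV_op B" "energy f \<alpha> (u, v, apply_op B (regular v)) < ennreal a"
proof -
  have lt: "L2_norm_sq (\<lambda>x. u x - f x) + PGV2 \<alpha> B u < ennreal a"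
    using assms by (simp add: level2_functional_def)
  then have "L2_norm_sq (\<lambda>x. u x - f x) < top" "PGV2 \<alpha> B u < top"
    by (auto intro: le_less_trans[OF _ less_trans[OF lt ennreal_less_top]])
  then obtain x y where x: "L2_norm_sq (\<lambda>x. u x - f x) = ennreal x" "0 \<le> x" and y: "PGV2 \<alpha> B u = ennreal y" "0 \<le> y"
    by (metis less_top_ennreal)
  have xy: "x + y < a"
    using lt x y by (simp add: ennreal_plus[symmetric] ennreal_less_iff del: ennreal_plus)
  then have "PGV2 \<alpha> B u < ennreal (a - x)" using x y by (simp add: ennreal_less_iff)
  then obtain v where v: "v \<in> BV_op B" "ennreal (fst \<alpha>) * grad_defect u v
      + ennreal (snd \<alpha>) * Mb_norm (apply_op B (regular v)) < ennreal (a - x)"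
    unfolding PGV2_def INF_less_iff by blast
  define E where "E = ennreal (fst \<alpha>) * grad_defect u v
      + ennreal (snd \<alpha>) * Mb_norm (apply_op B (regular v))"
  have E: "E < ennreal (a - x)" using v(2) by (simp only: E_def)
  then have "E < top" by (rule less_trans) simp
  then obtain z where z: "E = ennreal z" "0 \<le> z" by (metis less_top_ennreal)
  then have za: "z < a - x" using E by (simp add: ennreal_less_iff)
  have "energy f \<alpha> (u, v, apply_op B (regular v)) = ennreal x + ennreal z"
    unfolding energy_def prod.case add.assoc by (simp only: x z(1)[symmetric] E_def)
  also have "\<dots> = ennreal (x + z)" using x z by simp
  also have "\<dots> < ennreal a" using x z za by (intro ennreal_lessI) auto
  finally show thesis by (rule that[OF v(1)])
qed

text \<open>
  The lower bound \<open>\<theta>\<close> for the weights turns bounds for the energy into bounds for its terms.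
\<close>
lemma cancel_weight:
  assumes "ennreal c * m \<le> ennreal k" "0 < \<theta>" "\<theta> \<le> c" "0 \<le> k"
  shows "m \<le> ennreal (k / \<theta>)"
proof (cases m)
  case (real r)
  have "ennreal (c * r) \<le> ennreal k" using assms real by (simp add: ennreal_mult)
  then have "c * r \<le> k" using assms(4) by simp
  moreover have "\<theta> * r \<le> c * r" using assms(3) real by (intro mult_right_mono) auto
  ultimately have "r \<le> k / \<theta>" using assms(2) by (simp add: pos_le_divide_eq mult.commute)
  then show ?thesis using real by (simp add: ennreal_leI)
next
  case top
  then show ?thesis using assms by (simp add: ennreal_mult_top top_unique)
qed

lemma energy_parts:
  assumes e: "energy f \<alpha> (u, v, S) \<le> ennreal k" and \<theta>: "0 < \<theta>" "\<theta> \<le> fst \<alpha>" "\<theta> \<le> snd \<alpha>" and k: "0 \<le> k"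
  shows "L2_norm_sq (\<lambda>x. u x - f x) \<le> ennreal k"
    and "grad_defect u v \<le> ennreal (k / \<theta>)"
    and "Mb_norm S \<le> ennreal (k / \<theta>)"
proof -
  show "L2_norm_sq (\<lambda>x. u x - f x) \<le> ennreal k"
    by (rule order_trans[OF _ e]) (simp add: energy_def add.assoc)
  have "ennreal (fst \<alpha>) * grad_defect u v \<le> ennreal k"
    by (rule order_trans[OF _ e]) (simp add: energy_def add_increasing add_increasing2)
  then show "grad_defect u v \<le> ennreal (k / \<theta>)"
    by (rule cancel_weight[OF _ \<theta>(1,2) k])
  have "ennreal (snd \<alpha>) * Mb_norm S \<le> ennreal k"
    by (rule order_trans[OF _ e]) (simp add: energy_def add_increasing)
  then show "Mb_norm S \<le> ennreal (k / \<theta>)"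
    by (rule cancel_weight[OF _ \<theta>(1,3) k])
qed

lemma nonneg_convergent_bounded:
  fixes a :: "nat \<Rightarrow> real"
  assumes "a \<longlonglongrightarrow> l" obtains K where "K \<ge> 0" "\<And>n. a n \<le> K"
proof -
  have "Bseq a" using assms by (intro convergent_imp_Bseq convergentI)
  then obtain K where "K > 0" "\<And>n. norm (a n) \<le> K" by (auto simp: Bseq_def)
  then show thesis by (intro that[of K]) (auto simp: abs_le_iff)
qed

text \<open>
  The direct method along a sequence of operators and weights. The fields converge strongly in \<open>L\<^sup>1\<close>
  after passing to a subsequence, but the images are only bounded in \<open>L\<^sup>2\<close>. Convex combinations of the tails
  converge strongly by Mazur's lemma. Taking them in the space of states keeps all
  information: the combined fields still converge to the same limit \<open>w\<close>, and the combined functionals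
  still converge to \<open>apply_op B (regular w)\<close>, because these convergences are convex conditions on the tail. Energy
  and cost are convex, so they do not increase in the limit, and the energy is lower semicontinuous
  under strong convergence. A constant sequence of operators gives existence for the lower level
  problem; a minimizing sequence gives existence for the upper level problem.
\<close>
theorem level2_limit:
  fixes Bs :: "nat \<Rightarrow> 'n::finite operator" and f g :: "real^'n \<Rightarrow> real"
  assumes compact: "compactness_property \<Sigma>" and bounded: "linf_bounded \<Sigma>"
    and Bs: "\<And>n. Bs n \<in> \<Sigma>" "Bs \<longlonglongrightarrow> B"
    and \<alpha>: "\<alpha>s \<longlonglongrightarrow> \<alpha>" and \<theta>: "0 < \<theta>" "\<And>n. \<theta> \<le> fst (\<alpha>s n)" "\<And>n. \<theta> \<le> snd (\<alpha>s n)"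
    and f: "f \<in> L2" and g: "g \<in> borel_measurable leb_Q"
    and u: "\<And>n. u n \<in> BV" and v: "\<And>n. v n \<in> BV_op (Bs n)"
    and a: "\<And>n. energy f (\<alpha>s n) (u n, v n, apply_op (Bs n) (regular (v n))) \<le> ennreal (a n)" "a \<longlonglongrightarrow> a0" "\<And>n. 0 \<le> a n"
    and c: "\<And>n. L2_norm_sq (\<lambda>x. u n x - g x) \<le> ennreal (c n)" "c \<longlonglongrightarrow> c0"
  shows "\<exists>w\<in>BV. level2_functional f \<alpha> B w \<le> ennreal a0 \<and> L2_norm_sq (\<lambda>x. w x - g x) \<le> ennreal c0"
proof -
  note fm = L2_borel[OF f]
  obtain K where K: "K \<ge> 0" "\<And>n. a n \<le> K" using nonneg_convergent_bounded[OF a(2)] by metis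
  have eK: "energy f (\<alpha>s n) (u n, v n, apply_op (Bs n) (regular (v n))) \<le> ennreal K" for n
    by (rule order_trans[OF a(1) ennreal_leI[OF K(2)]])
  note parts = energy_parts[OF eK \<theta>(1) \<theta>(2) \<theta>(3) K(1)]
  have uL: "u n \<in> L1" for n using u by (simp add: BV_iff)
  have vL: "v n \<in> L1" for n using v by (simp add: BV_op_iff)
  \<comment> \<open>bound for the images in L1, obtained from the fidelity term\<close>
  define K1 where "K1 = enn2real (ennreal 2 * ennreal K + (ennreal 2 * L2_norm_sq f + ennreal (vol_Q TYPE('n))))"
  have "L1_norm (u n) \<le> ennreal K1" for n
  proof -
    have "L1_norm (u n) \<le> ennreal 2 * ennreal K + (ennreal 2 * L2_norm_sq f + ennreal (vol_Q TYPE('n)))"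
      by (intro order_trans[OF L1_norm_le_fidelity[OF L1_borel[OF uL] f]] add_mono mult_left_mono parts(1)) auto
    also have "\<dots> = ennreal K1"
      unfolding K1_def using L2_norm_sq_less_top[OF f] by (subst ennreal_enn2real) (auto simp: ennreal_mult_less_top)
    finally show ?thesis .
  qed
  note uK1 = this
  define K2 where "K2 = max K1 (K / \<theta>)"
  have K12: "ennreal K1 \<le> ennreal K2" "ennreal (K / \<theta>) \<le> ennreal K2" by (simp_all add: K2_def ennreal_leI)
  have uK: "L1_norm (u n) \<le> ennreal K2" for n by (rule order_trans[OF uK1 K12(1)])
  have MK: "grad_defect (u n) (v n) \<le> ennreal K2"
    "Mb_norm (apply_op (Bs n) (regular (v n))) \<le> ennreal K2" for n
    by (rule order_trans[OF parts(2) K12(2)], rule order_trans[OF parts(3) K12(2)])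
  have K2: "K2 \<ge> 0" using K(1) \<theta>(1) by (simp add: K2_def le_max_iff_disj)
  obtain C where C: "C \<ge> 0" "\<And>n. L1_norm (v n) \<le> ennreal C"
    using auxiliary_fields_bounded[where Bs=Bs and u=u and v=v, OF compact bounded Bs(1) uL v K2 uK MK] by blast
  obtain L where L: "\<And>B. B \<in> \<Sigma> \<Longrightarrow> linf_norm B \<le> L" using bounded by (auto simp: linf_bounded_def)
  have "(SUP n. ennreal (linf_norm (Bs n)) + BV_op_norm (Bs n) (v n)) \<le> ennreal L + (ennreal C + ennreal K2)"
    unfolding BV_op_norm_def by (intro SUP_least add_mono ennreal_leI L Bs C MK)
  also have "\<dots> < \<infinity>" by simp
  finally have "(\<forall>n. Bs n \<in> \<Sigma> \<and> v n \<in> BV_op (Bs n)) \<and>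
      (SUP n. ennreal (linf_norm (Bs n)) + BV_op_norm (Bs n) (v n)) < \<infinity>"
    using Bs v by simp
  from compact[unfolded compactness_property_def, rule_format, OF this]
  obtain w r B' where "w \<in> BV_op (B' :: 'n operator)" and r: "strict_mono (r :: nat \<Rightarrow> nat)"
    and vlim: "(\<lambda>n. L1_norm (\<lambda>x. v (r n) x - w x)) \<longlonglongrightarrow> 0" by blast
  then have wL: "w \<in> L1" by (simp add: BV_op_iff)
  define T where "T = apply_op B (regular w)"
  define X where "X k = (u (r k), v (r k), apply_op (Bs (r k)) (regular (v (r k))))" for k
  have Slim: "(\<lambda>k. snd (snd (X k)) \<phi>) \<longlonglongrightarrow> T \<phi>" if "\<phi> \<in> test_functions" for \<phi>
    unfolding X_def T_def snd_conv
    by (rule apply_op_regular_tendsto[OF _ vL wL vlim that])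
       (use LIMSEQ_subseq_LIMSEQ[OF Bs(2) r] in \<open>simp add: o_def\<close>)
  let ?H = "midhull midpoint3 (range X)"
  have HL: "fst x \<in> L1 \<and> fst (snd x) \<in> L1" if "x \<in> ?H" for x
    using that
  proof induction
    case (base x)
    then show ?case using uL vL by (auto simp: X_def)
  next
    case (mid x y)
    obtain u1 v1 S1 u2 v2 S2 where xy: "x = (u1, v1, S1)" "y = (u2, v2, S2)" by (metis prod_cases3)
    have "(\<lambda>x. (1/2) *\<^sub>R u1 x + (1/2) *\<^sub>R u2 x) \<in> L1" using mid.IH by (intro L1_lincomb) (auto simp: xy)
    then have "(\<lambda>x. (u1 x + u2 x) / 2) \<in> L1" by (simp add: add_divide_distrib)
    moreover have "(\<lambda>x. (1/2) *\<^sub>R v1 x + (1/2) *\<^sub>R v2 x) \<in> L1" using mid.IH by (intro L1_lincomb) (auto simp: xy)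
    ultimately show ?case by (simp add: xy midpoint3_def)
  qed
  have fst_mid: "fst (midpoint3 x y) = (\<lambda>t. (fst x t + fst y t) / 2)"
    and snd_mid: "fst (snd (midpoint3 x y)) = (\<lambda>t. (1/2) *\<^sub>R fst (snd x) t + (1/2) *\<^sub>R fst (snd y) t)"
    and S_mid: "snd (snd (midpoint3 x y)) = (\<lambda>\<phi>. (1/2) *\<^sub>R snd (snd x) \<phi> + (1/2) *\<^sub>R snd (snd y) \<phi>)"
    for x y :: "'n state"
    by (auto simp: midpoint3_def split: prod.splits)
  have para: "L2_norm_sq (\<lambda>t. fst (midpoint3 x y) t - h t) + ennreal (1/4) * L2_norm_sq (\<lambda>t. fst x t - fst y t)
     = ennreal (1/2) * L2_norm_sq (\<lambda>t. fst x t - h t) + ennreal (1/2) * L2_norm_sq (\<lambda>t. fst y t - h t)"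
    if "x \<in> ?H" "y \<in> ?H" "h \<in> borel_measurable leb_Q" for x y h
    unfolding fst_mid using HL[OF that(1)] HL[OF that(2)] by (intro L2_parallelogram_shifted that(3) L1_borel) auto
  have L2_conv: "L2_norm_sq (\<lambda>t. fst (midpoint3 x y) t - h t)
     \<le> ennreal (1/2) * L2_norm_sq (\<lambda>t. fst x t - h t) + ennreal (1/2) * L2_norm_sq (\<lambda>t. fst y t - h t)"
    if "x \<in> ?H" "y \<in> ?H" "h \<in> borel_measurable leb_Q" for x y h
    unfolding para[OF that, symmetric] by simp
  have half: "ennreal (1/2) * ennreal k + ennreal (1/2) * ennreal k = ennreal k" if "0 \<le> k" for k
    using that by (subst ennreal_lincomb) auto
  have L2K: "L2_norm_sq (\<lambda>t. fst x t - f t) \<le> ennreal K" if "x \<in> ?H" for x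
    using that
  proof induction
    case (base x)
    then show ?case using parts(1) by (auto simp: X_def)
  next
    case (mid x y)
    have "L2_norm_sq (\<lambda>t. fst (midpoint3 x y) t - f t) \<le> ennreal (1/2) * ennreal K + ennreal (1/2) * ennreal K"
      by (intro order_trans[OF L2_conv] add_mono mult_left_mono mid fm) auto
    then show ?case using half[OF K(1)] by simp
  qed
  \<comment> \<open>the strictly convex part of the energy plays the role of the squared norm in the lemma of Mazur\<close>
  define q where "q x = enn2real (L2_norm_sq (\<lambda>t. fst x t - f t))"
    for x :: "'n state"
  define D where "D x y = enn2real (L2_norm_sq (\<lambda>t. fst x t - fst y t))"
    for x y :: "'n state"
  have q: "L2_norm_sq (\<lambda>t. fst x t - f t) = ennreal (q x)" if "x \<in> ?H" for x
    unfolding q_def using le_less_trans[OF L2K[OF that]] by simp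
  have q0: "0 \<le> q x" "0 \<le> D x y" for x y by (simp_all add: q_def D_def)
  have mem: "midpoint3 x y \<in> ?H" if "x \<in> ?H" "y \<in> ?H" for x y by (rule midhull.mid[OF that])
  have D: "L2_norm_sq (\<lambda>t. fst x t - fst y t) = ennreal (D x y)" if "x \<in> ?H" "y \<in> ?H" for x y
  proof -
    have "ennreal (1/4) * L2_norm_sq (\<lambda>t. fst x t - fst y t)
        \<le> L2_norm_sq (\<lambda>t. fst (midpoint3 x y) t - f t) + ennreal (1/4) * L2_norm_sq (\<lambda>t. fst x t - fst y t)"
      by simp
    also have "\<dots> = ennreal (1/2) * ennreal (q x) + ennreal (1/2) * ennreal (q y)"
      unfolding para[OF that fm] q[OF that(1)] q[OF that(2)] ..
    also have "\<dots> = ennreal (1/2 * q x + 1/2 * q y)" by (rule ennreal_lincomb) (simp_all add: q0)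
    finally have "ennreal (1/4) * L2_norm_sq (\<lambda>t. fst x t - fst y t) \<le> ennreal (1/2 * q x + 1/2 * q y)" .
    then have "L2_norm_sq (\<lambda>t. fst x t - fst y t) \<le> ennreal ((1/2 * q x + 1/2 * q y) / (1/4))"
      by (rule cancel_weight) (simp_all add: q0)
    then have "L2_norm_sq (\<lambda>t. fst x t - fst y t) < top" by (rule le_less_trans) simp
    then show ?thesis by (simp add: D_def)
  qed
  obtain y where y: "\<And>n. y n \<in> midhull midpoint3 (X ` {n..})"
    and yD: "\<And>e. e > 0 \<Longrightarrow> \<exists>N. \<forall>n\<ge>N. \<forall>m\<ge>n. D (y n) (y m) < e"
  proof (rule mazur_midpoint[of midpoint3 X q K D])
    show "0 \<le> q x \<and> q x \<le> K" if "x \<in> ?H" for x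
      using L2K[OF that] q0 K(1) unfolding q[OF that] by simp
    show "q (midpoint3 x y) + D x y / 4 \<le> (q x + q y) / 2" if "x \<in> ?H" "y \<in> ?H" for x y
    proof -
      have "ennreal 1 * ennreal (q (midpoint3 x y)) + ennreal (1/4) * ennreal (D x y)
          = ennreal (1/2) * ennreal (q x) + ennreal (1/2) * ennreal (q y)"
        using para[OF that fm] unfolding q[OF that(1)] q[OF that(2)] q[OF mem[OF that]] D[OF that]
        by (simp only: ennreal_1 mult_1)
      then have "ennreal (1 * q (midpoint3 x y) + 1/4 * D x y) = ennreal (1/2 * q x + 1/2 * q y)"
        by (subst (asm) (1 2) ennreal_lincomb) (simp_all add: q0)
      then show ?thesis using q0 by (subst (asm) ennreal_inj) auto
    qed
  qed (rule that)
  have yH: "y n \<in> ?H" for n by (rule midhull_mono[OF y]) auto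
  define U where "U n = fst (y n)" for n
  define V where "V n = fst (snd (y n))" for n
  define S where "S n = snd (snd (y n))" for n
  have yUVS: "y n = (U n, V n, S n)" for n by (simp add: U_def V_def S_def)
  have UL: "U n \<in> L1" and VL: "V n \<in> L1" for n using HL[OF yH] by (simp_all add: U_def V_def)
  obtain s w0 where s: "strict_mono (s :: nat \<Rightarrow> nat)" and w0m: "w0 \<in> borel_measurable leb_Q"
    and ae: "AE x in leb_Q. (\<lambda>n. U (s n) x) \<longlonglongrightarrow> w0 x" and Ulim2: "(\<lambda>n. L2_norm_sq (\<lambda>x. U n x - w0 x)) \<longlonglongrightarrow> 0"
  proof (rule L2_complete[of U])
    show "U n \<in> borel_measurable leb_Q" for n by (rule L1_borel[OF UL])
    fix e :: real assume "e > 0"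
    then obtain N where "\<forall>n\<ge>N. \<forall>m\<ge>n. D (y n) (y m) < e" using yD by blast
    then show "\<exists>N. \<forall>n\<ge>N. \<forall>m\<ge>n. L2_norm_sq (\<lambda>x. U n x - U m x) < ennreal e"
      unfolding U_def D[OF yH yH] using \<open>e > 0\<close> by (auto simp: ennreal_less_iff q0)
  qed (rule that)
  have Ulim: "(\<lambda>n. L1_norm (\<lambda>x. U n x - w0 x)) \<longlonglongrightarrow> 0"
    by (rule L1_norm_tendsto_0[OF _ Ulim2]) (intro borel_measurable_diff L1_borel[OF UL] w0m)
  have w0L: "w0 \<in> L1"
  proof -
    have "\<forall>\<^sub>F n in sequentially. L1_norm (\<lambda>x. U n x - w0 x) < top"
      by (rule order_tendstoD(2)[OF Ulim]) simp
    then obtain n where "L1_norm (\<lambda>x. U n x - w0 x) < top" by (auto simp: eventually_sequentially)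
    then have "(\<lambda>x. U n x - w0 x) \<in> L1"
      by (intro L1_I borel_measurable_diff L1_borel[OF UL] w0m)
    from L1_diff[OF UL[of n] this] show ?thesis by simp
  qed
  have Vlim: "(\<lambda>n. L1_norm (\<lambda>x. V n x - w x)) \<longlonglongrightarrow> 0"
  proof (rule ennreal_tendsto_0I)
    fix e :: real assume e: "e > 0"
    define b where "b k = enn2real (L1_norm (\<lambda>x. v (r k) x - w x))" for k
    have bk: "L1_norm (\<lambda>x. v (r k) x - w x) = ennreal (b k)" for k
      unfolding b_def using L1_norm_less_top[OF L1_diff[OF vL wL]] by simp
    have "(\<lambda>k. ennreal (b k)) \<longlonglongrightarrow> ennreal 0" using vlim by (simp add: bk)
    then have b0: "b \<longlonglongrightarrow> 0" by (subst (asm) tendsto_ennreal_iff) (simp_all add: b_def)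
    have "\<forall>\<^sub>F n in sequentially. L1_norm (\<lambda>t. fst (snd (y n)) t - w t) \<le> ennreal (0 + e)"
    proof (rule midhull_convex_limit[OF y _ _ b0 e, where F="\<lambda>x. L1_norm (\<lambda>t. fst (snd x) t - w t)"])
      show "L1_norm (\<lambda>t. fst (snd (midpoint3 x z)) t - w t)
          \<le> ennreal (1/2) * L1_norm (\<lambda>t. fst (snd x) t - w t) + ennreal (1/2) * L1_norm (\<lambda>t. fst (snd z) t - w t)"
        if "x \<in> ?H" "z \<in> ?H" for x z
        unfolding snd_mid using HL[OF that(1)] HL[OF that(2)] wL by (intro L1_norm_midpoint_le) auto
      show "L1_norm (\<lambda>t. fst (snd (X k)) t - w t) \<le> ennreal (b k)" for k
        by (simp add: X_def bk)
    qed
    then show "\<forall>\<^sub>F n in sequentially. L1_norm (\<lambda>x. V n x - w x) \<le> ennreal e" by (simp add: V_def)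
  qed
  have Sconv: "(\<lambda>n. S n \<phi>) \<longlonglongrightarrow> T \<phi>" if \<phi>: "\<phi> \<in> test_functions" for \<phi>
  proof -
    have b0: "(\<lambda>k. norm (snd (snd (X k)) \<phi> - T \<phi>)) \<longlonglongrightarrow> 0"
      using Slim[OF \<phi>] by (simp add: tendsto_norm_zero_iff LIM_zero_iff)
    have "(\<lambda>n. ennreal (norm (S n \<phi> - T \<phi>))) \<longlonglongrightarrow> 0"
    proof (rule ennreal_tendsto_0I)
      fix e :: real assume e: "e > 0"
      have "\<forall>\<^sub>F n in sequentially. ennreal (norm (snd (snd (y n)) \<phi> - T \<phi>)) \<le> ennreal (0 + e)"
      proof (rule midhull_convex_limit[OF y _ _ b0 e, where F="\<lambda>x. ennreal (norm (snd (snd x) \<phi> - T \<phi>))"])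
        fix x z :: "'n state"
        let ?a = "snd (snd x) \<phi>" and ?b = "snd (snd z) \<phi>"
        have "T \<phi> = (1/2) *\<^sub>R T \<phi> + (1/2) *\<^sub>R T \<phi>" unfolding scaleR_add_left[symmetric] by simp
        then have "(1/2) *\<^sub>R ?a + (1/2) *\<^sub>R ?b - T \<phi> = (1/2) *\<^sub>R ?a + (1/2) *\<^sub>R ?b - ((1/2) *\<^sub>R T \<phi> + (1/2) *\<^sub>R T \<phi>)"
          by (rule arg_cong)
        also have "\<dots> = (1/2) *\<^sub>R (?a - T \<phi>) + (1/2) *\<^sub>R (?b - T \<phi>)" unfolding scaleR_diff_right by simp
        finally have "norm (snd (snd (midpoint3 x z)) \<phi> - T \<phi>) \<le> 1/2 * norm (?a - T \<phi>) + 1/2 * norm (?b - T \<phi>)"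
          unfolding S_mid using norm_triangle_ineq[of "(1/2) *\<^sub>R (?a - T \<phi>)" "(1/2) *\<^sub>R (?b - T \<phi>)"] by simp
        then have "ennreal (norm (snd (snd (midpoint3 x z)) \<phi> - T \<phi>)) \<le> ennreal (1/2 * norm (?a - T \<phi>) + 1/2 * norm (?b - T \<phi>))"
          by (rule ennreal_leI)
        also have "\<dots> = ennreal (1/2) * ennreal (norm (?a - T \<phi>)) + ennreal (1/2) * ennreal (norm (?b - T \<phi>))"
          by (rule ennreal_lincomb[symmetric]) simp_all
        finally show "ennreal (norm (snd (snd (midpoint3 x z)) \<phi> - T \<phi>))
          \<le> ennreal (1/2) * ennreal (norm (?a - T \<phi>)) + ennreal (1/2) * ennreal (norm (?b - T \<phi>))" .
      qed simp
      then show "\<forall>\<^sub>F n in sequentially. ennreal (norm (S n \<phi> - T \<phi>)) \<le> ennreal e" by (simp add: S_def)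
    qed
    then have "(\<lambda>n. ennreal (norm (S n \<phi> - T \<phi>))) \<longlonglongrightarrow> ennreal 0" by simp
    then have "(\<lambda>n. norm (S n \<phi> - T \<phi>)) \<longlonglongrightarrow> 0" by (subst (asm) tendsto_ennreal_iff) simp_all
    then show ?thesis by (simp add: tendsto_norm_zero_iff LIM_zero_iff)
  qed
  have sub0: "(\<lambda>n. F (s n)) \<longlonglongrightarrow> l" if "F \<longlonglongrightarrow> l" for F :: "nat \<Rightarrow> 'z::topological_space" and l
    using LIMSEQ_subseq_LIMSEQ[OF that s] by (simp add: o_def)
  have liminf_le: "liminf (\<lambda>n. F (y (s n))) \<le> ennreal \<beta>"
    if "\<And>e. e > 0 \<Longrightarrow> \<forall>\<^sub>F n in sequentially. F (y n) \<le> ennreal (\<beta> + e)" "0 \<le> \<beta>" for F \<beta>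
  proof (rule ennreal_le_epsilon)
    fix e :: real assume e: "0 < e"
    have "\<forall>\<^sub>F n in sequentially. F (y (s n)) \<le> ennreal (\<beta> + e)"
      using that(1)[OF e] filterlim_subseq[OF s] by (auto dest: eventually_compose_filterlim)
    then have "liminf (\<lambda>n. F (y (s n))) \<le> ennreal (\<beta> + e)" by (intro Liminf_le) simp_all
    then show "liminf (\<lambda>n. F (y (s n))) \<le> ennreal \<beta> + ennreal e" using that(2) e by simp
  qed
  have a0: "0 \<le> a0" by (rule LIMSEQ_le_const[OF a(2)]) (use a(3) in auto)
  have energy: "energy f \<alpha> (w0, w, T) \<le> ennreal a0"
  proof -
    \<comment> \<open>the energy with the limit weights: the error is controlled because both penalty terms are bounded by K2\<close>
    define b where "b k = a (r k) + (\<bar>fst \<alpha> - fst (\<alpha>s (r k))\<bar> + \<bar>snd \<alpha> - snd (\<alpha>s (r k))\<bar>) * K2" for k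
    have "(\<lambda>n. a n + (\<bar>fst \<alpha> - fst (\<alpha>s n)\<bar> + \<bar>snd \<alpha> - snd (\<alpha>s n)\<bar>) * K2) \<longlonglongrightarrow> a0 + (\<bar>fst \<alpha> - fst \<alpha>\<bar> + \<bar>snd \<alpha> - snd \<alpha>\<bar>) * K2"
      by (intro tendsto_intros a \<alpha>)
    from LIMSEQ_subseq_LIMSEQ[OF this r] have b0: "b \<longlonglongrightarrow> a0" by (simp add: o_def b_def[abs_def])
    have ev: "\<forall>\<^sub>F n in sequentially. energy f \<alpha> (y n) \<le> ennreal (a0 + e)" if e: "e > 0" for e
    proof (rule midhull_convex_limit[OF y _ _ b0 e])
      show "energy f \<alpha> (midpoint3 x z) \<le> ennreal (1/2) * energy f \<alpha> x + ennreal (1/2) * energy f \<alpha> z"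
        if "x \<in> ?H" "z \<in> ?H" for x z
      proof -
        obtain u1 v1 S1 u2 v2 S2 where xz: "x = (u1, v1, S1)" "z = (u2, v2, S2)" by (metis prod_cases3)
        have "u1 \<in> L1" "u2 \<in> L1" "v1 \<in> L1" "v2 \<in> L1" using HL[OF that(1)] HL[OF that(2)] by (simp_all add: xz)
        from energy_midpoint[OF this fm, of \<alpha> S1 S2] show ?thesis
          unfolding xz by (rule order_trans[rotated]) simp
      qed
      show "energy f \<alpha> (X k) \<le> ennreal (b k)" for k
        unfolding X_def b_def by (rule energy_change_weights[OF MK K2 a(1,3)])
    qed
    have "energy f \<alpha> (w0, w, T) \<le> liminf (\<lambda>n. energy f \<alpha> (U (s n), V (s n), S (s n)))"
      by (rule energy_lower_semicontinuous[OF UL w0L fm VL wL ae sub0[OF Ulim] sub0[OF Vlim] sub0[OF Sconv]])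
    also have "\<dots> \<le> ennreal a0"
      using liminf_le[of "energy f \<alpha>", OF ev a0] by (simp add: yUVS)
    finally show ?thesis .
  qed
  have cost: "L2_norm_sq (\<lambda>x. w0 x - g x) \<le> ennreal c0"
  proof -
    have c': "(\<lambda>n. max 0 (c n)) \<longlonglongrightarrow> max 0 c0" by (intro tendsto_intros c)
    from LIMSEQ_subseq_LIMSEQ[OF this r] have c0': "(\<lambda>k. max 0 (c (r k))) \<longlonglongrightarrow> max 0 c0" by (simp add: o_def)
    have ev: "\<forall>\<^sub>F n in sequentially. L2_norm_sq (\<lambda>t. fst (y n) t - g t) \<le> ennreal (max 0 c0 + e)" if e: "e > 0" for e
    proof (rule midhull_convex_limit[OF y _ _ c0' e, where F="\<lambda>x. L2_norm_sq (\<lambda>t. fst x t - g t)"])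
      show "L2_norm_sq (\<lambda>t. fst (X k) t - g t) \<le> ennreal (max 0 (c (r k)))" for k
        by (simp add: X_def) (rule order_trans[OF c(1)], simp add: ennreal_leI)
    qed (intro L2_conv g, assumption+)
    have "L2_norm_sq (\<lambda>x. w0 x - g x) \<le> liminf (\<lambda>n. L2_norm_sq (\<lambda>x. U (s n) x - g x))"
      by (rule L2_norm_sq_Fatou[OF L1_borel[OF UL] g ae])
    also have "\<dots> \<le> ennreal (max 0 c0)"
      using liminf_le[of "\<lambda>x. L2_norm_sq (\<lambda>t. fst x t - g t)", OF ev] by (simp add: U_def)
    also have "\<dots> = ennreal c0" by (simp add: max_def ennreal_neg)
    finally show ?thesis .
  qed
  have "\<theta> \<le> fst \<alpha>" "\<theta> \<le> snd \<alpha>"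
    using \<theta> by (auto intro!: LIMSEQ_le_const[OF tendsto_fst[OF \<alpha>]] LIMSEQ_le_const[OF tendsto_snd[OF \<alpha>]])
  note parts0 = energy_parts[OF energy \<theta>(1) this a0]
  have wB: "w \<in> BV_op B" using wL le_less_trans[OF parts0(3)] by (auto simp: BV_op_iff T_def)
  have "grad_defect w0 w < top" using le_less_trans[OF parts0(2)] by simp
  then have "\<exists>\<mu>. represents \<mu> (distr_grad (regular w0))"
    using represents_add_regular[OF _ wL] by (auto simp: Mb_norm_less_top_iff)
  then have "w0 \<in> BV" using w0L by (simp add: BV_def)
  moreover have "level2_functional f \<alpha> B w0 \<le> ennreal a0"
    using order_trans[OF level2_functional_le_energy[OF wB]] energy by (simp add: T_def)
  ultimately show ?thesis using cost by blast
qed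

section \<open>The lower level problem\<close>

lemma zero_admissible:
  fixes f :: "real^'n::finite \<Rightarrow> real" and B :: "'n operator"
  shows "(\<lambda>x. 0) \<in> (BV :: (real^'n \<Rightarrow> real) set)"
    and "level2_functional f \<alpha> B (\<lambda>x. 0) \<le> L2_norm_sq f"
proof -
  have Mb0: "Mb_norm S = 0" if "\<And>\<phi>. \<phi> \<in> test_functions \<Longrightarrow> S \<phi> = 0" for S :: "('n, 'x::euclidean_space) functional"
  proof -
    have z: "(\<lambda>x::real^'n. 0::'x) \<in> L1" by (simp add: L1_def)
    have "Mb_norm S = Mb_norm (regular (\<lambda>x::real^'n. 0::'x))"
      by (rule Mb_norm_cong) (simp add: that regular_def)
    also have "\<dots> \<le> L1_norm (\<lambda>x::real^'n. 0::'x)" by (rule Mb_norm_regular[OF z])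
    also have "\<dots> = 0" by (simp add: L1_norm_def)
    finally show ?thesis by simp
  qed
  have r0: "regular (\<lambda>x::real^'n. 0::'x::euclidean_space) \<phi> = 0" for \<phi> by (simp add: regular_def)
  have g0: "distr_grad (regular (\<lambda>x::real^'n. 0)) \<phi> = 0" for \<phi>
    by (simp add: vec_eq_iff distr_grad_nth r0)
  have a0: "apply_op B (regular (\<lambda>x::real^'n. 0)) \<phi> = 0" for \<phi>
    by (simp add: vec_eq_iff apply_op_nth r0)
  show "(\<lambda>x. 0) \<in> (BV :: (real^'n \<Rightarrow> real) set)"
    by (simp add: BV_iff Mb0 g0) (simp add: L1_def)
  have v0: "(\<lambda>x. 0) \<in> BV_op B"
    by (simp add: BV_op_iff Mb0 a0) (simp add: L1_def)
  have "level2_functional f \<alpha> B (\<lambda>x. 0) \<le> energy f \<alpha> (\<lambda>x. 0, \<lambda>x. 0, apply_op B (regular (\<lambda>x. 0)))"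
    by (rule level2_functional_le_energy[OF v0])
  also have "\<dots> = L2_norm_sq f"
    by (simp add: energy_def Mb0 g0 r0 a0) (simp add: L2_norm_sq_def)
  finally show "level2_functional f \<alpha> B (\<lambda>x. 0) \<le> L2_norm_sq f" .
qed

lemma level2_minimum_finite:
  assumes f: "f \<in> L2" and u: "is_level2_solution f \<alpha> B u"
  shows "level2_functional f \<alpha> B u \<le> L2_norm_sq f" "level2_functional f \<alpha> B u < top"
proof -
  have "level2_functional f \<alpha> B u \<le> level2_functional f \<alpha> B (\<lambda>x. 0)"
    using u zero_admissible(1) unfolding is_level2_solution_def is_arg_min_def by (auto simp: not_less)
  also have "\<dots> \<le> L2_norm_sq f" by (rule zero_admissible(2))
  finally show "level2_functional f \<alpha> B u \<le> L2_norm_sq f" .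
  then show "level2_functional f \<alpha> B u < top" using L2_norm_sq_less_top[OF f] by (rule le_less_trans)
qed

text \<open>
  A minimizing sequence for fixed weights and a fixed operator is a special case of the situation in
  \<open>level2_limit\<close>; the cost is then taken to be the fidelity term.
\<close>
theorem level2_solution_exists:
  fixes f :: "real^'n \<Rightarrow> real" and B :: "'n::finite operator"
  assumes compact: "compactness_property \<Sigma>" and bounded: "linf_bounded \<Sigma>" and B: "B \<in> \<Sigma>"
    and \<theta>: "0 < \<theta>" "\<theta> \<le> fst \<alpha>" "\<theta> \<le> snd \<alpha>" and f: "f \<in> L2"
  shows "\<exists>u. is_level2_solution f \<alpha> B u"
proof -
  define m where "m = (INF u\<in>BV. level2_functional f \<alpha> B u)"
  have "m \<le> L2_norm_sq f" unfolding m_def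
    by (intro INF_lower2[where i="\<lambda>x. 0"] zero_admissible)
  then have "m < top" using L2_norm_sq_less_top[OF f] by (rule le_less_trans)
  then obtain k where k: "m = ennreal k" "0 \<le> k" by (metis less_top_ennreal)
  define a where "a n = k + 1 / real (Suc n)" for n
  have a0: "0 \<le> a n" for n using k(2) by (simp add: a_def)
  have alim: "a \<longlonglongrightarrow> k"
    using tendsto_add[OF tendsto_const LIMSEQ_inverse_real_of_nat, of k] by (simp add: a_def[abs_def] inverse_eq_divide)
  have "\<exists>u v. u \<in> BV \<and> v \<in> BV_op B \<and> energy f \<alpha> (u, v, apply_op B (regular v)) \<le> ennreal (a n)" for n
  proof -
    have "m < ennreal (a n)" unfolding k(1) using k(2) by (intro ennreal_lessI) (auto simp: a_def add_nonneg_pos)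
    then obtain u where u: "u \<in> BV" "level2_functional f \<alpha> B u < ennreal (a n)"
      unfolding m_def INF_less_iff by blast
    obtain v where "v \<in> BV_op B" "energy f \<alpha> (u, v, apply_op B (regular v)) < ennreal (a n)"
      using level2_functional_less[OF u(2)] by blast
    with u show ?thesis by (auto intro: less_imp_le)
  qed
  then obtain u v where uv: "\<And>n. u n \<in> BV" "\<And>n. v n \<in> BV_op B"
    "\<And>n. energy f \<alpha> (u n, v n, apply_op B (regular (v n))) \<le> ennreal (a n)" by metis
  have "\<exists>w\<in>BV. level2_functional f \<alpha> B w \<le> ennreal k \<and> L2_norm_sq (\<lambda>x. w x - f x) \<le> ennreal k"
    by (rule level2_limit[where Bs="\<lambda>_. B" and \<alpha>s="\<lambda>_. \<alpha>", OF compact bounded B tendsto_const tendsto_const \<theta> f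
          L2_borel[OF f] uv(1,2,3) alim a0 energy_parts(1)[OF uv(3) \<theta> a0] alim])
  then obtain w where w: "w \<in> BV" "level2_functional f \<alpha> B w \<le> m" unfolding k(1) by blast
  have "\<not> level2_functional f \<alpha> B y < level2_functional f \<alpha> B w" if "y \<in> BV" for y
  proof -
    have "m \<le> level2_functional f \<alpha> B y" unfolding m_def by (rule INF_lower[OF that])
    with w(2) show ?thesis by (auto simp: not_less)
  qed
  with w(1) show ?thesis unfolding is_level2_solution_def is_arg_min_def by blast
qed

lemma lincomb_less_top: "x < top \<Longrightarrow> y < top \<Longrightarrow> ennreal a * x + ennreal b * y < top"
  by (simp add: ennreal_mult_less_top)

text \<open>
  By strong convexity the midpoint of two different minimizers would have smaller energy. The
  functional is an infimum over auxiliary fields, hence the argument is run with almost optimal fields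
  and their midpoint.
\<close>
theorem level2_solution_unique:
  fixes f :: "real^'n \<Rightarrow> real" and B :: "'n::finite operator"
  assumes f: "f \<in> L2" and u: "is_level2_solution f \<alpha> B u" and w: "is_level2_solution f \<alpha> B w"
  shows "AE x in leb_Q. u x = w x"
proof -
  have uBV: "u \<in> BV" and wBV: "w \<in> BV" and le: "\<And>y. y \<in> BV \<Longrightarrow> level2_functional f \<alpha> B u \<le> level2_functional f \<alpha> B y"
    "\<And>y. y \<in> BV \<Longrightarrow> level2_functional f \<alpha> B w \<le> level2_functional f \<alpha> B y"
    using u w unfolding is_level2_solution_def is_arg_min_def by (auto simp: not_less)
  have uL: "u \<in> L1" and wL: "w \<in> L1" using uBV wBV by (simp_all add: BV_iff)
  obtain m where m: "level2_functional f \<alpha> B u = ennreal m" "0 \<le> m"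
    using level2_minimum_finite(2)[OF f u] by (metis less_top_ennreal)
  have mw: "level2_functional f \<alpha> B w = ennreal m" using le(1)[OF wBV] le(2)[OF uBV] m(1) by simp
  let ?z = "\<lambda>x. (u x + w x) / 2"
  have zL: "?z \<in> L1"
    using L1_lincomb[OF uL wL, of "1/2" "1/2"] by (simp add: add_divide_distrib)
  have zBV: "?z \<in> BV"
  proof -
    have eq: "?z = (\<lambda>x. 1/2 * u x + 1/2 * w x)" by (auto simp: field_simps)
    have "Mb_norm (distr_grad (regular ?z)) = Mb_norm (\<lambda>\<phi>. (1/2) *\<^sub>R distr_grad (regular u) \<phi> + (1/2) *\<^sub>R distr_grad (regular w) \<phi>)"
      unfolding eq by (intro Mb_norm_cong distr_grad_regular_lincomb uL wL)
    also have "\<dots> \<le> ennreal \<bar>1/2\<bar> * Mb_norm (distr_grad (regular u)) + ennreal \<bar>1/2\<bar> * Mb_norm (distr_grad (regular w))"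
      by (rule Mb_norm_lincomb) auto
    also have "\<dots> < top"
      using uBV wBV by (intro lincomb_less_top) (simp_all add: BV_iff)
    finally show ?thesis using zL by (simp add: BV_iff)
  qed
  have small: "L2_norm_sq (\<lambda>x. u x - w x) \<le> ennreal (4 * e)" if e: "e > 0" for e
  proof -
    have lt: "ennreal m < ennreal (m + e)" using m(2) e by (intro ennreal_lessI) auto
    obtain v where v: "v \<in> BV_op B" "energy f \<alpha> (u, v, apply_op B (regular v)) < ennreal (m + e)"
      using level2_functional_less[of f \<alpha> B u "m + e"] lt unfolding m(1) by blast
    obtain v' where v': "v' \<in> BV_op B" "energy f \<alpha> (w, v', apply_op B (regular v')) < ennreal (m + e)"
      using level2_functional_less[of f \<alpha> B w "m + e"] lt unfolding mw by blast
    have vL: "v \<in> L1" "v' \<in> L1" using v v' by (simp_all add: BV_op_iff)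
    let ?v = "\<lambda>x. (1/2) *\<^sub>R v x + (1/2) *\<^sub>R v' x"
    let ?S = "\<lambda>\<phi>. (1/2) *\<^sub>R apply_op B (regular v) \<phi> + (1/2) *\<^sub>R apply_op B (regular v') \<phi>"
    have S: "Mb_norm (apply_op B (regular ?v)) = Mb_norm ?S"
      by (intro Mb_norm_cong apply_op_regular_lincomb vL)
    have "Mb_norm ?S \<le> ennreal \<bar>1/2\<bar> * Mb_norm (apply_op B (regular v)) + ennreal \<bar>1/2\<bar> * Mb_norm (apply_op B (regular v'))"
      by (rule Mb_norm_lincomb) auto
    also have "\<dots> < top"
      using v(1) v'(1) by (intro lincomb_less_top) (simp_all add: BV_op_iff)
    finally have vB: "?v \<in> BV_op B" using L1_lincomb[OF vL] by (simp add: BV_op_iff S)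
    have "ennreal m \<le> energy f \<alpha> (?z, ?v, apply_op B (regular ?v))"
      unfolding m(1)[symmetric] by (rule order_trans[OF le(1)[OF zBV] level2_functional_le_energy[OF vB]])
    also have "\<dots> = energy f \<alpha> (midpoint3 (u, v, apply_op B (regular v)) (w, v', apply_op B (regular v')))"
      by (simp only: energy_def midpoint3_def prod.case S)
    finally have "ennreal m + ennreal (1/4) * L2_norm_sq (\<lambda>x. u x - w x)
        \<le> ennreal (1/2) * energy f \<alpha> (u, v, apply_op B (regular v)) + ennreal (1/2) * energy f \<alpha> (w, v', apply_op B (regular v'))"
      using energy_midpoint[OF uL wL vL L2_borel[OF f], of \<alpha> "apply_op B (regular v)" "apply_op B (regular v')"]
      by (meson add_right_mono order_trans)
    also have "\<dots> \<le> ennreal (1/2) * ennreal (m + e) + ennreal (1/2) * ennreal (m + e)"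
      using v(2) v'(2) by (intro add_mono mult_left_mono) auto
    also have "\<dots> = ennreal (1/2 * (m + e) + 1/2 * (m + e))" using m(2) e by (intro ennreal_lincomb) auto
    also have "\<dots> = ennreal m + ennreal e" using m(2) e by simp
    finally have "ennreal (1/4) * L2_norm_sq (\<lambda>x. u x - w x) \<le> ennreal e"
      by (subst (asm) ennreal_add_left_cancel_le) auto
    then have "L2_norm_sq (\<lambda>x. u x - w x) \<le> ennreal (e / (1/4))"
      by (rule cancel_weight) (use e in auto)
    then show ?thesis by (simp add: mult.commute)
  qed
  have "L2_norm_sq (\<lambda>x. u x - w x) \<le> 0"
  proof (rule ennreal_le_epsilon)
    fix e :: real assume "0 < e"
    then show "L2_norm_sq (\<lambda>x. u x - w x) \<le> 0 + ennreal e" using small[of "e / 4"] by simp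
  qed
  then have "(\<integral>\<^sup>+x. ennreal ((u x - w x)\<^sup>2) \<partial>leb_Q) = 0" by (simp add: L2_norm_sq_def)
  then have "AE x in leb_Q. ennreal ((u x - w x)\<^sup>2) = 0"
    using L1_borel[OF uL] L1_borel[OF wL] by (subst (asm) nn_integral_0_iff_AE) auto
  then show ?thesis by eventually_elim (simp add: ennreal_eq_0_iff)
qed

section \<open>Recovery along varying operators\<close>

text \<open>
  An almost optimal field for \<open>B\<close> is replaced by a smooth one with nearly the same energy. The smooth field is
  admissible for every operator of the sequence, and its energy depends continuously on weights and
  operator.
\<close>
theorem level2_functional_upper_semicontinuous:
  fixes Bs :: "nat \<Rightarrow> 'n::finite operator"
  assumes approx: "smooth_approximation B" and B: "Bs \<longlonglongrightarrow> B" and \<alpha>: "\<alpha>s \<longlonglongrightarrow> \<alpha>"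
    and pos: "0 < fst \<alpha>" "0 < snd \<alpha>" and u: "u \<in> L1"
    and less: "level2_functional f \<alpha> B u < ennreal a"
  shows "\<forall>\<^sub>F n in sequentially. level2_functional f (\<alpha>s n) (Bs n) u < ennreal a"
proof -
  let ?G = "\<lambda>v. grad_defect u v"
  obtain v where v: "v \<in> BV_op B" "energy f \<alpha> (u, v, apply_op B (regular v)) < ennreal a"
    using level2_functional_less[OF less] by blast
  have vL: "v \<in> L1" using v by (simp add: BV_op_iff)
  have "energy f \<alpha> (u, v, apply_op B (regular v)) < top" by (rule less_trans[OF v(2)]) simp
  then have fin: "L2_norm_sq (\<lambda>x. u x - f x) < top" "ennreal (fst \<alpha>) * ?G v < top" "ennreal (snd \<alpha>) * Mb_norm (apply_op B (regular v)) < top"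
    unfolding energy_def prod.case by simp_all
  have "?G v < top" "Mb_norm (apply_op B (regular v)) < top"
    using fin(2,3) pos by (auto simp: ennreal_mult_less_top)
  note G_fin = this(1) and M_fin = this(2)
  obtain x where x: "L2_norm_sq (\<lambda>x. u x - f x) = ennreal x" "0 \<le> x"
    using fin(1) unfolding less_top_ennreal by blast
  obtain p where p: "?G v = ennreal p" "0 \<le> p"
    using G_fin unfolding less_top_ennreal by blast
  obtain q where q: "Mb_norm (apply_op B (regular v)) = ennreal q" "0 \<le> q"
    using M_fin unfolding less_top_ennreal by blast
  have "energy f \<alpha> (u, v, apply_op B (regular v)) = ennreal (x + fst \<alpha> * p + snd \<alpha> * q)"
    unfolding energy_def prod.case x(1) p(1) q(1) using x p q pos by (simp add: ennreal_mult)
  with v(2) have "ennreal (x + fst \<alpha> * p + snd \<alpha> * q) < ennreal a" by (simp only:)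
  then have gap: "x + fst \<alpha> * p + snd \<alpha> * q < a"
    using x(2) p(2) q(2) pos by (subst (asm) ennreal_less_iff) simp_all
  define d where "d = a - (x + fst \<alpha> * p + snd \<alpha> * q)"
  define \<epsilon> where "\<epsilon> = d / 2 / (fst \<alpha> + snd \<alpha>)"
  have d: "d > 0" using gap by (simp add: d_def)
  have sum_pos: "fst \<alpha> + snd \<alpha> > 0" using pos by simp
  then have \<epsilon>: "\<epsilon> > 0" using d by (simp add: \<epsilon>_def)
  have "(fst \<alpha> + snd \<alpha>) * \<epsilon> = d / 2"
    unfolding \<epsilon>_def using sum_pos by (intro nonzero_mult_div_cancel_left[of "fst \<alpha> + snd \<alpha>" "d/2", unfolded times_divide_eq_right[symmetric]]) simp
  moreover have "x + fst \<alpha> * (p + \<epsilon>) + snd \<alpha> * (q + \<epsilon>) = (x + fst \<alpha> * p + snd \<alpha> * q) + (fst \<alpha> + snd \<alpha>) * \<epsilon>"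
    by (simp add: distrib_left distrib_right)
  ultimately have "x + fst \<alpha> * (p + \<epsilon>) + snd \<alpha> * (q + \<epsilon>) = (x + fst \<alpha> * p + snd \<alpha> * q) + d / 2"
    by (simp only:)
  also have "\<dots> < (x + fst \<alpha> * p + snd \<alpha> * q) + d" using d by simp
  also have "\<dots> = a" by (simp add: d_def)
  finally have gap': "x + fst \<alpha> * (p + \<epsilon>) + snd \<alpha> * (q + \<epsilon>) < a" .
  obtain us where us: "\<And>n. smooth (us n)" "(\<lambda>n. L1_norm (\<lambda>x. us n x - v x)) \<longlonglongrightarrow> 0"
    "(\<lambda>n. Mb_norm (apply_op B (regular (us n)))) \<longlonglongrightarrow> Mb_norm (apply_op B (regular v))"
    using approx v(1) unfolding smooth_approximation_def by blast
  have "\<forall>\<^sub>F n in sequentially. L1_norm (\<lambda>x. us n x - v x) < ennreal \<epsilon>"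
    using \<epsilon> by (intro order_tendstoD(2)[OF us(2)]) simp
  moreover have "\<forall>\<^sub>F n in sequentially. Mb_norm (apply_op B (regular (us n))) < ennreal (q + \<epsilon>)"
    using \<epsilon> q(2) by (intro order_tendstoD(2)[OF us(3)]) (simp add: q(1) ennreal_less_iff)
  ultimately have "\<forall>\<^sub>F n in sequentially. L1_norm (\<lambda>x. us n x - v x) < ennreal \<epsilon> \<and> Mb_norm (apply_op B (regular (us n))) < ennreal (q + \<epsilon>)"
    by (rule eventually_conj)
  then obtain k where k: "L1_norm (\<lambda>x. us k x - v x) < ennreal \<epsilon>" "Mb_norm (apply_op B (regular (us k))) < ennreal (q + \<epsilon>)"
    by (auto simp: eventually_sequentially)
  define s where "s = us k"
  have s: "smooth s" and sL: "s \<in> L1" using us(1) smooth_L1 by (auto simp: s_def)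
  have Gs: "?G s \<le> ennreal (p + \<epsilon>)"
  proof -
    have "?G s = Mb_norm (\<lambda>\<phi>. (distr_grad (regular u) \<phi> - regular v \<phi>) + regular (\<lambda>x. v x - s x) \<phi>)"
      by (rule Mb_norm_cong) (simp add: regular_diff[OF vL sL])
    also have "\<dots> \<le> ?G v + Mb_norm (regular (\<lambda>x. v x - s x))" by (rule Mb_norm_add)
    also have "\<dots> \<le> ennreal p + L1_norm (\<lambda>x. v x - s x)"
      unfolding p(1) by (intro add_mono order_refl Mb_norm_regular L1_diff vL sL)
    also have "L1_norm (\<lambda>x. v x - s x) = L1_norm (\<lambda>x. s x - v x)"
      by (simp add: L1_norm_def norm_minus_commute)
    also have "ennreal p + L1_norm (\<lambda>x. s x - v x) \<le> ennreal p + ennreal \<epsilon>"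
      using k(1) by (intro add_mono order_refl) (simp add: s_def)
    finally show ?thesis using p \<epsilon> by simp
  qed
  obtain G where G: "\<And>B. Mb_norm (apply_op B (regular s)) \<le> ennreal (G * norm B)" "G \<ge> 0"
    using apply_op_smooth[OF s] by blast
  have sB: "s \<in> BV_op B'" for B' using sL le_less_trans[OF G(1)] by (simp add: BV_op_iff)
  define b where "b n = x + fst (\<alpha>s n) * (p + \<epsilon>) + snd (\<alpha>s n) * (q + \<epsilon> + G * norm (Bs n - B))" for n
  have "b \<longlonglongrightarrow> x + fst \<alpha> * (p + \<epsilon>) + snd \<alpha> * (q + \<epsilon> + G * norm (B - B))"
    unfolding b_def by (intro tendsto_intros \<alpha> B)
  then have "\<forall>\<^sub>F n in sequentially. b n < a"
    by (rule order_tendstoD(2)) (use gap' in simp)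
  moreover have "\<forall>\<^sub>F n in sequentially. 0 < fst (\<alpha>s n)" "\<forall>\<^sub>F n in sequentially. 0 < snd (\<alpha>s n)"
    using order_tendstoD(1)[OF tendsto_fst[OF \<alpha>] pos(1)] order_tendstoD(1)[OF tendsto_snd[OF \<alpha>] pos(2)] by auto
  ultimately show ?thesis
  proof eventually_elim
    case (elim n)
    have "Mb_norm (apply_op (Bs n) (regular s)) = Mb_norm (\<lambda>\<phi>. apply_op B (regular s) \<phi> + apply_op (Bs n - B) (regular s) \<phi>)"
      by (simp add: apply_op_diff)
    also have "\<dots> \<le> Mb_norm (apply_op B (regular s)) + Mb_norm (apply_op (Bs n - B) (regular s))"
      by (rule Mb_norm_add)
    also have "\<dots> \<le> ennreal (q + \<epsilon>) + ennreal (G * norm (Bs n - B))"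
      using k(2) by (intro add_mono G) (simp add: s_def)
    also have "\<dots> = ennreal (q + \<epsilon> + G * norm (Bs n - B))" using q \<epsilon> G(2) by simp
    finally have M: "Mb_norm (apply_op (Bs n) (regular s)) \<le> ennreal (q + \<epsilon> + G * norm (Bs n - B))" .
    have "level2_functional f (\<alpha>s n) (Bs n) u \<le> energy f (\<alpha>s n) (u, s, apply_op (Bs n) (regular s))"
      by (rule level2_functional_le_energy[OF sB])
    also have "\<dots> \<le> ennreal x + ennreal (fst (\<alpha>s n)) * ennreal (p + \<epsilon>) + ennreal (snd (\<alpha>s n)) * ennreal (q + \<epsilon> + G * norm (Bs n - B))"
      unfolding energy_def prod.case x(1) by (intro add_mono order_refl mult_left_mono Gs M) auto
    also have "\<dots> = ennreal (b n)"
      using x p q \<epsilon> G(2) elim by (simp add: b_def ennreal_mult)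
    also have "\<dots> < ennreal a"
    proof (rule ennreal_lessI)
      have "0 \<le> b n" using x(2) p(2) q(2) \<epsilon> G(2) elim(2,3) by (simp add: b_def)
      then show "0 < a" using elim(1) by (rule le_less_trans)
    qed (rule elim(1))
    finally show ?case .
  qed
qed

section \<open>The bilevel scheme\<close>

lemma linf_norm_ge: "norm B \<le> linf_norm B"
  unfolding linf_norm_def norm_vec_def[of B] by (rule L2_set_le_sum) simp

lemma linf_norm_tendsto:
  assumes "Bs \<longlonglongrightarrow> B" shows "(\<lambda>n. linf_norm (Bs n - B)) \<longlonglongrightarrow> 0"
proof -
  have "(\<lambda>n. linf_norm (Bs n - B)) \<longlonglongrightarrow> linf_norm (B - B)"
    unfolding linf_norm_def by (intro tendsto_sum tendsto_norm tendsto_vec_nth tendsto_diff assms tendsto_const)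
  then show ?thesis by (simp add: linf_norm_def)
qed

lemma reconstruction_solution:
  assumes "\<exists>u. is_level2_solution f \<alpha> B u"
  shows "is_level2_solution f \<alpha> B (reconstruction f \<alpha> B)"
  using someI_ex[OF assms] unfolding is_level2_solution_def reconstruction_def arg_min_def .

text \<open>
  Weights and operators of a minimizing sequence range over a compact set. Along a convergent
  subsequence \<open>level2_limit\<close> provides a function \<open>w\<close> that costs no more than the infimum and whose energy is at
  most the limit \<open>a0\<close> of the minimal energies. By upper semicontinuity no competitor for the limit
  problem has energy below \<open>a0\<close>. So \<open>w\<close> solves the limit problem, and by uniqueness it agrees with the
  reconstruction.
\<close>
theorem level1_minimizer_exists:
  fixes f uc :: "real^'n \<Rightarrow> real" and \<Sigma> :: "'n::finite operator set"
  assumes \<theta>: "0 < \<theta>" "\<theta> < 1" and f: "f \<in> L2" and uc: "uc \<in> borel_measurable leb_Q"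
    and \<Sigma>: "training_set \<Sigma>" "\<Sigma> \<noteq> {}"
  shows "\<exists>p. is_arg_min (level1_cost uc f) (\<lambda>p. p \<in> ({\<theta>..1/\<theta>} \<times> {\<theta>..1/\<theta>}) \<times> \<Sigma>) p"
proof -
  let ?D = "({\<theta>..1/\<theta>} \<times> {\<theta>..1/\<theta>}) \<times> \<Sigma>"
  have Pi: "\<Sigma> \<subseteq> Pi_ops" and closed: "linf_closed \<Sigma>" and bounded: "linf_bounded \<Sigma>" and compact: "compactness_property \<Sigma>"
    using \<Sigma>(1) by (auto simp: training_set_def)
  have sol: "is_level2_solution f \<alpha> B (reconstruction f \<alpha> B)"
    if "\<alpha> \<in> {\<theta>..1/\<theta>} \<times> {\<theta>..1/\<theta>}" "B \<in> \<Sigma>" for \<alpha> B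
    by (intro reconstruction_solution level2_solution_exists[OF compact bounded that(2) \<theta>(1) _ _ f]) (use that(1) in auto)
  define m where "m = (INF p\<in>?D. level1_cost uc f p)"
  \<comment> \<open>the interval of admissible weights is not empty\<close>
  have "\<theta> * \<theta> \<le> 1 * 1" using \<theta> by (intro mult_mono) auto
  then have "\<theta> \<le> 1/\<theta>" using \<theta> by (simp add: field_simps)
  then obtain p0 where p0: "p0 \<in> ?D" using \<Sigma>(2) by fastforce
  show ?thesis
  proof (cases "m = top")
    case True
    have "\<not> level1_cost uc f p < level1_cost uc f p0" if "p \<in> ?D" for p
    proof -
      have "m \<le> level1_cost uc f p" unfolding m_def by (rule INF_lower[OF that])
      then show ?thesis using True by (simp add: top_unique)
    qed
    then show ?thesis using p0 unfolding is_arg_min_def by blast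
  next
    case False
    then obtain c0 where c0: "m = ennreal c0" "0 \<le> c0" by (cases m) auto
    define c where "c n = c0 + 1 / real (Suc n)" for n
    have clim: "c \<longlonglongrightarrow> c0"
      using tendsto_add[OF tendsto_const LIMSEQ_inverse_real_of_nat, of c0] by (simp add: c_def[abs_def] inverse_eq_divide)
    have "\<exists>p\<in>?D. level1_cost uc f p < ennreal (c n)" for n
    proof -
      have "m < ennreal (c n)" unfolding c0(1) using c0(2) by (intro ennreal_lessI) (auto simp: c_def add_nonneg_pos)
      then show ?thesis unfolding m_def INF_less_iff by blast
    qed
    then obtain p where p: "\<And>n. p n \<in> ?D" "\<And>n. level1_cost uc f (p n) < ennreal (c n)" by metis
    obtain L where L: "\<And>B. B \<in> \<Sigma> \<Longrightarrow> linf_norm B \<le> L" using bounded by (auto simp: linf_bounded_def)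
    define u where "u n = reconstruction f (fst (p n)) (snd (p n))" for n
    have us: "is_level2_solution f (fst (p n)) (snd (p n)) (u n)" for n
      unfolding u_def using p(1)[of n] by (intro sol) (auto simp: mem_Times_iff)
    define a where "a n = enn2real (level2_functional f (fst (p n)) (snd (p n)) (u n))" for n
    have an: "level2_functional f (fst (p n)) (snd (p n)) (u n) = ennreal (a n)" for n
      unfolding a_def using level2_minimum_finite(2)[OF f us] by simp
    obtain l where l: "L2_norm_sq f = ennreal l" "0 \<le> l" using L2_norm_sq_less_top[OF f] by (metis less_top_ennreal)
    have a_bounds: "0 \<le> a n" "a n \<le> l" for n
    proof -
      show "0 \<le> a n" by (simp add: a_def)
      have "ennreal (a n) \<le> ennreal l"
        using level2_minimum_finite(1)[OF f us[of n]] unfolding an l(1) .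
      then show "a n \<le> l" using l(2) by simp
    qed
    \<comment> \<open>The minimal energies are bounded by the energy of the zero function, and are made convergent
      together with weights and operators.\<close>
    let ?K = "(({\<theta>..1/\<theta>} \<times> {\<theta>..1/\<theta>}) \<times> cball (0 :: 'n operator) L) \<times> {0..l}"
    have K: "compact ?K" by (intro compact_Times) auto
    have inK: "(p n, a n) \<in> ?K" for n
    proof -
      have "norm (snd (p n)) \<le> L" using p(1)[of n] by (intro order_trans[OF linf_norm_ge L]) (auto simp: mem_Times_iff)
      then show ?thesis using p(1)[of n] a_bounds[of n] by (auto simp: mem_Times_iff)
    qed
    obtain lim r where lim: "lim \<in> ?K" and r: "strict_mono (r :: nat \<Rightarrow> nat)" and conv: "((\<lambda>n. (p n, a n)) \<circ> r) \<longlonglongrightarrow> lim"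
      by (rule seq_compactE[OF compact_imp_seq_compact[OF K], of "\<lambda>n. (p n, a n)"]) (use inK in blast)+
    obtain \<alpha> B a0 where lim_eq: "lim = ((\<alpha>, B), a0)" by (metis prod.exhaust)
    have conv': "(\<lambda>n. (p (r n), a (r n))) \<longlonglongrightarrow> ((\<alpha>, B), a0)" using conv by (simp add: o_def lim_eq)
    have \<alpha>lim: "(\<lambda>n. fst (p (r n))) \<longlonglongrightarrow> \<alpha>" using tendsto_fst[OF tendsto_fst[OF conv']] by simp
    have Blim: "(\<lambda>n. snd (p (r n))) \<longlonglongrightarrow> B" using tendsto_snd[OF tendsto_fst[OF conv']] by simp
    have alim: "(\<lambda>n. a (r n)) \<longlonglongrightarrow> a0" using tendsto_snd[OF conv'] by simp
    have a00: "0 \<le> a0" and \<alpha>D: "\<alpha> \<in> {\<theta>..1/\<theta>} \<times> {\<theta>..1/\<theta>}" using lim by (simp_all add: lim_eq)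
    have pD: "fst (p n) \<in> {\<theta>..1/\<theta>} \<times> {\<theta>..1/\<theta>}" "snd (p n) \<in> \<Sigma>" for n
      using p(1)[of n] by (auto simp: mem_Times_iff)
    have BS: "B \<in> \<Sigma>"
      using closed[unfolded linf_closed_def, rule_format, of "\<lambda>n. snd (p (r n))" B] pD(2) linf_norm_tendsto[OF Blim] by blast
    define b where "b n = a (r n) + 1 / real (Suc n)" for n
    have b0: "0 \<le> b n" for n using a_bounds by (simp add: b_def)
    have blim: "b \<longlonglongrightarrow> a0"
      using tendsto_add[OF alim LIMSEQ_inverse_real_of_nat] by (simp add: b_def[abs_def] inverse_eq_divide)
    have "\<exists>v. v \<in> BV_op (snd (p (r n))) \<and> energy f (fst (p (r n))) (u (r n), v, apply_op (snd (p (r n))) (regular v)) \<le> ennreal (b n)" for n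
    proof -
      have "level2_functional f (fst (p (r n))) (snd (p (r n))) (u (r n)) < ennreal (b n)"
        unfolding an b_def using a_bounds by (intro ennreal_lessI) (auto intro: add_nonneg_pos)
      from level2_functional_less[OF this] show ?thesis by (auto intro: less_imp_le)
    qed
    then obtain v where v: "\<And>n. v n \<in> BV_op (snd (p (r n)))"
      "\<And>n. energy f (fst (p (r n))) (u (r n), v n, apply_op (snd (p (r n))) (regular (v n))) \<le> ennreal (b n)" by metis
    have uBV: "u n \<in> BV" for n using us[of n] by (simp add: is_level2_solution_def is_arg_min_def)
    have cost: "L2_norm_sq (\<lambda>x. u (r n) x - uc x) \<le> ennreal (c (r n))" for n
      using p(2)[of "r n"] by (simp add: level1_cost_def u_def L2_norm_sq_minus_commute[of uc])
    have c_r: "(\<lambda>n. c (r n)) \<longlonglongrightarrow> c0" using LIMSEQ_subseq_LIMSEQ[OF clim r] by (simp add: o_def)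
    have th: "\<theta> \<le> fst (fst (p (r n)))" "\<theta> \<le> snd (fst (p (r n)))" for n
      using pD(1)[of "r n"] by (auto simp: mem_Times_iff)
    have "\<exists>w\<in>BV. level2_functional f \<alpha> B w \<le> ennreal a0 \<and> L2_norm_sq (\<lambda>x. w x - uc x) \<le> ennreal c0"
      by (rule level2_limit[where Bs="\<lambda>n. snd (p (r n))" and \<alpha>s="\<lambda>n. fst (p (r n))" and u="\<lambda>n. u (r n)",
            OF compact bounded pD(2) Blim \<alpha>lim \<theta>(1) th f uc uBV v blim b0 cost c_r])
    then obtain w where w: "w \<in> BV" "level2_functional f \<alpha> B w \<le> ennreal a0" "L2_norm_sq (\<lambda>x. w x - uc x) \<le> ennreal c0"
      by blast
    have pos: "0 < fst \<alpha>" "0 < snd \<alpha>" using \<alpha>D \<theta>(1) by (auto simp: mem_Times_iff)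
    have approx: "smooth_approximation B" using BS Pi by (auto simp: Pi_ops_def)
    have w_min: "ennreal a0 \<le> level2_functional f \<alpha> B y" if y: "y \<in> BV" for y
    proof (rule ccontr)
      assume "\<not> ennreal a0 \<le> level2_functional f \<alpha> B y"
      then have "level2_functional f \<alpha> B y < ennreal a0" by simp
      then obtain z where z: "level2_functional f \<alpha> B y < z" "z < ennreal a0" using dense by blast
      then obtain z' where z': "z = ennreal z'" "0 \<le> z'" by (cases z) auto
      have za: "z' < a0" using z(2) z' by (simp add: ennreal_less_iff)
      have "y \<in> L1" using y by (simp add: BV_iff)
      from level2_functional_upper_semicontinuous[OF approx Blim \<alpha>lim pos this z(1)[unfolded z'(1)]]
      have "\<forall>\<^sub>F n in sequentially. a (r n) \<le> z'"
      proof eventually_elim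
        case (elim n)
        have "ennreal (a (r n)) \<le> level2_functional f (fst (p (r n))) (snd (p (r n))) y"
          unfolding an[symmetric] using us[of "r n"] y by (auto simp: is_level2_solution_def is_arg_min_def not_less)
        also have "\<dots> \<le> ennreal z'" using elim by simp
        finally show ?case using z'(2) by simp
      qed
      then have "a0 \<le> z'" by (intro tendsto_upperbound[OF alim]) simp_all
      with za show False by simp
    qed
    have "is_level2_solution f \<alpha> B w"
      unfolding is_level2_solution_def is_arg_min_def using w(1) order_trans[OF w(2) w_min] by (auto simp: not_less)
    then have ae: "AE x in leb_Q. w x = reconstruction f \<alpha> B x"
      by (rule level2_solution_unique[OF f _ sol[OF \<alpha>D BS]])
    have "level1_cost uc f (\<alpha>, B) = L2_norm_sq (\<lambda>x. w x - uc x)"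
      unfolding level1_cost_def fst_conv snd_conv L2_norm_sq_minus_commute[of uc] L2_norm_sq_def
      by (rule nn_integral_cong_AE) (use ae in eventually_elim, simp)
    then have le: "level1_cost uc f (\<alpha>, B) \<le> m" using w(3) by (simp add: c0(1))
    have "\<not> level1_cost uc f y < level1_cost uc f (\<alpha>, B)" if "y \<in> ?D" for y
    proof -
      have "m \<le> level1_cost uc f y" unfolding m_def by (rule INF_lower[OF that])
      with le show ?thesis by (auto simp: not_less)
    qed
    moreover have "(\<alpha>, B) \<in> ?D" using \<alpha>D BS by simp
    ultimately show ?thesis unfolding is_arg_min_def by blast
  qed
qed

theorem theorem1p1:
  fixes \<theta> :: real
    and u\<eta> uc :: "real^'n \<Rightarrow> real"
    and \<Sigma> :: "'n::finite operator set"
  assumes "0 < \<theta>" and "\<theta> < 1"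
    and "u\<eta> \<in> L2"
    and "uc \<in> BV"
    and "training_set \<Sigma>"
    and "\<Sigma> \<noteq> {}"
  shows "(\<forall>\<alpha> \<in> {\<theta>..1/\<theta>} \<times> {\<theta>..1/\<theta>}. \<forall>B \<in> \<Sigma>.
            (\<exists>u. is_level2_solution u\<eta> \<alpha> B u) \<and>
            (\<forall>u w. is_level2_solution u\<eta> \<alpha> B u \<and> is_level2_solution u\<eta> \<alpha> B w
                \<longrightarrow> (AE x in leb_Q. u x = w x))) \<and>
         (\<exists>\<alpha>t Bt.
            is_arg_min (level1_cost uc u\<eta>)
              (\<lambda>p. p \<in> ({\<theta>..1/\<theta>} \<times> {\<theta>..1/\<theta>}) \<times> \<Sigma>) (\<alpha>t, Bt) \<and>
            is_level2_solution u\<eta> \<alpha>t Bt (reconstruction u\<eta> \<alpha>t Bt) \<and>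
            reconstruction u\<eta> \<alpha>t Bt \<in> BV)"
proof -
  have compact: "compactness_property \<Sigma>" and bounded: "linf_bounded \<Sigma>"
    using assms(5) by (simp_all add: training_set_def)
  have ex: "\<exists>u. is_level2_solution u\<eta> \<alpha> B u" if "\<alpha> \<in> {\<theta>..1/\<theta>} \<times> {\<theta>..1/\<theta>}" "B \<in> \<Sigma>" for \<alpha> B
    by (rule level2_solution_exists[OF compact bounded that(2) assms(1) _ _ assms(3)]) (use that(1) in auto)
  have "uc \<in> borel_measurable leb_Q" using assms(4) by (simp add: BV_iff L1_borel)
  from level1_minimizer_exists[OF assms(1-3) this assms(5,6)]
  obtain \<alpha>t Bt where t: "is_arg_min (level1_cost uc u\<eta>) (\<lambda>p. p \<in> ({\<theta>..1/\<theta>} \<times> {\<theta>..1/\<theta>}) \<times> \<Sigma>) (\<alpha>t, Bt)"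
    by auto
  then have "\<alpha>t \<in> {\<theta>..1/\<theta>} \<times> {\<theta>..1/\<theta>}" "Bt \<in> \<Sigma>" by (simp_all add: is_arg_min_def)
  then have sol: "is_level2_solution u\<eta> \<alpha>t Bt (reconstruction u\<eta> \<alpha>t Bt)"
    by (intro reconstruction_solution ex)
  then have "reconstruction u\<eta> \<alpha>t Bt \<in> BV" by (simp add: is_level2_solution_def is_arg_min_def)
  with t sol show ?thesis
    using ex level2_solution_unique[OF assms(3)] by blast
qed

end
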